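(* Let $h \in C^2(\mathbb{R}^{r+p},\mathbb{R}^r)$, $g \in C^2(\mathbb{R}^{r+p},\mathbb{R}^p)$, and consider the semiexplicit differential-algebraic system $$y' = h(y,z), \qquad 0 = g(y,z),$$ with $y=(y_1,\ldots,y_r)\in\mathbb{R}^r$, $z\in\mathbb{R}^p$. Write $E=\begin{pmatrix} I_r & 0\\ 0 & 0\end{pmatrix}\in\mathbb{R}^{(r+p)\times(r+p)}$ and $F=(h,g)$. Assume that the matrix of partial derivatives $g_z(0,0)$ is non-singular and that 1. $h(y_1,0,0)=0$ and $g(y_1,0,0)=0$ for all $y_1$ (here $(y_1,0,0)$ means $y=(y_1,0,\ldots,0)$, $z=0$); 2. the matrix pencil $\lambda E-F'(0,0)$ has a double index-two zero eigenvalue, and $\mathrm{Re}\,\lambda\neq 0$ for each of its remaining eigenvalues $\lambda$; 3. $F''(0,0)\,\overline{p}\,\overline{q}\notin \mathrm{im}\, F'(0,0)$, where $\overline{p}\in\ker F'(0,0)\setminus\{0\}$ and $\overline{q}\in\ker (F'(0,0))^2\setminus\ker F'(0,0)$. Then there exists, locally around the origin, an invariant, two-dimensional, $C^2$ submanifold of $\{g(y,z)=0\}$ through the origin, on which the dynamics admits a local description $u'=\xi(u)$, $u=(u_1,u_2)$ (with the origin of $\mathbb{R}^{r+p}$ corresponding to $u=(0,0)$), where $\xi=(\xi_1,\xi_2)$ is a $C^2$ map defined near $(0,0)$ such that (i) $\xi(u_1,0)=0$ for $u_1$ sufficiently close to $0$; (ii) $\dfrac{\partial \xi_2}{\partial u_2}(0,0)=0$;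 (iii) $\dfrac{\partial \xi_1}{\partial u_2}(0,0)\neq 0$; (iv) $\dfrac{\partial^2 \xi_2}{\partial u_1\partial u_2}(0,0)\neq 0$.
   Context: The eigenvalues of the matrix pencil $\lambda E-F'(0,0)$ are the roots of $\det(\lambda E-F'(0,0))$. A "double index-two zero eigenvalue" of the pencil means that $\lambda=0$ is a root of multiplicity two of this determinant and $\dim\ker F'(0,0)=1$ (a single $2\times 2$ Jordan block). $F''(0,0)\,\overline{p}\,\overline{q}$ denotes the second derivative of $F$ at the origin, as a symmetric bilinear map, evaluated at $(\overline{p},\overline{q})$. Since $g_z(0,0)$ is non-singular, near the origin the set $\{g=0\}$ is a manifold of the form $z=\psi(y)$, and the dynamics of the system on it is that of $y'=h(y,\psi(y))$; "invariant" refers to (local) invariance under this dynamics. *)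

theory Defs
  imports "HOL-Analysis.Analysis" "HOL-Computational_Algebra.Polynomial"
begin

text \<open>
  The space of all variables \<open>(y, z)\<close> is \<open>real ^ ('r + 'p)\<close>: the components \<open>Inl i\<close> form \<open>y\<close>,
  the components \<open>Inr j\<close> form \<open>z\<close>.
\<close>

definition join_vec :: "real ^ 'r \<Rightarrow> real ^ 'p \<Rightarrow> real ^ ('r::finite + 'p::finite)" where
  "join_vec v w = (\<chi> i. case i of Inl a \<Rightarrow> v $ a | Inr b \<Rightarrow> w $ b)"

definition y_part :: "real ^ ('r::finite + 'p::finite) \<Rightarrow> real ^ 'r" where
  "y_part x = (\<chi> a. x $ Inl a)"

definition E_mat :: "real ^ ('r::finite + 'p::finite) ^ ('r + 'p)" where
  "E_mat = (\<chi> i j. case i of Inl _ \<Rightarrow> (if i = j then 1 else 0) | Inr _ \<Rightarrow> 0)"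

definition jacobian_z ::
  "(real ^ ('r::finite + 'p::finite) \<Rightarrow> real ^ 'p) \<Rightarrow> real ^ ('r + 'p) \<Rightarrow> real ^ 'p ^ 'p" where
  "jacobian_z g x = (\<chi> i j. jacobian g (at x) $ i $ Inr j)"

subsection \<open>Matrix pencils\<close>

text \<open>The polynomial \<open>det (z E - A)\<close> in the complex variable \<open>z\<close>.\<close>

definition pencil_poly :: "real ^ 'n ^ 'n \<Rightarrow> real ^ 'n ^ 'n \<Rightarrow> complex poly" where
  "pencil_poly E A =
     det (\<chi> i j. [: - complex_of_real (A $ i $ j), complex_of_real (E $ i $ j) :])"

lemma poly_pencil_poly:
  "poly (pencil_poly E A) z =
     det (\<chi> i j. z * complex_of_real (E $ i $ j) - complex_of_real (A $ i $ j))"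
  by (simp add: pencil_poly_def det_def poly_sum poly_prod algebra_simps)

definition pencil_eigenvalue :: "real ^ 'n ^ 'n \<Rightarrow> real ^ 'n ^ 'n \<Rightarrow> complex \<Rightarrow> bool" where
  "pencil_eigenvalue E A z \<longleftrightarrow> poly (pencil_poly E A) z = 0"

text \<open>
  The value of \<^const>\<open>order\<close> is unspecified for the zero polynomial, hence the first conjunct.
\<close>

definition double_index_two_zero_eigenvalue ::
  "real ^ 'n ^ 'n \<Rightarrow> real ^ 'n ^ 'n \<Rightarrow> bool" where
  "double_index_two_zero_eigenvalue E A \<longleftrightarrow>
     pencil_poly E A \<noteq> 0 \<and> order 0 (pencil_poly E A) = 2 \<and> dim {x. A *v x = 0} = 1"

subsection \<open>Maps of class \<open>C\<^sup>2\<close> and submanifolds\<close>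

text \<open>Intended for open \<open>S\<close>.\<close>

definition C2_on :: "'a::real_normed_vector set \<Rightarrow> ('a \<Rightarrow> 'b::real_normed_vector) \<Rightarrow> bool" where
  "C2_on S f \<longleftrightarrow>
     (\<exists>(f' :: 'a \<Rightarrow> 'a \<Rightarrow>\<^sub>L 'b) (f'' :: 'a \<Rightarrow> 'a \<Rightarrow>\<^sub>L 'a \<Rightarrow>\<^sub>L 'b).
        (\<forall>x\<in>S. (f has_derivative blinfun_apply (f' x)) (at x)) \<and>
        (\<forall>x\<in>S. (f' has_derivative blinfun_apply (f'' x)) (at x)) \<and>
        continuous_on S f'')"

text \<open>The bilinear map \<open>f''(x) p q\<close>, as the derivative along \<open>p\<close> of \<open>y \<mapsto> f'(y) q\<close>.\<close>

definition second_derivative ::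
  "('a::real_normed_vector \<Rightarrow> 'b::real_normed_vector) \<Rightarrow> 'a \<Rightarrow> 'a \<Rightarrow> 'a \<Rightarrow> 'b" where
  "second_derivative f x p q =
     frechet_derivative (\<lambda>y. frechet_derivative f (at y) q) (at x) p"

lemma second_derivative_eq:
  assumes f': "\<And>y. (f has_derivative blinfun_apply (f' y)) (at y)"
    and f'': "(f' has_derivative blinfun_apply f'') (at x)"
  shows "second_derivative f x p q = blinfun_apply (blinfun_apply f'' p) q"
proof -
  have "(\<lambda>y. frechet_derivative f (at y) q) = (\<lambda>y. blinfun_apply (f' y) q)"
    using frechet_derivative_at[OF f'] by metis
  moreover have "((\<lambda>y. blinfun_apply (f' y) q) has_derivative
      (\<lambda>p. blinfun_apply (blinfun_apply f'' p) q)) (at x)"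
    using bounded_linear.has_derivative[OF
        bounded_bilinear.bounded_linear_left[OF bounded_bilinear_blinfun_apply] f''] .
  ultimately show ?thesis
    unfolding second_derivative_def using frechet_derivative_at by metis
qed

definition C2_local_parametrization ::
  "'a::euclidean_space set \<Rightarrow> ('a \<Rightarrow> 'b::euclidean_space) \<Rightarrow> 'b set \<Rightarrow> bool" where
  "C2_local_parametrization U \<phi> M \<longleftrightarrow>
     open U \<and> C2_on U \<phi> \<and> (\<forall>u\<in>U. inj (frechet_derivative \<phi> (at u))) \<and>
     openin (top_of_set M) (\<phi> ` U) \<and> (\<exists>\<psi>. homeomorphism U (\<phi> ` U) \<phi> \<psi>)"

text \<open>Embedded two-dimensional submanifolds of class \<open>C\<^sup>2\<close>.\<close>

definition C2_surface :: "'b::euclidean_space set \<Rightarrow> bool" where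
  "C2_surface M \<longleftrightarrow>
     (\<forall>x\<in>M. \<exists>(U :: (real \<times> real) set) \<phi>. C2_local_parametrization U \<phi> M \<and> x \<in> \<phi> ` U)"

subsection \<open>Dynamics\<close>

definition dae_solution ::
  "(real ^ ('r::finite + 'p::finite) \<Rightarrow> real ^ 'r) \<Rightarrow> (real ^ ('r + 'p) \<Rightarrow> real ^ 'p)
    \<Rightarrow> real set \<Rightarrow> (real \<Rightarrow> real ^ ('r + 'p)) \<Rightarrow> bool" where
  "dae_solution h g J x \<longleftrightarrow>
     continuous_on J x \<and>
     (\<forall>t\<in>J. ((\<lambda>s. y_part (x s)) has_vector_derivative h (x t)) (at t within J) \<and> g (x t) = 0)"

definition ode_solution ::
  "('a::real_normed_vector \<Rightarrow> 'a) \<Rightarrow> real set \<Rightarrow> (real \<Rightarrow> 'a) \<Rightarrow> bool" where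
  "ode_solution \<xi> J u \<longleftrightarrow> (\<forall>t\<in>J. (u has_vector_derivative \<xi> (u t)) (at t within J))"

text \<open>
  Local invariance: a trajectory can leave \<open>M\<close>, forward or backward in time, only by leaving
  some fixed neighbourhood \<open>V\<close> of \<open>M\<close>.
\<close>

definition dae_locally_invariant ::
  "(real ^ ('r::finite + 'p::finite) \<Rightarrow> real ^ 'r) \<Rightarrow> (real ^ ('r + 'p) \<Rightarrow> real ^ 'p)
    \<Rightarrow> (real ^ ('r + 'p)) set \<Rightarrow> bool" where
  "dae_locally_invariant h g M \<longleftrightarrow>
     (\<exists>V. open V \<and> M \<subseteq> V \<and>
        (\<forall>J x. is_interval J \<and> dae_solution h g J x \<and> x ` J \<subseteq> V \<and> (\<exists>t\<in>J. x t \<in> M)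
           \<longrightarrow> x ` J \<subseteq> M))"

text \<open>
  In the coordinates \<open>u \<in> U\<close> given by \<open>\<phi>\<close>, the trajectories of the system on \<open>\<phi> ` U\<close> are
  exactly those of \<open>u' = \<xi>(u)\<close>.
\<close>

definition dae_described_by ::
  "(real ^ ('r::finite + 'p::finite) \<Rightarrow> real ^ 'r) \<Rightarrow> (real ^ ('r + 'p) \<Rightarrow> real ^ 'p)
    \<Rightarrow> 'a::euclidean_space set \<Rightarrow> ('a \<Rightarrow> real ^ ('r + 'p)) \<Rightarrow> ('a \<Rightarrow> 'a) \<Rightarrow> bool" where
  "dae_described_by h g U \<phi> \<xi> \<longleftrightarrow>
     (\<forall>J u. is_interval J \<and> u ` J \<subseteq> U
        \<longrightarrow> (dae_solution h g J (\<phi> \<circ> u) \<longleftrightarrow> ode_solution \<xi> J u))"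

end

theory Submission
  imports Defs "HOL-Computational_Algebra.Fundamental_Theorem_Algebra"
begin

text \<open>
  Near the origin the constraint can be solved for its linear part, and the system becomes
  \<open>y' = B y + N\<^sub>1(y, z)\<close>, \<open>z = L y + N\<^sub>2(y, z)\<close> with \<open>N\<close> vanishing to second order. The
  eigenvalues of \<open>B\<close> are those of the pencil: a double zero with a single Jordan block, spanned by
  \<open>e\<close> (the direction of the line of equilibria) and \<open>q\<close>, and eigenvalues off the imaginary axis.
  The required surface is a centre manifold, and it is obtained by the Lyapunov-Perron method.

  After cutting \<open>N\<close> off outside a small ball (\<open>C2_cutoff\<close>) there remains a globally small
  nonlinearity \<open>G\<close>. Prescribe the two centre coordinates \<open>u = \<pi> (y 0)\<close> and ask for solutions on the
  whole real line whose exponential growth rate stays below the distance of the hyperbolic eigenvalues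
  from the imaginary axis. For the linear equation with a given slow inhomogeneity there is exactly
  one, and it is controlled in every small exponential weight (\<open>slow_linear_solution\<close>). So, for the
  nonlinear equation, the slow solution \<open>X u\<close> is the fixed point of a contraction, and the manifold is
  the set of the points \<open>\<Phi> u = X u 0\<close>.
  Uniqueness gives invariance: a time shift of a slow solution is a slow solution, so all of \<open>X u\<close>
  lies on the manifold, and the vector field is tangent to it (\<open>slow_manifold_exists\<close>).

  The map \<open>u \<mapsto> X u 0\<close> is of class \<open>C\<^sup>2\<close> (\<open>C2_on_X\<close>), although \<open>G\<close> is only \<open>C\<^sup>2\<close>: the candidates
  for the derivatives solve linear equations of the same kind, and the remainders of Taylor's
  formula, which grow like products of the solutions involved, are estimated in the weights with
  exponents \<open>2 \<eta>\<close> and \<open>3 \<eta>\<close>.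

  Local invariance also concerns solutions that merely touch the manifold. The deviation \<open>w\<close> of a
  solution from the manifold satisfies \<open>\<bar>w'\<bar> \<le> K \<bar>w\<bar>\<close> and vanishes once, hence always
  (\<open>zero_of_linear_growth\<close>).

  The conditions on the reduced field \<open>\<xi>(u) = \<pi> (h (\<Phi> u))\<close> come from the invariance equation
  \<open>F(\<Phi> u) = E \<Phi>'(u) \<xi>(u)\<close> (\<open>reduced_field\<close>). Equilibria are slow solutions, so \<open>\<Phi>(s, 0)\<close> is the
  equilibrium \<open>s e\<close> and \<open>\<xi>(s, 0) = 0\<close>. Differentiating the equation in the direction \<open>(0, 1)\<close> along
  this line gives \<open>\<Phi>'(0)(0, 1) = q\<close> and \<open>\<xi>'(0)(0, 1) = (c, 0)\<close>, where \<open>F'(0) q = c e\<close>.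
  Differentiating once more along the line expresses \<open>F''(0) e q\<close>, modulo the image of \<open>F'(0)\<close>, by
  the second component of the mixed derivative of \<open>\<xi>\<close>. So this component cannot vanish.
\<close>

section \<open>Maps of class \<open>C\<^sup>2\<close>\<close>

lemma C2_onE:
  assumes "C2_on UNIV f"
  obtains f' f'' where "\<And>x. (f has_derivative blinfun_apply (f' x)) (at x)"
    "\<And>x. (f' has_derivative blinfun_apply (f'' x)) (at x)" "continuous_on UNIV f''"
  using assms unfolding C2_on_def by blast

lemma C2_onI:
  assumes "\<And>x. (f has_derivative blinfun_apply (f' x)) (at x)"
    "\<And>x. (f' has_derivative blinfun_apply (f'' x)) (at x)" "continuous_on UNIV f''"
  shows "C2_on UNIV f"
  using assms unfolding C2_on_def by blast

lemma C2_on_subset: "C2_on S f \<Longrightarrow> T \<subseteq> S \<Longrightarrow> C2_on T f"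
  unfolding C2_on_def by (meson continuous_on_subset subset_iff)

lemma continuous_on_of_derivative:
  "(\<And>x. (f has_derivative f' x) (at x)) \<Longrightarrow> continuous_on S f"
  by (meson continuous_at_imp_continuous_on has_derivative_continuous)

lemma norm_blinfun_le: "norm (blinfun_apply T y) \<le> b * norm y" if "norm T \<le> b"
  using norm_blinfun[of T y] mult_right_mono[OF that norm_ge_zero[of y]] by linarith

text \<open>
  The typical case is a bilinear map on a product space, whose derivative depends linearly on the base
  point.
\<close>

lemma C2_on_quadratic:
  assumes "\<And>x. (f has_derivative blinfun_apply (L x)) (at x)" "bounded_linear L"
  shows "C2_on UNIV f"
proof (rule C2_onI)
  show "(L has_derivative blinfun_apply (Blinfun L)) (at x)" for x
    using assms(2) by (simp add: bounded_linear_Blinfun_apply bounded_linear_imp_has_derivative)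
qed (use assms in auto)

lemma C2_on_bounded_linear:
  assumes "bounded_linear f" shows "C2_on UNIV f"
proof (rule C2_onI[where f'="\<lambda>_. Blinfun f" and f''="\<lambda>_. 0"])
  show "(f has_derivative blinfun_apply (Blinfun f)) (at x)" for x
    using assms by (simp add: bounded_linear_Blinfun_apply bounded_linear_imp_has_derivative)
qed (auto simp: blinfun.zero_left[abs_def])

lemma C2_on_const: "C2_on UNIV (\<lambda>_. c)"
  by (rule C2_onI[where f'="\<lambda>_. 0" and f''="\<lambda>_. 0"]) (auto simp: blinfun.zero_left[abs_def])

lemma C2_on_add:
  assumes "C2_on UNIV f" "C2_on UNIV g"
  shows "C2_on UNIV (\<lambda>x. f x + g x)"
proof -
  obtain f' f'' where f: "\<And>x. (f has_derivative blinfun_apply (f' x)) (at x)"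
    "\<And>x. (f' has_derivative blinfun_apply (f'' x)) (at x)" "continuous_on UNIV f''"
    by (rule C2_onE[OF assms(1)]) blast
  obtain g' g'' where g: "\<And>x. (g has_derivative blinfun_apply (g' x)) (at x)"
    "\<And>x. (g' has_derivative blinfun_apply (g'' x)) (at x)" "continuous_on UNIV g''"
    by (rule C2_onE[OF assms(2)]) blast
  show ?thesis
  proof (rule C2_onI[where f'="\<lambda>x. f' x + g' x" and f''="\<lambda>x. f'' x + g'' x"])
    show "((\<lambda>x. f x + g x) has_derivative blinfun_apply (f' x + g' x)) (at x)" for x
      using has_derivative_add[OF f(1) g(1)] by (simp add: blinfun.add_left[abs_def])
    show "((\<lambda>x. f' x + g' x) has_derivative blinfun_apply (f'' x + g'' x)) (at x)" for x
      using has_derivative_add[OF f(2) g(2)] by (simp add: blinfun.add_left[abs_def])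
    show "continuous_on UNIV (\<lambda>x. f'' x + g'' x)" by (intro continuous_intros f g)
  qed
qed

lemma C2_on_compose:
  assumes "C2_on UNIV f" "C2_on UNIV g"
  shows "C2_on UNIV (\<lambda>x. g (f x))"
proof -
  obtain f' f'' where f: "\<And>x. (f has_derivative blinfun_apply (f' x)) (at x)"
    "\<And>x. (f' has_derivative blinfun_apply (f'' x)) (at x)" "continuous_on UNIV f''"
    by (rule C2_onE[OF assms(1)]) blast
  obtain g' g'' where g: "\<And>x. (g has_derivative blinfun_apply (g' x)) (at x)"
    "\<And>x. (g' has_derivative blinfun_apply (g'' x)) (at x)" "continuous_on UNIV g''"
    by (rule C2_onE[OF assms(2)]) blast
  note B = bounded_bilinear_blinfun_compose
  \<comment> \<open>composition with a fixed left or right factor, as an operator on derivatives\<close>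
  define l where "l = bounded_bilinear.prod_left ((o\<^sub>L) :: 'b \<Rightarrow>\<^sub>L 'c \<Rightarrow> 'a \<Rightarrow>\<^sub>L 'b \<Rightarrow> 'a \<Rightarrow>\<^sub>L 'c)"
  define r where "r = bounded_bilinear.prod_right ((o\<^sub>L) :: 'b \<Rightarrow>\<^sub>L 'c \<Rightarrow> 'a \<Rightarrow>\<^sub>L 'b \<Rightarrow> 'a \<Rightarrow>\<^sub>L 'c)"
  have l: "blinfun_apply (l b) a = a o\<^sub>L b" for a b
    by (simp add: l_def bounded_bilinear.prod_left.rep_eq[OF B])
  have r: "blinfun_apply (r a) b = a o\<^sub>L b" for a b
    by (simp add: r_def bounded_bilinear.prod_right.rep_eq[OF B])
  have bl: "bounded_linear l" unfolding l_def by (rule bounded_bilinear.bounded_linear_prod_left[OF B])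
  have br: "bounded_linear r" unfolding r_def by (rule bounded_bilinear.bounded_linear_prod_right[OF B])
  show ?thesis
  proof (rule C2_onI[where f'="\<lambda>x. g' (f x) o\<^sub>L f' x"
        and f''="\<lambda>x. (r (g' (f x)) o\<^sub>L f'' x) + (l (f' x) o\<^sub>L (g'' (f x) o\<^sub>L f' x))"])
    fix x
    show "((\<lambda>x. g (f x)) has_derivative blinfun_apply (g' (f x) o\<^sub>L f' x)) (at x)"
      using diff_chain_at[OF f(1)[of x] g(1)[of "f x"]]
      by (simp add: o_def blinfun_compose.rep_eq)
    have 1: "((\<lambda>x. g' (f x)) has_derivative (\<lambda>a. g'' (f x) (f' x a))) (at x)"
      using diff_chain_at[OF f(1)[of x] g(2)[of "f x"]] by (simp add: o_def)
    show "((\<lambda>x. g' (f x) o\<^sub>L f' x) has_derivative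
        blinfun_apply ((r (g' (f x)) o\<^sub>L f'' x) + (l (f' x) o\<^sub>L (g'' (f x) o\<^sub>L f' x)))) (at x)"
      using bounded_bilinear.FDERIV[OF B 1 f(2)[of x]]
      by (simp add: blinfun.add_left[abs_def] l r)
    have cf: "continuous_on UNIV f" "continuous_on UNIV f'" by (rule continuous_on_of_derivative[OF f(1)], rule continuous_on_of_derivative[OF f(2)])
    have cg: "continuous_on UNIV (\<lambda>x. g' (f x))" "continuous_on UNIV (\<lambda>x. g'' (f x))"
      using continuous_on_compose2[OF continuous_on_of_derivative[OF g(2), of UNIV] cf(1)]
        continuous_on_compose2[OF g(3) cf(1)] by auto
    show "continuous_on UNIV (\<lambda>x. (r (g' (f x)) o\<^sub>L f'' x) + (l (f' x) o\<^sub>L (g'' (f x) o\<^sub>L f' x)))"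
      by (intro continuous_on_add bounded_bilinear.continuous_on[OF bounded_bilinear_blinfun_compose]
          bounded_linear.continuous_on[OF bl] bounded_linear.continuous_on[OF br] cf cg f(3))
  qed
qed

lemma C2_on_Pair:
  assumes "C2_on UNIV f" "C2_on UNIV g"
  shows "C2_on UNIV (\<lambda>x. (f x, g x))"
proof -
  have "bounded_linear (\<lambda>x::'b. (x, 0::'c))" "bounded_linear (\<lambda>x::'c. (0::'b, x))"
    by (auto intro!: bounded_linear_intros bounded_linear_Pair)
  then have "C2_on UNIV (\<lambda>x. (f x, 0::'c) + (0::'b, g x))"
    by (intro C2_on_add C2_on_compose[OF assms(1)] C2_on_compose[OF assms(2)] C2_on_bounded_linear)
  then show ?thesis by simp
qed

lemma C2_on_linear_compose:
  assumes "bounded_linear L" "C2_on UNIV f"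
  shows "C2_on UNIV (\<lambda>x. L (f x))"
  by (rule C2_on_compose[OF assms(2) C2_on_bounded_linear[OF assms(1)]])

lemma C2_on_minus:
  assumes "C2_on UNIV f" "C2_on UNIV g"
  shows "C2_on UNIV (\<lambda>x. f x - g x)"
  using C2_on_add[OF assms(1) C2_on_linear_compose[OF bounded_linear_minus[OF bounded_linear_ident] assms(2)]]
  by simp

text \<open>
  The uncurried bilinear map on the product space falls under \<open>C2_on_quadratic\<close>; the rest is the
  chain rule.
\<close>

lemma C2_on_bilinear:
  assumes B: "bounded_bilinear B" and fg: "C2_on UNIV f" "C2_on UNIV g"
  shows "C2_on UNIV (\<lambda>x. B (f x) (g x))"
proof -
  let ?L = "\<lambda>p. (bounded_bilinear.prod_right B (fst p) o\<^sub>L snd_blinfun)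
      + (bounded_bilinear.prod_left B (snd p) o\<^sub>L fst_blinfun)"
  have "C2_on UNIV (\<lambda>p. B (fst p) (snd p))"
  proof (rule C2_on_quadratic)
    show "((\<lambda>p. B (fst p) (snd p)) has_derivative blinfun_apply (?L p)) (at p)" for p
      using bounded_bilinear.FDERIV[OF B has_derivative_fst[OF has_derivative_ident] has_derivative_snd[OF has_derivative_ident], of p UNIV]
      by (simp add: blinfun.add_left[abs_def] bounded_bilinear.prod_left.rep_eq[OF B] bounded_bilinear.prod_right.rep_eq[OF B])
    show "bounded_linear ?L"
      by (intro bounded_linear_add bounded_linear_compose[OF bounded_bilinear.bounded_linear_left[OF bounded_bilinear_blinfun_compose]]
          bounded_linear_compose[OF bounded_bilinear.bounded_linear_prod_right[OF B]]
          bounded_linear_compose[OF bounded_bilinear.bounded_linear_prod_left[OF B]]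
          bounded_linear_fst bounded_linear_snd)
  qed
  from C2_on_compose[OF C2_on_Pair[OF fg] this] show ?thesis by simp
qed

lemma C2_on_real:
  fixes f :: "real \<Rightarrow> real"
  assumes "\<And>x. (f has_real_derivative df x) (at x)" "\<And>x. (df has_real_derivative ddf x) (at x)"
    "continuous_on UNIV ddf"
  shows "C2_on UNIV f"
proof (rule C2_onI[where f'="\<lambda>x. blinfun_scaleR_left (df x)"
      and f''="\<lambda>x. ddf x *\<^sub>R Blinfun blinfun_scaleR_left"])
  fix x
  show "(f has_derivative blinfun_apply (blinfun_scaleR_left (df x))) (at x)"
    using assms(1)[of x] by (simp add: has_field_derivative_def mult_commute_abs)
  have "((\<lambda>x. blinfun_scaleR_left (df x)) has_derivative (\<lambda>a. blinfun_scaleR_left (ddf x * a))) (at x)"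
    using bounded_linear.has_derivative[OF bounded_linear_blinfun_scaleR_left assms(2)[of x, unfolded has_field_derivative_def]] .
  moreover have "blinfun_scaleR_left (ddf x * a) = ddf x *\<^sub>R blinfun_scaleR_left a" for a
    by (rule blinfun_eqI) (simp add: blinfun.bilinear_simps mult_ac)
  ultimately show "((\<lambda>x. blinfun_scaleR_left (df x)) has_derivative
      blinfun_apply (ddf x *\<^sub>R Blinfun blinfun_scaleR_left)) (at x)"
    by (simp add: blinfun.scaleR_left[abs_def] bounded_linear_Blinfun_apply[OF bounded_linear_blinfun_scaleR_left])
qed (intro continuous_intros assms)

section \<open>Cutting off a nonlinearity\<close>

text \<open>
  The exponent 3 is the smallest one for which the truncated power is of class \<open>C\<^sup>2\<close>.
\<close>

definition poscube :: "real \<Rightarrow> real" where "poscube t = max 0 t ^ 3"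

lemma has_derivative_max_power:
  "((\<lambda>t::real. max 0 t ^ Suc (Suc n)) has_real_derivative real (Suc (Suc n)) * max 0 x ^ Suc n) (at x)"
proof (cases "x = 0")
  case True
  have "((\<lambda>t::real. max 0 t ^ Suc (Suc n) / t) \<longlongrightarrow> 0) (at 0)"
  proof (rule tendsto_rabs_zero_cancel, rule tendsto_sandwich[of "\<lambda>_. 0" _ _ "\<lambda>t. \<bar>t\<bar> ^ Suc n"])
    have le: "\<bar>max 0 t ^ Suc (Suc n) / t\<bar> \<le> \<bar>t\<bar> ^ Suc n" for t :: real
    proof (cases "t > 0")
      case False
      then have "\<bar>max 0 t ^ Suc (Suc n) / t\<bar> = 0" by simp
      also have "0 \<le> \<bar>t\<bar> ^ Suc n" by (rule zero_le_power) simp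
      finally show ?thesis .
    qed (auto simp: max_def power_abs)
    show "\<forall>\<^sub>F t::real in at 0. \<bar>max 0 t ^ Suc (Suc n) / t\<bar> \<le> \<bar>t\<bar> ^ Suc n"
      by (intro always_eventually allI le)
    have "((\<lambda>t::real. \<bar>t\<bar> ^ Suc n) \<longlongrightarrow> \<bar>0\<bar> ^ Suc n) (at 0)" by (intro tendsto_intros)
    then show "((\<lambda>t::real. \<bar>t\<bar> ^ Suc n) \<longlongrightarrow> 0) (at 0)" by simp
  qed auto
  then show ?thesis unfolding True by (simp add: has_field_derivative_iff)
next
  case False
  then consider "x > 0" | "x < 0" by linarith
  then show ?thesis
  proof cases
    case 1
    have "((\<lambda>t. t ^ Suc (Suc n)) has_real_derivative real (Suc (Suc n)) * max 0 x ^ Suc n) (at x)"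
      using DERIV_pow[of "Suc (Suc n)" x] 1 by simp
    then show ?thesis unfolding has_field_derivative_def
      by (rule has_derivative_transform_within_open[where s="{0<..}"]) (use 1 in auto)
  next
    case 2
    have "((\<lambda>t. 0::real) has_real_derivative real (Suc (Suc n)) * max 0 x ^ Suc n) (at x)" using 2 by simp
    then show ?thesis unfolding has_field_derivative_def
      by (rule has_derivative_transform_within_open[where s="{..<0}"]) (use 2 in auto)
  qed
qed

lemma C2_on_poscube: "C2_on UNIV poscube"
proof (rule C2_on_real[where df="\<lambda>t. 3 * max 0 t ^ 2" and ddf="\<lambda>t. 6 * max 0 t"])
  show "(poscube has_real_derivative 3 * (max 0 x)\<^sup>2) (at x)" for x
    using has_derivative_max_power[of 1 x] unfolding poscube_def[abs_def]
    by (simp add: numeral_eq_Suc)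
  show "((\<lambda>t. 3 * (max 0 t)\<^sup>2) has_real_derivative 6 * max 0 x) (at x)" for x :: real
    using DERIV_cmult[OF has_derivative_max_power[of 0 x], of 3]
    by (simp add: numeral_eq_Suc mult_ac)
qed (intro continuous_intros)

text \<open>
  The inner cube vanishes for \<open>norm x \<le> 1\<close>, where the value is therefore 1, and it is at least 1
  for \<open>x \<bullet> x \<ge> 2\<close>, where the outer cube vanishes.
\<close>

definition bump :: "'a::real_inner \<Rightarrow> real" where
  "bump x = poscube (1 - poscube (x \<bullet> x - 1))"

lemma C2_on_bump: "C2_on UNIV (bump :: 'a::real_inner \<Rightarrow> real)"
proof -
  have 1: "C2_on UNIV (\<lambda>x::'a. x \<bullet> x)"
    by (rule C2_on_bilinear[OF bounded_bilinear_inner]; rule C2_on_bounded_linear[OF bounded_linear_ident])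
  show ?thesis unfolding bump_def[abs_def]
    by (intro C2_on_compose[OF _ C2_on_poscube] C2_on_minus C2_on_const 1)
qed

lemma bump_eq_1: "norm x \<le> 1 \<Longrightarrow> bump x = 1"
  by (simp add: bump_def poscube_def power_le_one dot_square_norm)

lemma bump_eq_0: "2 \<le> norm x \<Longrightarrow> bump x = 0"
proof -
  assume "2 \<le> norm x"
  then have "2\<^sup>2 \<le> (norm x)\<^sup>2" by (intro power_mono) auto
  then have "1 \<le> max 0 (x \<bullet> x - 1)" by (simp add: dot_square_norm)
  then have "1 \<le> poscube (x \<bullet> x - 1)" unfolding poscube_def by (rule one_le_power)
  then show ?thesis by (simp add: bump_def poscube_def)
qed

lemma bump_bounds: "0 \<le> bump x" "bump x \<le> 1"
proof -
  have "0 \<le> poscube t" for t by (simp add: poscube_def)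
  then show "0 \<le> bump x" "bump x \<le> 1"
    unfolding bump_def by (auto simp: poscube_def intro!: power_le_one)
qed

text \<open>
  Uniform continuity is expressed by affine moduli \<open>e + C * norm (x - y)\<close>. Along slow solutions the
  distance \<open>norm (x - y)\<close> is only bounded by a growing exponential, and an affine bound can be
  absorbed by an exponential weight, whereas a bound for small distances alone cannot. For distances
  above the \<open>d\<close> of uniform continuity the slope \<open>2 * M / d\<close> makes the affine bound exceed \<open>2 * M\<close>.
\<close>

lemma compact_support_modulus:
  fixes f :: "'a::euclidean_space \<Rightarrow> 'b::real_normed_vector"
  assumes f: "continuous_on UNIV f" and supp: "\<And>x. R < norm x \<Longrightarrow> f x = 0"
  shows "\<exists>M\<ge>0. (\<forall>x. norm (f x) \<le> M) \<and>
    (\<forall>e>0. \<exists>C\<ge>0. \<forall>x y. norm (f x - f y) \<le> e + C * norm (x - y))"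
proof -
  have "bounded (f ` cball 0 R)"
    by (intro compact_imp_bounded compact_continuous_image continuous_on_subset[OF f]) auto
  then obtain M where M: "0 < M" "\<And>x. x \<in> cball 0 R \<Longrightarrow> norm (f x) \<le> M"
    by (auto simp: bounded_pos)
  have bound: "norm (f x) \<le> M" for x
    using M(2)[of x] M(1) supp[of x] by (cases "norm x \<le> R") auto
  have "\<exists>C\<ge>0. \<forall>x y. norm (f x - f y) \<le> e + C * norm (x - y)" if "0 < e" for e
  proof -
    have "uniformly_continuous_on (cball 0 (R + 1)) f"
      by (intro compact_uniformly_continuous continuous_on_subset[OF f]) auto
    then obtain d where d: "0 < d"
      "\<And>x y. x \<in> cball 0 (R + 1) \<Longrightarrow> y \<in> cball 0 (R + 1) \<Longrightarrow> dist y x < d \<Longrightarrow> dist (f y) (f x) < e"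
      using \<open>0 < e\<close> unfolding uniformly_continuous_on_def by metis
    define d' where "d' = min d 1"
    have d': "0 < d'" "d' \<le> d" "d' \<le> 1" using d(1) by (auto simp: d'_def)
    have "norm (f x - f y) \<le> e + (2 * M / d') * norm (x - y)" for x y
    proof (cases "norm (x - y) < d'")
      case True
      have "norm (f x - f y) \<le> e"
      proof (cases "norm x \<le> R + 1 \<and> norm y \<le> R + 1")
        case t: True
        then show ?thesis using d(2)[of y x] True d'(2) by (auto simp: dist_norm)
      next
        case False
        moreover have "norm x \<le> norm y + norm (x - y)" "norm y \<le> norm x + norm (x - y)"
          by (metis norm_triangle_sub) (metis norm_triangle_sub norm_minus_commute)
        ultimately have "R < norm x \<and> R < norm y" using True d'(3) by auto
        then show ?thesis using supp[of x] supp[of y] \<open>0 < e\<close> by simp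
      qed
      moreover have "0 \<le> (2 * M / d') * norm (x - y)" using M(1) d'(1) by simp
      ultimately show ?thesis by linarith
    next
      case False
      have "norm (f x - f y) \<le> 2 * M" using norm_triangle_ineq4[of "f x" "f y"] bound[of x] bound[of y] by linarith
      also have "\<dots> \<le> (2 * M / d') * norm (x - y)"
        using False d'(1) M(1) by (simp add: field_simps)
      finally show ?thesis using \<open>0 < e\<close> by linarith
    qed
    moreover have "0 \<le> 2 * M / d'" using M(1) d'(1) by simp
    ultimately show ?thesis by blast
  qed
  then show ?thesis using bound M(1) by (intro exI[of _ M]) auto
qed


text \<open>
  The properties of a nonlinearity on which the global construction rests: a small Lipschitz
  constant for the contraction, and bounds with a modulus for the second derivative for smoothness.
\<close>

definition small_nonlinearity ::
  "real \<Rightarrow> ('a::real_normed_vector \<Rightarrow> 'b::real_normed_vector) \<Rightarrow> bool" where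
  "small_nonlinearity \<epsilon> G \<longleftrightarrow> G 0 = 0 \<and>
     (\<exists>(G' :: 'a \<Rightarrow> 'a \<Rightarrow>\<^sub>L 'b) (G'' :: 'a \<Rightarrow> 'a \<Rightarrow>\<^sub>L 'a \<Rightarrow>\<^sub>L 'b) M.
        (\<forall>x. (G has_derivative blinfun_apply (G' x)) (at x)) \<and>
        (\<forall>x. (G' has_derivative blinfun_apply (G'' x)) (at x)) \<and>
        (\<forall>x. norm (G' x) \<le> \<epsilon>) \<and> (\<forall>x. norm (G'' x) \<le> M) \<and>
        (\<forall>r>0. \<exists>C\<ge>0. \<forall>x y. norm (G'' x - G'' y) \<le> r + C * norm (x - y)))"

text \<open>
  On the ball of radius \<open>2 \<delta>\<close>, which contains the support of the cut-off map, \<open>n\<close> is of size at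
  most \<open>\<epsilon>1 * (2 * \<delta>)\<close>. This compensates the factor \<open>1 / \<delta>\<close> that the derivative of the rescaled
  bump contributes, so the derivative of the product is small uniformly in \<open>\<delta>\<close>.
\<close>

lemma C2_cutoff:
  fixes n :: "'a::euclidean_space \<Rightarrow> 'b::real_normed_vector"
  assumes n: "C2_on UNIV n" and n0: "n 0 = 0" and dn0: "(n has_derivative (\<lambda>_. 0)) (at 0)" and \<epsilon>: "0 < \<epsilon>"
  obtains \<delta> and G :: "'a \<Rightarrow> 'b"
  where "0 < \<delta>" "small_nonlinearity \<epsilon> G" "\<And>x. norm x \<le> \<delta> \<Longrightarrow> G x = n x"
proof -
  obtain n' n'' where n: "\<And>x. (n has_derivative blinfun_apply (n' x)) (at x)"
    "\<And>x. (n' has_derivative blinfun_apply (n'' x)) (at x)" "continuous_on UNIV n''" and C2n: "C2_on UNIV n"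
    by (rule C2_onE[OF n]) (use n in blast)
  obtain b' b'' where b: "\<And>x. (bump has_derivative blinfun_apply (b' x)) (at (x::'a))"
    "\<And>x. (b' has_derivative blinfun_apply (b'' x)) (at x)" "continuous_on UNIV b''"
    by (rule C2_onE[OF C2_on_bump]) blast
  have locally_zero: "blinfun_apply D = (\<lambda>_. 0)"
    if "(f has_derivative blinfun_apply D) (at x)" "r < norm x" "\<And>y. r < norm y \<Longrightarrow> f y = 0"
    for f :: "'a \<Rightarrow> 'c::real_normed_vector" and D x r
  proof -
    have "(f has_derivative (\<lambda>_. 0)) (at x)"
    proof (rule has_derivative_transform_within_open[of "\<lambda>_. 0" _ _ UNIV "{y. r < norm y}"])
      show "open {y::'a. r < norm y}" by (intro open_Collect_less continuous_intros)
    qed (use that in auto)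
    then show ?thesis using that(1) has_derivative_unique by blast
  qed
  have "b' x = 0" if "2 < norm x" for x
    using locally_zero[OF b(1) that bump_eq_0[OF less_imp_le]] by (intro blinfun_eqI) simp
  then obtain K where K: "0 \<le> K" "\<And>x. norm (b' x) \<le> K"
    using compact_support_modulus[OF continuous_on_of_derivative[OF b(2)], of 2] by blast
  have n'0: "n' 0 = 0"
    using has_derivative_unique[OF n(1)[of 0] dn0] by (intro blinfun_eqI) simp
  define \<epsilon>1 where "\<epsilon>1 = \<epsilon> / (1 + 2 * K)"
  have \<epsilon>1: "0 < \<epsilon>1" "\<epsilon>1 * (1 + 2 * K) = \<epsilon>" using \<epsilon> K(1) by (auto simp: \<epsilon>1_def add_pos_nonneg)
  have "isCont n' 0" using n(2) has_derivative_continuous by blast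
  then obtain d where d: "0 < d" "\<And>x. norm x < d \<Longrightarrow> norm (n' x) < \<epsilon>1"
    unfolding continuous_at_eps_delta using \<epsilon>1(1) n'0 by (auto simp: dist_norm)
  define \<delta> where "\<delta> = d / 3"
  have \<delta>: "0 < \<delta>" "2 * \<delta> < d" using d(1) by (auto simp: \<delta>_def)
  have n_small: "norm (n x) \<le> \<epsilon>1 * (2 * \<delta>)" if "norm x \<le> 2 * \<delta>" for x
  proof -
    have "norm (n x - n 0) \<le> \<epsilon>1 * norm (x - 0)"
    proof (rule differentiable_bound[of "cball 0 (2 * \<delta>)" n "\<lambda>x. blinfun_apply (n' x)"])
      show "(n has_derivative blinfun_apply (n' x)) (at x within cball 0 (2 * \<delta>))" for x
        by (rule has_derivative_at_withinI[OF n(1)])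
      show "onorm (blinfun_apply (n' x)) \<le> \<epsilon>1" if "x \<in> cball 0 (2 * \<delta>)" for x
        using d(2)[of x] that \<delta> by (simp add: norm_blinfun.rep_eq less_imp_le)
    qed (use that \<delta> in auto)
    also have "\<dots> \<le> \<epsilon>1 * (2 * \<delta>)" using that \<epsilon>1(1) by (intro mult_left_mono) auto
    finally show ?thesis by (simp add: n0)
  qed
  define G where "G x = bump (x /\<^sub>R \<delta>) *\<^sub>R n x" for x
  have "C2_on UNIV G" unfolding G_def[abs_def]
    by (intro C2_on_bilinear[OF bounded_bilinear_scaleR] C2_on_compose[OF _ C2_on_bump] C2n
        C2_on_bounded_linear bounded_linear_scaleR_right)
  then obtain G' G'' where G: "\<And>x. (G has_derivative blinfun_apply (G' x)) (at x)"
    "\<And>x. (G' has_derivative blinfun_apply (G'' x)) (at x)" "continuous_on UNIV G''"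
    by (rule C2_onE) blast
  have G_zero: "G x = 0" if "2 * \<delta> < norm x" for x
    using that \<delta>(1) bump_eq_0[of "x /\<^sub>R \<delta>"] by (simp add: G_def field_simps)
  have G'_zero: "G' x = 0" if "2 * \<delta> < norm x" for x
    using locally_zero[OF G(1) that] G_zero by (intro blinfun_eqI) auto
  have G''_zero: "G'' x = 0" if "2 * \<delta> < norm x" for x
    using locally_zero[OF G(2) that] G'_zero by (intro blinfun_eqI) auto
  have G'_bound: "norm (G' x) \<le> \<epsilon>" for x
  proof (cases "norm x \<le> 2 * \<delta>")
    case True
    have "((\<lambda>x. bump (x /\<^sub>R \<delta>)) has_derivative (\<lambda>a. b' (x /\<^sub>R \<delta>) (a /\<^sub>R \<delta>))) (at x)"
      using diff_chain_at[OF bounded_linear_imp_has_derivative[OF bounded_linear_scaleR_right[of "inverse \<delta>"]] b(1)]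
      by (simp add: o_def)
    from has_derivative_scaleR[OF this n(1)[of x]]
    have "blinfun_apply (G' x) = (\<lambda>a. bump (x /\<^sub>R \<delta>) *\<^sub>R n' x a + b' (x /\<^sub>R \<delta>) (a /\<^sub>R \<delta>) *\<^sub>R n x)"
      using has_derivative_unique[OF G(1)[of x]] unfolding G_def[abs_def] by blast
    moreover have "norm (bump (x /\<^sub>R \<delta>) *\<^sub>R n' x a + b' (x /\<^sub>R \<delta>) (a /\<^sub>R \<delta>) *\<^sub>R n x) \<le> \<epsilon> * norm a" for a
    proof -
      have "norm (n' x a) \<le> \<epsilon>1 * norm a"
        using order_trans[OF norm_blinfun[of "n' x" a] mult_right_mono[of "norm (n' x)" \<epsilon>1]] d(2)[of x] True \<delta>(2) by simp
      then have "norm (bump (x /\<^sub>R \<delta>) *\<^sub>R n' x a) \<le> 1 * (\<epsilon>1 * norm a)"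
        unfolding norm_scaleR using bump_bounds[of "x /\<^sub>R \<delta>"] by (intro mult_mono) auto
      moreover have "norm (b' (x /\<^sub>R \<delta>) (a /\<^sub>R \<delta>)) \<le> K * norm (a /\<^sub>R \<delta>)"
        by (rule order_trans[OF norm_blinfun mult_right_mono[OF K(2)]]) simp
      then have "norm (b' (x /\<^sub>R \<delta>) (a /\<^sub>R \<delta>) *\<^sub>R n x) \<le> (K * norm (a /\<^sub>R \<delta>)) * (\<epsilon>1 * (2 * \<delta>))"
        unfolding norm_scaleR[of "blinfun_apply _ _"] real_norm_def using K(1)
        by (intro mult_mono n_small True) auto
      moreover have "(K * norm (a /\<^sub>R \<delta>)) * (\<epsilon>1 * (2 * \<delta>)) = \<epsilon>1 * (2 * K) * norm a"
        using \<delta>(1) by simp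
      moreover have "\<epsilon> * norm a = \<epsilon>1 * norm a + \<epsilon>1 * (2 * K) * norm a"
        unfolding \<epsilon>1(2)[symmetric] by (simp add: algebra_simps)
      ultimately show ?thesis
        using norm_triangle_ineq[of "bump (x /\<^sub>R \<delta>) *\<^sub>R n' x a" "b' (x /\<^sub>R \<delta>) (a /\<^sub>R \<delta>) *\<^sub>R n x"]
        by linarith
    qed
    ultimately show ?thesis using \<epsilon> by (intro norm_blinfun_bound) auto
  next
    case False
    then show ?thesis using G'_zero[of x] \<epsilon> by simp
  qed
  obtain M where M: "\<And>x. norm (G'' x) \<le> M"
    "\<And>e. 0 < e \<Longrightarrow> \<exists>C\<ge>0. \<forall>x y. norm (G'' x - G'' y) \<le> e + C * norm (x - y)"
    using compact_support_modulus[OF G(3) G''_zero] by blast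
  have "G x = n x" if "norm x \<le> \<delta>" for x
    using bump_eq_1[of "x /\<^sub>R \<delta>"] that \<delta>(1) by (simp add: G_def field_simps)
  moreover have "G 0 = 0" by (simp add: G_def n0)
  then have "small_nonlinearity \<epsilon> G"
    unfolding small_nonlinearity_def
    by (intro conjI exI[of _ G'] exI[of _ G''] exI[of _ M]) (use G G'_bound M in auto)
  ultimately show thesis using that[OF \<delta>(1)] by blast
qed


section \<open>Fixed points in spaces of curves of bounded exponential growth\<close>

text \<open>
  The constant \<open>D\<close> bounds the norm of \<open>f\<close> in the space of continuous functions with weight
  \<open>exp (- \<zeta> * \<bar>t\<bar>)\<close>. Keeping \<open>\<zeta>\<close> a parameter rather than a part of the type lets one curve be
  considered in several of these spaces.
\<close>

definition exp_bounded :: "real \<Rightarrow> real \<Rightarrow> (real \<Rightarrow> 'a::real_normed_vector) \<Rightarrow> bool" where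
  "exp_bounded \<zeta> D f \<longleftrightarrow> continuous_on UNIV f \<and> (\<forall>t. norm (f t) \<le> D * exp (\<zeta> * \<bar>t\<bar>))"

definition slow :: "real \<Rightarrow> (real \<Rightarrow> 'a::real_normed_vector) \<Rightarrow> bool" where
  "slow \<zeta> f \<longleftrightarrow> (\<exists>D. exp_bounded \<zeta> D f)"

lemma exp_boundedI:
  "continuous_on UNIV f \<Longrightarrow> (\<And>t. norm (f t) \<le> D * exp (\<zeta> * \<bar>t\<bar>)) \<Longrightarrow> exp_bounded \<zeta> D f"
  by (simp add: exp_bounded_def)

lemma exp_boundedD: "exp_bounded \<zeta> D f \<Longrightarrow> norm (f t) \<le> D * exp (\<zeta> * \<bar>t\<bar>)"
  by (simp add: exp_bounded_def)

lemma exp_bounded_continuous: "exp_bounded \<zeta> D f \<Longrightarrow> continuous_on UNIV f"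
  by (simp add: exp_bounded_def)

lemma exp_bounded_slow: "exp_bounded \<zeta> D f \<Longrightarrow> slow \<zeta> f"
  by (auto simp: slow_def)

lemma exp_bounded_nonneg: "exp_bounded \<zeta> D f \<Longrightarrow> 0 \<le> D"
  using order_trans[OF norm_ge_zero exp_boundedD[of \<zeta> D f 0]] by simp

lemma exp_bounded_mono:
  assumes "exp_bounded \<zeta> D f" "\<zeta> \<le> \<zeta>'" "D \<le> D'"
  shows "exp_bounded \<zeta>' D' f"
proof (rule exp_boundedI)
  show "continuous_on UNIV f" using assms(1) by (rule exp_bounded_continuous)
  fix t
  have "norm (f t) \<le> D * exp (\<zeta> * \<bar>t\<bar>)" using assms(1) by (rule exp_boundedD)
  also have "\<dots> \<le> D' * exp (\<zeta>' * \<bar>t\<bar>)"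
    using assms exp_bounded_nonneg[OF assms(1)] by (intro mult_mono) (auto intro: mult_right_mono)
  finally show "norm (f t) \<le> D' * exp (\<zeta>' * \<bar>t\<bar>)" .
qed

lemma slow_mono: "slow \<zeta> f \<Longrightarrow> \<zeta> \<le> \<zeta>' \<Longrightarrow> slow \<zeta>' f"
  unfolding slow_def using exp_bounded_mono by blast

lemma exp_bounded_add:
  "exp_bounded \<zeta> C f \<Longrightarrow> exp_bounded \<zeta> D g \<Longrightarrow> exp_bounded \<zeta> (C + D) (\<lambda>t. f t + g t)"
  unfolding exp_bounded_def
  by (auto intro!: continuous_intros simp: distrib_right intro: norm_triangle_mono)

lemma exp_bounded_scaleR:
  "exp_bounded \<zeta> D f \<Longrightarrow> exp_bounded \<zeta> (\<bar>r\<bar> * D) (\<lambda>t. r *\<^sub>R f t)"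
  unfolding exp_bounded_def
  by (auto intro!: continuous_intros mult_left_mono simp: mult.assoc)

lemma exp_bounded_diff:
  "exp_bounded \<zeta> C f \<Longrightarrow> exp_bounded \<zeta> D g \<Longrightarrow> exp_bounded \<zeta> (C + D) (\<lambda>t. f t - g t)"
  using exp_bounded_add[of \<zeta> C f D "\<lambda>t. - g t"] exp_bounded_scaleR[of \<zeta> D g "-1"] by simp

lemma slow_add: "slow \<zeta> f \<Longrightarrow> slow \<zeta> g \<Longrightarrow> slow \<zeta> (\<lambda>t. f t + g t)"
  unfolding slow_def using exp_bounded_add by blast

lemma slow_diff: "slow \<zeta> f \<Longrightarrow> slow \<zeta> g \<Longrightarrow> slow \<zeta> (\<lambda>t. f t - g t)"
  unfolding slow_def using exp_bounded_diff by blast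

lemma slow_scaleR: "slow \<zeta> f \<Longrightarrow> slow \<zeta> (\<lambda>t. r *\<^sub>R f t)"
  unfolding slow_def using exp_bounded_scaleR by blast

lemma slow_continuous: "slow \<zeta> f \<Longrightarrow> continuous_on UNIV f"
  unfolding slow_def using exp_bounded_continuous by blast

lemma slow_dominated:
  assumes "continuous_on UNIV f" "slow \<zeta> g" "\<And>t. norm (f t) \<le> c * norm (g t)"
  shows "slow \<zeta> f"
proof -
  obtain D where D: "exp_bounded \<zeta> D g" using assms(2) by (auto simp: slow_def)
  have "norm (f t) \<le> (\<bar>c\<bar> * D) * exp (\<zeta> * \<bar>t\<bar>)" for t
  proof -
    have "norm (f t) \<le> \<bar>c\<bar> * norm (g t)"
      using assms(3)[of t] by (meson abs_ge_self mult_right_mono norm_ge_zero order_trans)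
    also have "\<dots> \<le> \<bar>c\<bar> * (D * exp (\<zeta> * \<bar>t\<bar>))"
      by (intro mult_left_mono exp_boundedD D) auto
    finally show ?thesis by (simp add: mult.assoc)
  qed
  then show ?thesis using assms(1) by (meson exp_boundedI exp_bounded_slow)
qed

lemma exp_bounded_linear_image:
  assumes "bounded_linear T"
  shows "\<exists>C\<ge>0. \<forall>\<zeta> D f. exp_bounded \<zeta> D f \<longrightarrow> exp_bounded \<zeta> (C * D) (\<lambda>t. T (f t))"
proof -
  obtain C where C: "0 \<le> C" "\<And>x. norm (T x) \<le> norm x * C"
    using bounded_linear.nonneg_bounded[OF assms] by blast
  have "exp_bounded \<zeta> (C * D) (\<lambda>t. T (f t))" if f: "exp_bounded \<zeta> D f" for \<zeta> D f
  proof (rule exp_boundedI)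
    show "continuous_on UNIV (\<lambda>t. T (f t))"
      by (rule bounded_linear.continuous_on[OF assms exp_bounded_continuous[OF f]])
    show "norm (T (f t)) \<le> C * D * exp (\<zeta> * \<bar>t\<bar>)" for t
      using order_trans[OF C(2) mult_right_mono[OF exp_boundedD[OF f] C(1)], of t] by (simp add: mult_ac)
  qed
  with C(1) show ?thesis by blast
qed

text \<open>
  \<open>Sol u f\<close> stands for the solution of a linear problem with initial data \<open>u\<close> and inhomogeneity
  \<open>f\<close>. The weight \<open>\<eta>\<close> serves for the solutions of the nonlinear equation, \<open>2 \<eta>\<close> and \<open>3 \<eta>\<close> for
  their first and second derivatives in \<open>u\<close>; \<open>\<epsilon>\<close> is the Lipschitz constant of the nonlinearities
  admitted.
\<close>

locale slow_solution_operator =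
  fixes Sol :: "'u::real_normed_vector \<Rightarrow> (real \<Rightarrow> 'x::banach) \<Rightarrow> real \<Rightarrow> 'x"
    and \<eta> \<kappa> \<epsilon> :: real
  assumes eta_pos: "0 < \<eta>" and kappa_nonneg: "0 \<le> \<kappa>" and eps_nonneg: "0 \<le> \<epsilon>"
    and contraction: "\<kappa> * \<epsilon> \<le> 1/2"
    and Sol_add: "\<And>f g u v t. slow (3*\<eta>) f \<Longrightarrow> slow (3*\<eta>) g \<Longrightarrow>
        Sol (u + v) (\<lambda>t. f t + g t) t = Sol u f t + Sol v g t"
    and Sol_scale: "\<And>f u r t. slow (3*\<eta>) f \<Longrightarrow> Sol (r *\<^sub>R u) (\<lambda>t. r *\<^sub>R f t) t = r *\<^sub>R Sol u f t"
    and Sol_bound: "\<And>\<zeta> D f u. \<zeta> \<in> {\<eta>, 2*\<eta>, 3*\<eta>} \<Longrightarrow> exp_bounded \<zeta> D f \<Longrightarrow>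
        exp_bounded \<zeta> (\<kappa> * (norm u + D)) (Sol u f)"
begin

lemma Sol_diff:
  assumes "slow (3*\<eta>) f" "slow (3*\<eta>) g"
  shows "Sol (u - v) (\<lambda>t. f t - g t) t = Sol u f t - Sol v g t"
  using Sol_add[OF assms(1) slow_scaleR[OF assms(2)], of u "- v" "-1" t]
    Sol_scale[OF assms(2), of "-1" v t] by simp

lemma Sol_linear:
  assumes "slow (3*\<eta>) f" "slow (3*\<eta>) g"
  shows "Sol (r *\<^sub>R u + v) (\<lambda>t. r *\<^sub>R f t + g t) t = r *\<^sub>R Sol u f t + Sol v g t"
  by (simp only: Sol_add[OF slow_scaleR[OF assms(1)] assms(2)] Sol_scale[OF assms(1)])

lemma weight_le: "\<zeta> \<in> {\<eta>, 2*\<eta>, 3*\<eta>} \<Longrightarrow> \<zeta> \<le> 3*\<eta>" using eta_pos by auto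

text \<open>
  The optimal constant \<open>S\<close> of \<open>w\<close> satisfies \<open>S \<le> \<kappa> (norm u + D) + \<kappa> \<epsilon> S\<close>, and \<open>\<kappa> \<epsilon> \<le> 1/2\<close> absorbs
  the last term. Finiteness of \<open>S\<close> is needed for this, so slowness of \<open>w\<close> is a hypothesis.
\<close>

lemma apriori_bound:
  assumes \<zeta>: "\<zeta> \<in> {\<eta>, 2*\<eta>, 3*\<eta>}" and w: "slow \<zeta> w" and eq: "\<And>t. w t = Sol u f t"
    and f: "continuous_on UNIV f" and D: "0 \<le> D"
    and fb: "\<And>t. norm (f t) \<le> \<epsilon> * norm (w t) + D * exp (\<zeta> * \<bar>t\<bar>)"
  shows "norm (w t) \<le> 2 * \<kappa> * (norm u + D) * exp (\<zeta> * \<bar>t\<bar>)"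
proof -
  obtain B where B: "exp_bounded \<zeta> B w" using w by (auto simp: slow_def)
  define S where "S = (SUP t. norm (w t) * exp (- \<zeta> * \<bar>t\<bar>))"
  have "norm (w t) * exp (- \<zeta> * \<bar>t\<bar>) \<le> B" for t
    using exp_boundedD[OF B, of t] by (simp add: exp_minus field_simps)
  then have bdd: "bdd_above (range (\<lambda>t. norm (w t) * exp (- \<zeta> * \<bar>t\<bar>)))" by (auto intro!: bdd_aboveI)
  have wS: "norm (w t) \<le> S * exp (\<zeta> * \<bar>t\<bar>)" for t
    using cSUP_upper[OF _ bdd, of t] by (simp add: S_def exp_minus field_simps)
  have "exp_bounded \<zeta> (\<epsilon> * S + D) f"
  proof (rule exp_boundedI[OF f])
    fix t
    have "norm (f t) \<le> \<epsilon> * (S * exp (\<zeta> * \<bar>t\<bar>)) + D * exp (\<zeta> * \<bar>t\<bar>)"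
      using fb[of t] mult_left_mono[OF wS[of t] eps_nonneg] by linarith
    then show "norm (f t) \<le> (\<epsilon> * S + D) * exp (\<zeta> * \<bar>t\<bar>)" by (simp add: algebra_simps)
  qed
  from Sol_bound[OF \<zeta> this, of u]
  have wb: "norm (w t) \<le> \<kappa> * (norm u + (\<epsilon> * S + D)) * exp (\<zeta> * \<bar>t\<bar>)" for t
    by (simp add: eq exp_boundedD)
  have "S \<le> \<kappa> * (norm u + (\<epsilon> * S + D))"
    unfolding S_def
  proof (rule cSUP_least)
    fix t show "norm (w t) * exp (- \<zeta> * \<bar>t\<bar>) \<le> \<kappa> * (norm u + (\<epsilon> * (SUP t. norm (w t) * exp (- \<zeta> * \<bar>t\<bar>)) + D))"
      using wb[of t] unfolding S_def by (simp add: exp_minus field_simps)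
  qed simp
  also have "\<dots> = \<kappa> * (norm u + D) + (\<kappa> * \<epsilon>) * S" by (simp add: algebra_simps)
  finally have 1: "S \<le> \<kappa> * (norm u + D) + (\<kappa> * \<epsilon>) * S" .
  have "0 \<le> S" using order_trans[OF norm_ge_zero wS[of 0]] by simp
  then have "(\<kappa> * \<epsilon>) * S \<le> 1/2 * S" using contraction by (intro mult_right_mono)
  with 1 have "S \<le> 2 * \<kappa> * (norm u + D)" by simp
  then show ?thesis using wS[of t] by (meson exp_ge_zero mult_right_mono order_trans)
qed

text \<open>
  Multiplication by the weight identifies slow curves with bounded continuous functions, a Banach
  space on which \<open>x \<mapsto> Sol u (\<Gamma> \<circ> x)\<close> becomes a contraction with factor 1/2.
\<close>

lemma fixed_point_exists:
  fixes \<Gamma> :: "real \<Rightarrow> 'x \<Rightarrow> 'x"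
  assumes \<zeta>: "\<zeta> \<in> {\<eta>, 2*\<eta>, 3*\<eta>}"
    and cont: "\<And>x. continuous_on UNIV x \<Longrightarrow> continuous_on UNIV (\<lambda>t. \<Gamma> t (x t))"
    and lip: "\<And>t x y. norm (\<Gamma> t x - \<Gamma> t y) \<le> \<epsilon> * norm (x - y)"
    and zero: "\<And>t. norm (\<Gamma> t 0) \<le> D * exp (\<zeta> * \<bar>t\<bar>)"
  shows "\<exists>x. slow \<zeta> x \<and> (\<forall>t. x t = Sol u (\<lambda>s. \<Gamma> s (x s)) t)"
proof -
  \<comment> \<open>removing and restoring the weight\<close>
  define unw :: "(real \<Rightarrow>\<^sub>C 'x) \<Rightarrow> real \<Rightarrow> 'x" where "unw b = (\<lambda>t. exp (\<zeta> * \<bar>t\<bar>) *\<^sub>R apply_bcontfun b t)" for b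
  define rhs where "rhs b = (\<lambda>s. \<Gamma> s (unw b s))" for b
  define \<Phi> :: "(real \<Rightarrow>\<^sub>C 'x) \<Rightarrow> real \<Rightarrow>\<^sub>C 'x" where
    "\<Phi> b = Bcontfun (\<lambda>t. exp (- \<zeta> * \<bar>t\<bar>) *\<^sub>R Sol u (rhs b) t)" for b
  have unw: "exp_bounded \<zeta> (norm b) (unw b)" for b
    unfolding unw_def using norm_bounded[of b]
    by (auto intro!: exp_boundedI continuous_intros simp: mult.commute)
  have rhs: "exp_bounded \<zeta> (\<epsilon> * norm b + D) (rhs b)" for b
  proof (rule exp_boundedI)
    show "continuous_on UNIV (rhs b)" unfolding rhs_def
      by (intro cont exp_bounded_continuous[OF unw])
    fix t
    have "norm (rhs b t) \<le> norm (\<Gamma> t (unw b t) - \<Gamma> t 0) + norm (\<Gamma> t 0)"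
      unfolding rhs_def by (metis norm_triangle_sub add.commute)
    also have "\<dots> \<le> \<epsilon> * norm (unw b t) + D * exp (\<zeta> * \<bar>t\<bar>)"
      using lip[of t "unw b t" 0] zero[of t] by simp
    also have "\<dots> \<le> \<epsilon> * (norm b * exp (\<zeta> * \<bar>t\<bar>)) + D * exp (\<zeta> * \<bar>t\<bar>)"
      using exp_boundedD[OF unw[of b], of t] eps_nonneg by (simp add: mult_left_mono)
    finally show "norm (rhs b t) \<le> (\<epsilon> * norm b + D) * exp (\<zeta> * \<bar>t\<bar>)" by (simp add: algebra_simps)
  qed
  have apply_\<Phi>: "apply_bcontfun (\<Phi> b) t = exp (- \<zeta> * \<bar>t\<bar>) *\<^sub>R Sol u (rhs b) t" for b t
  proof -
    have s: "exp_bounded \<zeta> (\<kappa> * (norm u + (\<epsilon> * norm b + D))) (Sol u (rhs b))" by (rule Sol_bound[OF \<zeta> rhs])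
    have "(\<lambda>t. exp (- \<zeta> * \<bar>t\<bar>) *\<^sub>R Sol u (rhs b) t) \<in> bcontfun"
    proof (rule bcontfun_normI)
      show "continuous_on UNIV (\<lambda>t. exp (- \<zeta> * \<bar>t\<bar>) *\<^sub>R Sol u (rhs b) t)"
        by (intro continuous_intros exp_bounded_continuous[OF s])
      show "norm (exp (- \<zeta> * \<bar>t\<bar>) *\<^sub>R Sol u (rhs b) t) \<le> \<kappa> * (norm u + (\<epsilon> * norm b + D))" for t
        using exp_boundedD[OF s, of t] by (simp add: exp_minus field_simps)
    qed
    then show ?thesis unfolding \<Phi>_def by (simp add: Bcontfun_inverse)
  qed
  have "dist (\<Phi> b) (\<Phi> c) \<le> 1/2 * dist b c" for b c
  proof (rule dist_bound)
    fix t
    have d: "exp_bounded \<zeta> (\<epsilon> * dist b c) (\<lambda>t. rhs b t - rhs c t)"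
    proof (rule exp_boundedI)
      show "continuous_on UNIV (\<lambda>t. rhs b t - rhs c t)"
        by (intro continuous_intros exp_bounded_continuous[OF rhs])
      fix t
      have "norm (rhs b t - rhs c t) \<le> \<epsilon> * norm (unw b t - unw c t)" unfolding rhs_def by (rule lip)
      also have "norm (unw b t - unw c t) = dist (apply_bcontfun b t) (apply_bcontfun c t) * exp (\<zeta> * \<bar>t\<bar>)"
        unfolding unw_def by (simp add: dist_norm flip: scaleR_diff_right)
      also have "\<epsilon> * \<dots> \<le> \<epsilon> * (dist b c * exp (\<zeta> * \<bar>t\<bar>))"
        by (intro mult_left_mono mult_right_mono dist_bounded eps_nonneg) auto
      finally show "norm (rhs b t - rhs c t) \<le> \<epsilon> * dist b c * exp (\<zeta> * \<bar>t\<bar>)" by simp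
    qed
    have "slow (3*\<eta>) (rhs b)" for b
      using rhs weight_le[OF \<zeta>] by (meson exp_bounded_slow slow_mono)
    then have "norm (Sol u (rhs b) t - Sol u (rhs c) t) = norm (Sol (u - u) (\<lambda>t. rhs b t - rhs c t) t)"
      using Sol_diff[of "rhs b" "rhs c" u u t] by simp
    also have "\<dots> \<le> \<kappa> * (\<epsilon> * dist b c) * exp (\<zeta> * \<bar>t\<bar>)"
      using exp_boundedD[OF Sol_bound[OF \<zeta> d, of "u - u"], of t] by simp
    also have "\<dots> \<le> 1/2 * dist b c * exp (\<zeta> * \<bar>t\<bar>)"
      using mult_right_mono[OF mult_right_mono[OF contraction zero_le_dist[of b c]], of "exp (\<zeta> * \<bar>t\<bar>)"]
      by (simp add: mult_ac)
    finally have *: "norm (Sol u (rhs b) t - Sol u (rhs c) t) \<le> 1/2 * dist b c * exp (\<zeta> * \<bar>t\<bar>)" .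
    have "dist (apply_bcontfun (\<Phi> b) t) (apply_bcontfun (\<Phi> c) t)
        = exp (- \<zeta> * \<bar>t\<bar>) * norm (Sol u (rhs b) t - Sol u (rhs c) t)"
      by (simp add: apply_\<Phi> dist_norm flip: scaleR_diff_right)
    also have "\<dots> \<le> exp (- \<zeta> * \<bar>t\<bar>) * (1/2 * dist b c * exp (\<zeta> * \<bar>t\<bar>))"
      by (intro mult_left_mono *) simp
    also have "\<dots> = 1/2 * dist b c" by (simp add: exp_minus)
    finally show "dist (apply_bcontfun (\<Phi> b) t) (apply_bcontfun (\<Phi> c) t) \<le> 1/2 * dist b c" .
  qed
  then have "\<exists>!b. \<Phi> b = b"
    by (intro banach_fix_type[of "1/2"]) auto
  then obtain b where b: "\<Phi> b = b" by auto
  have "unw b t = Sol u (rhs b) t" for t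
    using apply_\<Phi>[of b t] unfolding b by (simp add: unw_def exp_minus)
  then show ?thesis using exp_bounded_slow[OF unw[of b]] unfolding rhs_def by blast
qed

end


text \<open>
  Smooth dependence on \<open>u\<close> of the fixed points of \<open>x \<mapsto> Sol u (G \<circ> x)\<close>.
\<close>

locale slow_fixed_points = slow_solution_operator Sol \<eta> \<kappa> \<epsilon>
  for Sol :: "'u::real_normed_vector \<Rightarrow> (real \<Rightarrow> 'x::banach) \<Rightarrow> real \<Rightarrow> 'x" and \<eta> \<kappa> \<epsilon> +
  fixes G :: "'x \<Rightarrow> 'x" and G' :: "'x \<Rightarrow> 'x \<Rightarrow>\<^sub>L 'x" and G'' :: "'x \<Rightarrow> 'x \<Rightarrow>\<^sub>L 'x \<Rightarrow>\<^sub>L 'x" and M :: real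
  assumes G_zero: "G 0 = 0"
    and G_deriv: "\<And>x. (G has_derivative blinfun_apply (G' x)) (at x)"
    and G'_deriv: "\<And>x. (G' has_derivative blinfun_apply (G'' x)) (at x)"
    and G'_bound: "\<And>x. norm (G' x) \<le> \<epsilon>"
    and G''_bound: "\<And>x. norm (G'' x) \<le> M"
    and G''_modulus: "\<And>e. 0 < e \<Longrightarrow> \<exists>C\<ge>0. \<forall>x y. norm (G'' x - G'' y) \<le> e + C * norm (x - y)"
begin

lemma M_nonneg: "0 \<le> M"
  using G''_bound[of 0] norm_ge_zero[of "G'' 0"] by (rule order_trans[rotated])

lemma G_lipschitz: "norm (G x - G y) \<le> \<epsilon> * norm (x - y)"
  using differentiable_bound[of UNIV G "\<lambda>x. blinfun_apply (G' x)" \<epsilon> x y] G_deriv G'_bound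
  by (simp add: norm_blinfun.rep_eq)

lemma G'_lipschitz: "norm (G' x - G' y) \<le> M * norm (x - y)"
  using differentiable_bound[of UNIV G' "\<lambda>x. blinfun_apply (G'' x)" M x y] G'_deriv G''_bound
  by (simp add: norm_blinfun.rep_eq)

lemma G_taylor: "norm (G y - G x - G' x (y - x)) \<le> M * (norm (y - x))\<^sup>2"
proof -
  have "norm (G y - G x - blinfun_apply (G' x) (y - x)) \<le> norm (y - x) * (M * norm (y - x))"
  proof (rule differentiable_bound_linearization[where S="closed_segment x y" and f'="\<lambda>x. blinfun_apply (G' x)"])
    show "x + t *\<^sub>R (y - x) \<in> closed_segment x y" if "t \<in> {0..1}" for t :: real
      using that unfolding closed_segment_def by (auto intro!: exI[of _ t] simp: algebra_simps)
    show "(G has_derivative blinfun_apply (G' z)) (at z within closed_segment x y)" for z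
      by (rule has_derivative_at_withinI[OF G_deriv])
    fix z assume "z \<in> closed_segment x y"
    then have "norm (z - x) \<le> norm (y - x)"
      using segment_bound(1) by blast
    then have "norm (G' z - G' x) \<le> M * norm (y - x)"
      using G'_lipschitz[of z x] M_nonneg by (meson mult_left_mono order_trans)
    then show "onorm (blinfun_apply (G' z) - blinfun_apply (G' x)) \<le> M * norm (y - x)"
      by (simp add: norm_blinfun.rep_eq fun_diff_def flip: blinfun.diff_left)
  qed simp
  then show ?thesis by (simp add: power2_eq_square mult_ac)
qed

lemma G'_taylor:
  assumes C: "\<And>x y. norm (G'' x - G'' y) \<le> e + C * norm (x - y)" "0 \<le> C"
  shows "norm (G' y - G' x - G'' x (y - x)) \<le> (e + C * norm (y - x)) * norm (y - x)"
proof -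
  have "norm (G' y - G' x - blinfun_apply (G'' x) (y - x)) \<le> norm (y - x) * (e + C * norm (y - x))"
  proof (rule differentiable_bound_linearization[where S="closed_segment x y" and f'="\<lambda>x. blinfun_apply (G'' x)"])
    show "x + t *\<^sub>R (y - x) \<in> closed_segment x y" if "t \<in> {0..1}" for t :: real
      using that unfolding closed_segment_def by (auto intro!: exI[of _ t] simp: algebra_simps)
    show "(G' has_derivative blinfun_apply (G'' z)) (at z within closed_segment x y)" for z
      by (rule has_derivative_at_withinI[OF G'_deriv])
    fix z assume "z \<in> closed_segment x y"
    then have "norm (z - x) \<le> norm (y - x)"
      using segment_bound(1) by blast
    then have "norm (G'' z - G'' x) \<le> e + C * norm (y - x)"
      using C(1)[of z x] C(2) by (meson add_left_mono mult_left_mono order_trans)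
    then show "onorm (blinfun_apply (G'' z) - blinfun_apply (G'' x)) \<le> e + C * norm (y - x)"
      by (simp add: norm_blinfun.rep_eq fun_diff_def flip: blinfun.diff_left)
  qed simp
  then show ?thesis by (simp add: mult_ac)
qed

lemma continuous_G: "continuous_on S G"
  by (intro continuous_at_imp_continuous_on ballI has_derivative_continuous[OF G_deriv])

lemma continuous_G': "continuous_on S G'"
  by (intro continuous_at_imp_continuous_on ballI has_derivative_continuous[OF G'_deriv])

lemma continuous_G'_apply:
  "continuous_on S x \<Longrightarrow> continuous_on S v \<Longrightarrow> continuous_on S (\<lambda>t. G' (x t) (v t))"
  by (rule bounded_bilinear.continuous_on[OF bounded_bilinear_blinfun_apply])
    (auto intro: continuous_on_compose2[OF continuous_G'[of UNIV]])

lemma continuous_G_compose: "continuous_on S x \<Longrightarrow> continuous_on S (\<lambda>t. G (x t))"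
  by (rule continuous_on_compose2[OF continuous_G[of UNIV]]) auto

text \<open>
  Continuity at a point follows from the affine modulus, taken with \<open>e/2\<close> in place of \<open>e\<close>.
\<close>

lemma continuous_G'': "continuous_on S G''"
proof (rule continuous_at_imp_continuous_on, rule ballI)
  fix x assume "x \<in> S"
  show "isCont G'' x"
    unfolding continuous_at_eps_delta
  proof (intro allI impI)
    fix e :: real assume "0 < e"
    obtain C where C: "0 \<le> C" "\<And>x y. norm (G'' x - G'' y) \<le> e/2 + C * norm (x - y)"
      using G''_modulus[of "e/2"] \<open>0 < e\<close> by auto
    have "dist (G'' y) (G'' x) < e" if "dist y x < e / (2 * (C + 1))" for y
    proof -
      have "C * norm (y - x) \<le> C * (e / (2 * (C + 1)))"
        using that C(1) by (intro mult_left_mono) (auto simp: dist_norm)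
      also have "\<dots> < e / 2" using \<open>0 < e\<close> C(1) by (simp add: field_simps)
      finally show ?thesis using C(2)[of y x] by (simp add: dist_norm)
    qed
    moreover have "0 < e / (2 * (C + 1))" using \<open>0 < e\<close> C(1) by simp
    ultimately show "\<exists>d>0. \<forall>x'. dist x' x < d \<longrightarrow> dist (G'' x') (G'' x) < e" by blast
  qed
qed

lemma G'_apply_bound: "norm (G' x v) \<le> \<epsilon> * norm v"
  using norm_blinfun[of "G' x" v] G'_bound[of x] by (meson mult_right_mono norm_ge_zero order_trans)

lemma G''_apply_bound: "norm (G'' x v w) \<le> M * norm v * norm w"
proof -
  have "norm (G'' x v w) \<le> norm (G'' x v) * norm w" by (rule norm_blinfun)
  also have "\<dots> \<le> (norm (G'' x) * norm v) * norm w" by (intro mult_right_mono norm_blinfun) auto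
  also have "\<dots> \<le> (M * norm v) * norm w" by (intro mult_right_mono G''_bound) auto
  finally show ?thesis .
qed

text \<open>
  The slow solution \<open>X u\<close>, and the candidates \<open>V u a\<close> and \<open>W u a b\<close> for its first derivative in the
  direction \<open>a\<close> and its second derivative in the directions \<open>a\<close> and \<open>b\<close>. Their equations arise by
  formal differentiation of the equation for \<open>X u\<close>. The inhomogeneity of the equation for \<open>W\<close> is a
  product of two curves of weight \<open>\<eta>\<close>, so \<open>W\<close> is sought in the weight \<open>2 \<eta>\<close>.
\<close>

definition X :: "'u \<Rightarrow> real \<Rightarrow> 'x" where
  "X u = (SOME x. slow \<eta> x \<and> (\<forall>t. x t = Sol u (\<lambda>s. G (x s)) t))"

definition V :: "'u \<Rightarrow> 'u \<Rightarrow> real \<Rightarrow> 'x" where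
  "V u a = (SOME v. slow \<eta> v \<and> (\<forall>t. v t = Sol a (\<lambda>s. G' (X u s) (v s)) t))"

definition W :: "'u \<Rightarrow> 'u \<Rightarrow> 'u \<Rightarrow> real \<Rightarrow> 'x" where
  "W u a b = (SOME w. slow (2*\<eta>) w \<and>
     (\<forall>t. w t = Sol 0 (\<lambda>s. G'' (X u s) (V u a s) (V u b s) + G' (X u s) (w s)) t))"

lemma X_spec: "slow \<eta> (X u)" "X u t = Sol u (\<lambda>s. G (X u s)) t"
proof -
  have "\<exists>x. slow \<eta> x \<and> (\<forall>t. x t = Sol u (\<lambda>s. G (x s)) t)"
    by (rule fixed_point_exists[where D=0])
      (auto intro: continuous_G_compose G_lipschitz simp: G_zero)
  from someI_ex[OF this] show "slow \<eta> (X u)" "X u t = Sol u (\<lambda>s. G (X u s)) t"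
    unfolding X_def by blast+
qed

lemma X_continuous: "continuous_on S (X u)"
  by (rule continuous_on_subset[OF slow_continuous[OF X_spec(1)]]) simp

lemma V_spec: "slow \<eta> (V u a)" "V u a t = Sol a (\<lambda>s. G' (X u s) (V u a s)) t"
proof -
  have "\<exists>x. slow \<eta> x \<and> (\<forall>t. x t = Sol a (\<lambda>s. G' (X u s) (x s)) t)"
    by (rule fixed_point_exists[where D=0])
      (auto intro: continuous_G'_apply X_continuous G'_apply_bound simp flip: blinfun.diff_right)
  from someI_ex[OF this] show "slow \<eta> (V u a)" "V u a t = Sol a (\<lambda>s. G' (X u s) (V u a s)) t"
    unfolding V_def by blast+
qed

lemma V_continuous: "continuous_on S (V u a)"
  by (rule continuous_on_subset[OF slow_continuous[OF V_spec(1)]]) simp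

lemma slow_G:
  assumes "slow \<zeta> x" shows "slow \<zeta> (\<lambda>t. G (x t))"
proof (rule slow_dominated[OF continuous_G_compose[OF slow_continuous[OF assms]] assms])
  show "norm (G (x t)) \<le> \<epsilon> * norm (x t)" for t using G_lipschitz[of "x t" 0] by (simp add: G_zero)
qed

lemma slow_G':
  assumes "continuous_on UNIV x" "slow \<zeta> v" shows "slow \<zeta> (\<lambda>t. G' (x t) (v t))"
  by (rule slow_dominated[OF continuous_G'_apply[OF assms(1) slow_continuous[OF assms(2)]] assms(2)
      G'_apply_bound])

lemma eta_le: "\<eta> \<le> 3 * \<eta>" "2 * \<eta> \<le> 3 * \<eta>" using eta_pos by simp_all

lemma slow_GX: "slow (3*\<eta>) (\<lambda>s. G (X u s))"
  by (rule slow_mono[OF slow_G[OF X_spec(1)] eta_le(1)])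

lemma slow_G'V: "slow (3*\<eta>) (\<lambda>s. G' (X u s) (V v a s))"
  by (rule slow_mono[OF slow_G'[OF X_continuous V_spec(1)] eta_le(1)])

lemma slow_zero: "slow \<zeta> (\<lambda>_. 0)"
  unfolding slow_def exp_bounded_def by (auto intro!: exI[of _ 0])

definition E :: "real \<Rightarrow> real" where "E t = exp (\<eta> * \<bar>t\<bar>)"

definition k :: real where "k = 2 * \<kappa>"

lemma E_ge_1: "1 \<le> E t" using eta_pos by (simp add: E_def)

lemma k_nonneg: "0 \<le> k" using kappa_nonneg by (simp add: k_def)

lemma E_power: "exp (real j * \<eta> * \<bar>t\<bar>) = E t ^ j"
  by (simp add: E_def mult_ac flip: exp_of_nat_mult)

lemma solutions_close:
  assumes x: "slow \<eta> x" "\<And>t. x t = Sol u (\<lambda>s. G (x s)) t"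
    and y: "slow \<eta> y" "\<And>t. y t = Sol v (\<lambda>s. G (y s)) t"
  shows "norm (x t - y t) \<le> k * norm (u - v) * E t"
proof -
  note Gx = slow_mono[OF slow_G[OF x(1)] eta_le(1)] and Gy = slow_mono[OF slow_G[OF y(1)] eta_le(1)]
  have "norm (x t - y t) \<le> 2 * \<kappa> * (norm (u - v) + 0) * exp (\<eta> * \<bar>t\<bar>)"
  proof (rule apriori_bound)
    show "x t - y t = Sol (u - v) (\<lambda>s. G (x s) - G (y s)) t" for t
      by (simp only: Sol_diff[OF Gx Gy] x(2)[symmetric] y(2)[symmetric])
    show "continuous_on UNIV (\<lambda>s. G (x s) - G (y s))"
      by (rule slow_continuous[OF slow_diff[OF Gx Gy]])
  qed (use G_lipschitz in \<open>auto intro: slow_diff x(1) y(1)\<close>)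
  then show ?thesis by (simp add: k_def E_def)
qed

lemmas X_lipschitz = solutions_close[OF X_spec X_spec]

lemma X_unique:
  assumes "slow \<eta> x" "\<And>t. x t = Sol u (\<lambda>s. G (x s)) t"
  shows "x t = X u t"
  using solutions_close[OF assms X_spec[of u], of t] by simp

text \<open>
  The form in which the a priori bound is used for all differences below: the equation for a
  difference is brought into the form of a linear equation with a remainder \<open>R\<close>, and a bound for the
  remainder in some weight is inherited by the solution.
\<close>

lemma linear_bound:
  assumes "j \<in> {1, 2, 3}" "\<zeta> = real j * \<eta>" "slow \<zeta> w" "\<And>t. w t = Sol a f t" "slow (3*\<eta>) f"
    and f: "\<And>t. f t = R t + G' (x t) (w t)" and R: "\<And>t. norm (R t) \<le> D * E t ^ j"
  shows "norm (w t) \<le> k * (norm a + D) * E t ^ j"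
proof -
  have "norm (w t) \<le> 2 * \<kappa> * (norm a + D) * exp (\<zeta> * \<bar>t\<bar>)"
  proof (rule apriori_bound[OF _ assms(3,4) slow_continuous[OF assms(5)]])
    show "0 \<le> D" using order_trans[OF norm_ge_zero R[of 0]] by (simp add: E_def)
    show "norm (f t) \<le> \<epsilon> * norm (w t) + D * exp (\<zeta> * \<bar>t\<bar>)" for t
      using norm_triangle_ineq[of "R t" "G' (x t) (w t)"] R[of t] G'_apply_bound[of "x t" "w t"]
      unfolding f assms(2) E_power by linarith
  qed (use assms(1,2) in auto)
  then show ?thesis unfolding assms(2) E_power k_def .
qed

lemma V_bound: "norm (V u a t) \<le> k * norm a * E t"
  using linear_bound[of 1 \<eta> "V u a" a _ "\<lambda>_. 0" "X u" 0 t, OF _ _ V_spec slow_G'V] by simp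

lemma linear_unique:
  assumes \<zeta>: "j \<in> {1, 2, 3}" "\<zeta> = real j * \<eta>" and x: "continuous_on UNIV x"
    and v: "slow \<zeta> v" "slow \<zeta> w" and f: "slow (3*\<eta>) f"
    and eqs: "\<And>t. v t = Sol a (\<lambda>s. f s + G' (x s) (v s)) t" "\<And>t. w t = Sol a (\<lambda>s. f s + G' (x s) (w s)) t"
  shows "v t = w t"
proof -
  have "\<zeta> \<le> 3 * \<eta>" using \<zeta> eta_pos by auto
  note sl = slow_add[OF f slow_mono[OF slow_G'[OF x v(1)] this]] slow_add[OF f slow_mono[OF slow_G'[OF x v(2)] this]]
  have "norm (v t - w t) \<le> k * (norm (a - a) + 0) * E t ^ j"
  proof (rule linear_bound[OF \<zeta> slow_diff[OF v] _ slow_diff[OF sl]])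
    show "v t - w t = Sol (a - a) (\<lambda>s. f s + G' (x s) (v s) - (f s + G' (x s) (w s))) t" for t
      by (simp only: Sol_diff[OF sl] eqs[symmetric])
    show "f t + G' (x t) (v t) - (f t + G' (x t) (w t)) = 0 + G' (x t) (v t - w t)" for t
      by (simp add: blinfun.diff_right)
  qed simp
  then show ?thesis by simp
qed

lemma V_linear: "V u (r *\<^sub>R a + b) t = r *\<^sub>R V u a t + V u b t"
proof (rule linear_unique[where f="\<lambda>_. 0" and j=1 and \<zeta>=\<eta> and x="X u" and a="r *\<^sub>R a + b"])
  show "r *\<^sub>R V u a t + V u b t
      = Sol (r *\<^sub>R a + b) (\<lambda>s. 0 + G' (X u s) (r *\<^sub>R V u a s + V u b s)) t" for t
    by (simp only: blinfun.add_right blinfun.scaleR_right Sol_linear[OF slow_G'V slow_G'V] V_spec(2)[symmetric] add_0)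
  show "V u (r *\<^sub>R a + b) t = Sol (r *\<^sub>R a + b) (\<lambda>s. 0 + G' (X u s) (V u (r *\<^sub>R a + b) s)) t" for t
    by (simp only: V_spec(2)[symmetric] add_0)
qed (auto intro!: V_spec(1) slow_add slow_scaleR X_continuous slow_zero)

lemma G''V_bound: "norm (G'' x (V u a t) (V v b t)) \<le> M * k\<^sup>2 * norm a * norm b * E t ^ 2"
proof -
  have "norm (V u a t) * norm (V v b t) \<le> (k * norm a * E t) * (k * norm b * E t)"
    using k_nonneg E_ge_1[of t] by (intro mult_mono V_bound) auto
  from order_trans[OF G''_apply_bound[of x "V u a t" "V v b t", unfolded mult.assoc] mult_left_mono[OF this M_nonneg]]
  show ?thesis by (simp add: power2_eq_square mult_ac)
qed

lemma G''V_continuous: "continuous_on S (\<lambda>t. G'' (X u t) (V u a t) (V u b t))"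
  by (intro bounded_bilinear.continuous_on[OF bounded_bilinear_blinfun_apply] V_continuous
      continuous_on_compose2[OF continuous_G''[of UNIV] X_continuous]) auto

lemma slow_G''V: "slow (2*\<eta>) (\<lambda>t. G'' (X u t) (V u a t) (V u b t))"
  using exp_boundedI[OF G''V_continuous G''V_bound[unfolded E_power[symmetric]]]
  by (auto dest: exp_bounded_slow)

lemma W_spec: "slow (2*\<eta>) (W u a b)"
  "W u a b t = Sol 0 (\<lambda>s. G'' (X u s) (V u a s) (V u b s) + G' (X u s) (W u a b s)) t"
proof -
  have "\<exists>w. slow (2*\<eta>) w \<and>
     (\<forall>t. w t = Sol 0 (\<lambda>s. G'' (X u s) (V u a s) (V u b s) + G' (X u s) (w s)) t)"
  proof (rule fixed_point_exists[where D="M * k\<^sup>2 * norm a * norm b"])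
    show "norm (G'' (X u t) (V u a t) (V u b t) + G' (X u t) 0) \<le> M * k\<^sup>2 * norm a * norm b * exp (2 * \<eta> * \<bar>t\<bar>)" for t
      using G''V_bound[of "X u t" u a t u b] E_power[of 2 t] by (simp add: blinfun.zero_right)
  qed (auto intro!: continuous_on_add continuous_G'_apply X_continuous
        G'_apply_bound G''V_continuous simp flip: blinfun.diff_right)
  from someI_ex[OF this] show "slow (2*\<eta>) (W u a b)"
    "W u a b t = Sol 0 (\<lambda>s. G'' (X u s) (V u a s) (V u b s) + G' (X u s) (W u a b s)) t"
    unfolding W_def by blast+
qed

lemma slow_W_rhs: "slow (3*\<eta>) (\<lambda>s. G'' (X u s) (V u a s) (V u b s) + G' (X u s) (W u a b s))"
  by (rule slow_mono[OF slow_add[OF slow_G''V slow_G'[OF X_continuous W_spec(1)]] eta_le(2)])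

lemma W_unique:
  assumes "slow (2*\<eta>) w" "\<And>t. w t = Sol 0 (\<lambda>s. G'' (X u s) (V u a s) (V u b s) + G' (X u s) (w s)) t"
  shows "w t = W u a b t"
  by (rule linear_unique[of 2, OF _ _ X_continuous assms(1) W_spec(1) slow_mono[OF slow_G''V eta_le(2)]
        assms(2) W_spec(2)]) simp_all

lemma W_linear_left: "W u (r *\<^sub>R a + a') b t = r *\<^sub>R W u a b t + W u a' b t"
proof (rule W_unique[symmetric])
  fix t
  have "r *\<^sub>R W u a b t + W u a' b t = Sol (r *\<^sub>R 0 + 0) (\<lambda>s. r *\<^sub>R (G'' (X u s) (V u a s) (V u b s) + G' (X u s) (W u a b s))
      + (G'' (X u s) (V u a' s) (V u b s) + G' (X u s) (W u a' b s))) t"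
    by (simp only: Sol_linear[OF slow_W_rhs slow_W_rhs] W_spec(2)[symmetric])
  also have "\<dots> = Sol 0 (\<lambda>s. G'' (X u s) (V u (r *\<^sub>R a + a') s) (V u b s) + G' (X u s) (r *\<^sub>R W u a b s + W u a' b s)) t"
    unfolding V_linear blinfun.bilinear_simps by (simp add: algebra_simps)
  finally show "r *\<^sub>R W u a b t + W u a' b t
    = Sol 0 (\<lambda>s. G'' (X u s) (V u (r *\<^sub>R a + a') s) (V u b s) + G' (X u s) (r *\<^sub>R W u a b s + W u a' b s)) t" .
qed (intro slow_add slow_scaleR W_spec(1))

lemma W_linear_right: "W u a (r *\<^sub>R b + b') t = r *\<^sub>R W u a b t + W u a b' t"
proof (rule W_unique[symmetric])
  fix t
  have "r *\<^sub>R W u a b t + W u a b' t = Sol (r *\<^sub>R 0 + 0) (\<lambda>s. r *\<^sub>R (G'' (X u s) (V u a s) (V u b s) + G' (X u s) (W u a b s))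
      + (G'' (X u s) (V u a s) (V u b' s) + G' (X u s) (W u a b' s))) t"
    by (simp only: Sol_linear[OF slow_W_rhs slow_W_rhs] W_spec(2)[symmetric])
  also have "\<dots> = Sol 0 (\<lambda>s. G'' (X u s) (V u a s) (V u (r *\<^sub>R b + b') s) + G' (X u s) (r *\<^sub>R W u a b s + W u a b' s)) t"
    unfolding V_linear blinfun.bilinear_simps by (simp add: algebra_simps)
  finally show "r *\<^sub>R W u a b t + W u a b' t
    = Sol 0 (\<lambda>s. G'' (X u s) (V u a s) (V u (r *\<^sub>R b + b') s) + G' (X u s) (r *\<^sub>R W u a b s + W u a b' s)) t" .
qed (intro slow_add slow_scaleR W_spec(1))

lemma W_bound: "norm (W u a b t) \<le> k * (M * k\<^sup>2) * norm a * norm b * E t ^ 2"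
proof -
  have "norm (W u a b t) \<le> k * (norm (0 :: 'u) + M * k\<^sup>2 * norm a * norm b) * E t ^ 2"
    by (rule linear_bound[OF _ _ W_spec slow_W_rhs refl G''V_bound]) simp_all
  then show ?thesis by (simp add: mult.assoc)
qed

text \<open>
  The remainder is that of Taylor's formula for \<open>G\<close>. It is quadratic in \<open>X v - X u\<close>, which costs one
  more factor \<open>E t\<close>.
\<close>

lemma X_derivative_bound:
  "norm (X v t - X u t - V u (v - u) t) \<le> k * (M * k\<^sup>2) * (norm (v - u))\<^sup>2 * E t ^ 2"
proof -
  let ?w = "\<lambda>t. X v t - X u t - V u (v - u) t"
  have sl: "slow (3*\<eta>) (\<lambda>s. G (X v s) - G (X u s))" by (intro slow_diff slow_GX)
  have "norm (?w t) \<le> k * (norm (v - u - (v - u)) + M * (k * norm (v - u))\<^sup>2) * E t ^ 2"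
  proof (rule linear_bound[OF _ _ _ _ slow_diff[OF sl slow_G'V]])
    show "slow (2*\<eta>) ?w"
      by (rule slow_mono[OF slow_diff[OF slow_diff[OF X_spec(1) X_spec(1)] V_spec(1)]]) (use eta_pos in simp)
    show "?w t = Sol (v - u - (v - u)) (\<lambda>s. G (X v s) - G (X u s) - G' (X u s) (V u (v - u) s)) t" for t
      by (simp only: Sol_diff[OF sl slow_G'V] Sol_diff[OF slow_GX slow_GX] X_spec(2)[symmetric] V_spec(2)[symmetric])
    show "G (X v t) - G (X u t) - G' (X u t) (V u (v - u) t)
        = (G (X v t) - G (X u t) - G' (X u t) (X v t - X u t)) + G' (X u t) (?w t)" for t
      by (simp add: blinfun.diff_right)
    fix t
    have "(norm (X v t - X u t))\<^sup>2 \<le> (k * norm (v - u) * E t)\<^sup>2" by (intro power_mono X_lipschitz) simp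
    from order_trans[OF G_taylor mult_left_mono[OF this M_nonneg]]
    show "norm (G (X v t) - G (X u t) - G' (X u t) (X v t - X u t)) \<le> M * (k * norm (v - u))\<^sup>2 * E t ^ 2"
      by (simp add: power_mult_distrib mult.assoc)
  qed simp_all
  then show ?thesis by (simp add: power_mult_distrib mult_ac)
qed

lemma V_lipschitz: "norm (V v b t - V u b t) \<le> k * (M * k\<^sup>2) * norm (v - u) * norm b * E t ^ 2"
proof -
  let ?w = "\<lambda>t. V v b t - V u b t"
  have "norm (?w t) \<le> k * (norm (b - b) + M * k\<^sup>2 * norm (v - u) * norm b) * E t ^ 2"
  proof (rule linear_bound[OF _ _ _ _ slow_diff[OF slow_G'V slow_G'V]])
    show "slow (2*\<eta>) ?w"
      by (rule slow_mono[OF slow_diff[OF V_spec(1) V_spec(1)]]) (use eta_pos in simp)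
    show "?w t = Sol (b - b) (\<lambda>s. G' (X v s) (V v b s) - G' (X u s) (V u b s)) t" for t
      by (simp only: Sol_diff[OF slow_G'V slow_G'V] V_spec(2)[symmetric])
    show "G' (X v t) (V v b t) - G' (X u t) (V u b t) = (G' (X v t) - G' (X u t)) (V v b t) + G' (X u t) (?w t)" for t
      by (simp add: blinfun.bilinear_simps)
    fix t
    have "norm ((G' (X v t) - G' (X u t)) (V v b t)) \<le> (M * norm (X v t - X u t)) * norm (V v b t)"
      by (rule norm_blinfun_le[OF G'_lipschitz])
    also have "\<dots> \<le> (M * (k * norm (v - u) * E t)) * (k * norm b * E t)"
      using M_nonneg k_nonneg E_ge_1[of t] by (intro mult_mono mult_left_mono X_lipschitz V_bound) auto
    finally show "norm ((G' (X v t) - G' (X u t)) (V v b t)) \<le> M * k\<^sup>2 * norm (v - u) * norm b * E t ^ 2"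
      by (simp add: power2_eq_square mult_ac)
  qed simp_all
  then show ?thesis by (simp add: mult.assoc)
qed

text \<open>
  The error \<open>e0\<close> of the modulus will be multiplied by \<open>k ^ 3\<close>.
\<close>

lemma rescale_modulus:
  assumes "0 < e"
  obtains e0 C where "0 < e0" "k ^ 3 * e0 \<le> e" "0 \<le> C" "\<And>x y. norm (G'' x - G'' y) \<le> e0 + C * norm (x - y)"
proof -
  define e0 where "e0 = e / (k ^ 3 + 1)"
  have "0 < e0" "k ^ 3 * e0 \<le> e" using assms k_nonneg by (auto simp: e0_def field_simps add_pos_nonneg)
  then show thesis using G''_modulus[of e0] that by blast
qed

text \<open>
  Three errors contribute: \<open>R1\<close> replaces a difference of \<open>G'\<close> by its linearization, \<open>R2\<close> replaces
  \<open>X v - X u\<close> by its derivative, and \<open>R3\<close> replaces \<open>V v b\<close> by \<open>V u b\<close>. The last two are of second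
  order in \<open>v - u\<close> by the preceding lemmas. In \<open>R1\<close> the affine modulus of \<open>G''\<close> gives a term with
  factor \<open>e0\<close> and a term of second order, both within the weight \<open>3 \<eta>\<close>.
\<close>

lemma V_derivative_bound:
  assumes "0 < e"
  shows "\<exists>C\<ge>0. \<forall>u v b t. norm (V v b t - V u b t - W u (v - u) b t)
           \<le> (e + C * norm (v - u)) * norm (v - u) * norm b * E t ^ 3"
proof -
  obtain e0 C where e0: "0 < e0" "k ^ 3 * e0 \<le> e" and C: "0 \<le> C" "\<And>x y. norm (G'' x - G'' y) \<le> e0 + C * norm (x - y)"
    using rescale_modulus[OF assms] by blast
  define C1 where "C1 = C * k ^ 3 + 2 * M\<^sup>2 * k ^ 4"
  have "norm (V v b t - V u b t - W u (v - u) b t)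
      \<le> (e + k * C1 * norm (v - u)) * norm (v - u) * norm b * E t ^ 3" for u v b t
  proof -
    let ?w = "\<lambda>t. V v b t - V u b t - W u (v - u) b t"
    let ?d = "norm (v - u)"
    let ?f = "\<lambda>s. G' (X v s) (V v b s) - G' (X u s) (V u b s)
        - (G'' (X u s) (V u (v - u) s) (V u b s) + G' (X u s) (W u (v - u) b s))"
    define R1 where "R1 t = (G' (X v t) - G' (X u t) - G'' (X u t) (X v t - X u t)) (V v b t)" for t
    define R2 where "R2 t = G'' (X u t) (X v t - X u t - V u (v - u) t) (V v b t)" for t
    define R3 where "R3 t = G'' (X u t) (V u (v - u) t) (V v b t - V u b t)" for t
    have "norm (?w t) \<le> k * (norm (b - b - 0) + (e0 * k\<^sup>2 + C1 * ?d) * ?d * norm b) * E t ^ 3"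
    proof (rule linear_bound[OF _ _ _ _ slow_diff[OF slow_diff[OF slow_G'V slow_G'V] slow_W_rhs]])
      show "slow (3*\<eta>) ?w"
        by (rule slow_diff[OF slow_mono[OF slow_diff[OF V_spec(1) V_spec(1)] eta_le(1)] slow_mono[OF W_spec(1) eta_le(2)]])
      show "?w t = Sol (b - b - 0) ?f t" for t
        by (simp only: Sol_diff[OF slow_diff[OF slow_G'V slow_G'V] slow_W_rhs] Sol_diff[OF slow_G'V slow_G'V]
            V_spec(2)[symmetric] W_spec(2)[symmetric])
      show "?f t = (R1 t + (R2 t + R3 t)) + G' (X u t) (?w t)" for t
        unfolding R1_def R2_def R3_def by (simp add: blinfun.bilinear_simps)
      fix t
      have E: "1 \<le> E t" by (rule E_ge_1)
      have "norm (R1 t) \<le> ((e0 + C * norm (X v t - X u t)) * norm (X v t - X u t)) * norm (V v b t)"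
        unfolding R1_def by (rule norm_blinfun_le[OF G'_taylor[OF C(2,1)]])
      also have "\<dots> \<le> ((e0 + C * (k * ?d * E t)) * (k * ?d * E t)) * (k * norm b * E t)"
        using k_nonneg C(1) e0(1) E by (intro mult_mono add_mono X_lipschitz V_bound order_refl) auto
      also have "\<dots> = e0 * k\<^sup>2 * ?d * norm b * E t ^ 2 + C * k ^ 3 * ?d\<^sup>2 * norm b * E t ^ 3"
        by (simp add: algebra_simps power2_eq_square power3_eq_cube)
      also have "e0 * k\<^sup>2 * ?d * norm b * E t ^ 2 \<le> e0 * k\<^sup>2 * ?d * norm b * E t ^ 3"
        using e0 E by (intro mult_left_mono power_increasing) auto
      finally have R1: "norm (R1 t) \<le> e0 * k\<^sup>2 * ?d * norm b * E t ^ 3 + C * k ^ 3 * ?d\<^sup>2 * norm b * E t ^ 3" by simp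
      have "norm (R2 t) \<le> M * norm (X v t - X u t - V u (v - u) t) * norm (V v b t)"
        unfolding R2_def by (rule G''_apply_bound)
      also have "\<dots> \<le> M * (k * (M * k\<^sup>2) * ?d\<^sup>2 * E t ^ 2) * (k * norm b * E t)"
        using M_nonneg k_nonneg E by (intro mult_mono mult_left_mono X_derivative_bound V_bound) auto
      finally have R2: "norm (R2 t) \<le> M\<^sup>2 * k ^ 4 * ?d\<^sup>2 * norm b * E t ^ 3"
        by (simp add: power2_eq_square power3_eq_cube power4_eq_xxxx mult_ac)
      have "norm (R3 t) \<le> M * norm (V u (v - u) t) * norm (V v b t - V u b t)"
        unfolding R3_def by (rule G''_apply_bound)
      also have "\<dots> \<le> M * (k * ?d * E t) * (k * (M * k\<^sup>2) * ?d * norm b * E t ^ 2)"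
        using M_nonneg k_nonneg E by (intro mult_mono mult_left_mono V_lipschitz V_bound) auto
      finally have R3: "norm (R3 t) \<le> M\<^sup>2 * k ^ 4 * ?d\<^sup>2 * norm b * E t ^ 3"
        by (simp add: power2_eq_square power3_eq_cube power4_eq_xxxx mult_ac)
      have "norm (R1 t + (R2 t + R3 t)) \<le> norm (R1 t) + (norm (R2 t) + norm (R3 t))"
        by (intro norm_triangle_mono order_refl)
      also note add_mono[OF R1 add_mono[OF R2 R3]]
      finally show "norm (R1 t + (R2 t + R3 t)) \<le> (e0 * k\<^sup>2 + C1 * ?d) * ?d * norm b * E t ^ 3"
        by (simp add: C1_def algebra_simps power2_eq_square)
    qed simp_all
    also have "k * (norm (b - b - 0) + (e0 * k\<^sup>2 + C1 * ?d) * ?d * norm b) * E t ^ 3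
        = (k ^ 3 * e0 + k * C1 * ?d) * ?d * norm b * E t ^ 3"
      by (simp add: algebra_simps power2_eq_square power3_eq_cube)
    also have "\<dots> \<le> (e + k * C1 * ?d) * ?d * norm b * E t ^ 3"
      using E_ge_1[of t] by (intro mult_right_mono add_right_mono e0(2)) auto
    finally show ?thesis .
  qed
  moreover have "0 \<le> k * C1" using k_nonneg C(1) by (simp add: C1_def)
  ultimately show ?thesis by blast
qed

text \<open>
  Here the difference of the right-hand sides is split by changing the four factors \<open>G'\<close>, \<open>G''\<close> and
  the two copies of \<open>V\<close> one at a time.
\<close>

lemma W_modulus:
  assumes "0 < e"
  shows "\<exists>C\<ge>0. \<forall>u v a b t. norm (W v a b t - W u a b t) \<le> (e + C * norm (v - u)) * norm a * norm b * E t ^ 3"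
proof -
  obtain e0 C where e0: "0 < e0" "k ^ 3 * e0 \<le> e" and C: "0 \<le> C" "\<And>x y. norm (G'' x - G'' y) \<le> e0 + C * norm (x - y)"
    using rescale_modulus[OF assms] by blast
  define C1 where "C1 = C * k ^ 3 + 3 * M\<^sup>2 * k ^ 4"
  have "norm (W v a b t - W u a b t) \<le> (e + k * C1 * norm (v - u)) * norm a * norm b * E t ^ 3" for u v a b t
  proof -
    let ?w = "\<lambda>t. W v a b t - W u a b t"
    let ?d = "norm (v - u)"
    let ?f = "\<lambda>s. G'' (X v s) (V v a s) (V v b s) + G' (X v s) (W v a b s)
        - (G'' (X u s) (V u a s) (V u b s) + G' (X u s) (W u a b s))"
    define R1 where "R1 t = (G' (X v t) - G' (X u t)) (W v a b t)" for t
    define R2 where "R2 t = (G'' (X v t) - G'' (X u t)) (V v a t) (V v b t)" for t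
    define R3 where "R3 t = G'' (X u t) (V v a t - V u a t) (V v b t)" for t
    define R4 where "R4 t = G'' (X u t) (V u a t) (V v b t - V u b t)" for t
    have "norm (?w t) \<le> k * (norm (0 - 0 :: 'u) + (e0 * k\<^sup>2 + C1 * ?d) * norm a * norm b) * E t ^ 3"
    proof (rule linear_bound[OF _ _ _ _ slow_diff[OF slow_W_rhs slow_W_rhs]])
      show "slow (3*\<eta>) ?w"
        by (rule slow_mono[OF slow_diff[OF W_spec(1) W_spec(1)] eta_le(2)])
      show "?w t = Sol (0 - 0) ?f t" for t
        by (simp only: Sol_diff[OF slow_W_rhs slow_W_rhs] W_spec(2)[symmetric])
      show "?f t = (R1 t + (R2 t + (R3 t + R4 t))) + G' (X u t) (?w t)" for t
        unfolding R1_def R2_def R3_def R4_def by (simp add: blinfun.bilinear_simps)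
      fix t
      have E: "1 \<le> E t" by (rule E_ge_1)
      have "norm (R1 t) \<le> (M * norm (X v t - X u t)) * norm (W v a b t)"
        unfolding R1_def by (rule norm_blinfun_le[OF G'_lipschitz])
      also have "\<dots> \<le> (M * (k * ?d * E t)) * (k * (M * k\<^sup>2) * norm a * norm b * E t ^ 2)"
        using M_nonneg k_nonneg E by (intro mult_mono mult_left_mono X_lipschitz W_bound) auto
      finally have R1: "norm (R1 t) \<le> M\<^sup>2 * k ^ 4 * ?d * norm a * norm b * E t ^ 3"
        by (simp add: power2_eq_square power3_eq_cube power4_eq_xxxx mult_ac)
      have "norm (R2 t) \<le> ((e0 + C * norm (X v t - X u t)) * norm (V v a t)) * norm (V v b t)"
        unfolding R2_def by (rule norm_blinfun_le[OF norm_blinfun_le[OF C(2)]])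
      also have "\<dots> \<le> ((e0 + C * (k * ?d * E t)) * (k * norm a * E t)) * (k * norm b * E t)"
        using k_nonneg C(1) e0(1) E by (intro mult_mono add_mono mult_left_mono X_lipschitz V_bound order_refl) auto
      also have "\<dots> = e0 * k\<^sup>2 * norm a * norm b * E t ^ 2 + C * k ^ 3 * ?d * norm a * norm b * E t ^ 3"
        by (simp add: algebra_simps power2_eq_square power3_eq_cube)
      also have "e0 * k\<^sup>2 * norm a * norm b * E t ^ 2 \<le> e0 * k\<^sup>2 * norm a * norm b * E t ^ 3"
        using e0 E by (intro mult_left_mono power_increasing) auto
      finally have R2: "norm (R2 t) \<le> e0 * k\<^sup>2 * norm a * norm b * E t ^ 3 + C * k ^ 3 * ?d * norm a * norm b * E t ^ 3" by simp
      have "norm (R3 t) \<le> M * norm (V v a t - V u a t) * norm (V v b t)"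
        unfolding R3_def by (rule G''_apply_bound)
      also have "\<dots> \<le> M * (k * (M * k\<^sup>2) * ?d * norm a * E t ^ 2) * (k * norm b * E t)"
        using M_nonneg k_nonneg E by (intro mult_mono mult_left_mono V_lipschitz V_bound) auto
      finally have R3: "norm (R3 t) \<le> M\<^sup>2 * k ^ 4 * ?d * norm a * norm b * E t ^ 3"
        by (simp add: power2_eq_square power3_eq_cube power4_eq_xxxx mult_ac)
      have "norm (R4 t) \<le> M * norm (V u a t) * norm (V v b t - V u b t)"
        unfolding R4_def by (rule G''_apply_bound)
      also have "\<dots> \<le> M * (k * norm a * E t) * (k * (M * k\<^sup>2) * ?d * norm b * E t ^ 2)"
        using M_nonneg k_nonneg E by (intro mult_mono mult_left_mono V_lipschitz V_bound) auto
      finally have R4: "norm (R4 t) \<le> M\<^sup>2 * k ^ 4 * ?d * norm a * norm b * E t ^ 3"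
        by (simp add: power2_eq_square power3_eq_cube power4_eq_xxxx mult_ac)
      have "norm (R1 t + (R2 t + (R3 t + R4 t))) \<le> norm (R1 t) + (norm (R2 t) + (norm (R3 t) + norm (R4 t)))"
        by (intro norm_triangle_mono order_refl)
      also note add_mono[OF R1 add_mono[OF R2 add_mono[OF R3 R4]]]
      finally show "norm (R1 t + (R2 t + (R3 t + R4 t))) \<le> (e0 * k\<^sup>2 + C1 * ?d) * norm a * norm b * E t ^ 3"
        by (simp add: C1_def algebra_simps)
    qed simp_all
    also have "k * (norm (0 - 0 :: 'u) + (e0 * k\<^sup>2 + C1 * ?d) * norm a * norm b) * E t ^ 3
        = (k ^ 3 * e0 + k * C1 * ?d) * norm a * norm b * E t ^ 3"
      by (simp add: algebra_simps power2_eq_square power3_eq_cube)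
    also have "\<dots> \<le> (e + k * C1 * ?d) * norm a * norm b * E t ^ 3"
      using E_ge_1[of t] by (intro mult_right_mono add_right_mono e0(2)) auto
    finally show ?thesis .
  qed
  moreover have "0 \<le> k * C1" using k_nonneg C(1) by (simp add: C1_def)
  ultimately show ?thesis by blast
qed

text \<open>
  At time 0 all weights are 1, so that the bounds for the curves become bounds for the derivatives of
  a map between normed spaces.
\<close>

theorem C2_on_X: "C2_on UNIV (\<lambda>u. X u 0)"
proof -
  have E0: "E 0 = 1" by (simp add: E_def)
  let ?K = "k * (M * k\<^sup>2)"
  have K: "0 \<le> ?K" using k_nonneg M_nonneg by simp
  have VL: "V u (a + b) 0 = V u a 0 + V u b 0" "V u (r *\<^sub>R a) 0 = r *\<^sub>R V u a 0" for u r a b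
    using V_linear[of u 1 a b 0] V_linear[of u r a 0 0] V_bound[of u 0 0] by simp_all
  have WL: "W u a (b + b') 0 = W u a b 0 + W u a b' 0" "W u a (r *\<^sub>R b) 0 = r *\<^sub>R W u a b 0"
    "W u (a + a') b 0 = W u a b 0 + W u a' b 0" "W u (r *\<^sub>R a) b 0 = r *\<^sub>R W u a b 0" for u r a a' b b'
    using W_linear_right[of u a 1 b b' 0] W_linear_right[of u a r b 0 0] W_bound[of u a 0 0]
      W_linear_left[of u 1 a a' b 0] W_linear_left[of u r a 0 b 0] W_bound[of u 0 b 0] by simp_all
  have bl_V: "bounded_linear (\<lambda>a. V u a 0)" for u
    by (rule bounded_linear_intro[OF VL, where K=k]) (use V_bound[of u _ 0] in \<open>simp add: E0 mult.commute\<close>)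
  have bl_W: "bounded_linear (\<lambda>b. W u a b 0)" for u a
    by (rule bounded_linear_intro[OF WL(1,2), where K="?K * norm a"])
      (use W_bound[of u a _ 0] in \<open>simp add: E0 mult_ac\<close>)
  define DV where "DV u = Blinfun (\<lambda>a. V u a 0)" for u
  have DV: "blinfun_apply (DV u) a = V u a 0" for u a
    unfolding DV_def using bl_V by (simp add: bounded_linear_Blinfun_apply)
  define DW1 where "DW1 u a = Blinfun (\<lambda>b. W u a b 0)" for u a
  have DW1: "blinfun_apply (DW1 u a) b = W u a b 0" for u a b
    unfolding DW1_def using bl_W by (simp add: bounded_linear_Blinfun_apply)
  have "bounded_linear (DW1 u)" for u
  proof (rule bounded_linear_intro[where K="?K"])
    show "DW1 u (a + b) = DW1 u a + DW1 u b" for a b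
      by (rule blinfun_eqI) (simp add: DW1 blinfun.add_left WL)
    show "DW1 u (r *\<^sub>R a) = r *\<^sub>R DW1 u a" for r a
      by (rule blinfun_eqI) (simp add: DW1 blinfun.scaleR_left WL)
    show "norm (DW1 u a) \<le> norm a * ?K" for a
      using W_bound[of u a _ 0] mult_nonneg_nonneg[OF norm_ge_zero[of a] K] by (intro norm_blinfun_bound) (auto simp: DW1 E0 mult_ac)
  qed
  define DW where "DW u = Blinfun (DW1 u)" for u
  have DW: "blinfun_apply (DW u) a = DW1 u a" for u a
    unfolding DW_def using \<open>bounded_linear (DW1 u)\<close> by (simp add: bounded_linear_Blinfun_apply)
  have shrink: "e / 2 + C * norm (v - u) \<le> e" if "dist v u < e / (2 * (C + 1))" "0 < e" "0 \<le> C"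
    for e C :: real and u v :: 'u
  proof -
    have "C * norm (v - u) \<le> C * (e / (2 * (C + 1)))"
      using that by (intro mult_left_mono) (auto simp: dist_norm)
    also have "\<dots> \<le> e / 2" using that by (simp add: field_simps)
    finally show ?thesis by simp
  qed
  show ?thesis
  proof (rule C2_onI[where f'=DV and f''=DW])
    fix u
    show "((\<lambda>u. X u 0) has_derivative blinfun_apply (DV u)) (at u)"
    proof (rule has_derivativeI_sandwich[where e=1])
      fix v assume "v \<noteq> u"
      have "norm (X v 0 - X u 0 - DV u (v - u)) \<le> ?K * (norm (v - u))\<^sup>2"
        using X_derivative_bound[of v 0 u] by (simp add: DV E0)
      then show "norm (X v 0 - X u 0 - DV u (v - u)) / norm (v - u) \<le> ?K * norm (v - u)"
        using \<open>v \<noteq> u\<close> by (simp add: field_simps power2_eq_square)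
    qed (auto intro!: blinfun.bounded_linear_right tendsto_eq_intros)
    show "(DV has_derivative blinfun_apply (DW u)) (at u)"
      unfolding has_derivative_within_alt2
    proof (intro conjI allI impI)
      show "bounded_linear (blinfun_apply (DW u))" by (rule blinfun.bounded_linear_right)
      fix r :: real assume "0 < r"
      then obtain C where C: "0 \<le> C" "\<And>u v b t. norm (V v b t - V u b t - W u (v - u) b t)
           \<le> (r / 2 + C * norm (v - u)) * norm (v - u) * norm b * E t ^ 3"
        using V_derivative_bound[of "r / 2"] by auto
      have "\<forall>\<^sub>F v in at u. dist v u < r / (2 * (C + 1))"
        using eventually_at[of "\<lambda>v. dist v u < r / (2 * (C + 1))" u UNIV] \<open>0 < r\<close> C(1)
        by (auto intro!: exI[of _ "r / (2 * (C + 1))"])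
      then show "\<forall>\<^sub>F v in at u. norm (DV v - DV u - DW u (v - u)) \<le> r * norm (v - u)"
      proof eventually_elim
        case (elim v)
        show ?case
        proof (rule norm_blinfun_bound)
          fix b
          have "norm ((DV v - DV u - DW u (v - u)) b) \<le> (r / 2 + C * norm (v - u)) * norm (v - u) * norm b"
            using C(2)[of v b 0 u] by (simp add: blinfun.diff_left DV DW DW1 E0)
          also have "\<dots> \<le> r * norm (v - u) * norm b"
            by (intro mult_right_mono shrink[OF elim \<open>0 < r\<close> C(1)]) auto
          finally show "norm ((DV v - DV u - DW u (v - u)) b) \<le> r * norm (v - u) * norm b" .
        qed (use \<open>0 < r\<close> in simp)
      qed
    qed
  next
    show "continuous_on UNIV DW"
      unfolding continuous_on_iff
    proof (intro ballI allI impI)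
      fix u and r :: real assume "0 < r"
      then obtain C where C: "0 \<le> C" "\<And>u v a b t. norm (W v a b t - W u a b t)
           \<le> (r / 2 / 2 + C * norm (v - u)) * norm a * norm b * E t ^ 3"
        using W_modulus[of "r / 2 / 2"] by auto
      have "dist (DW v) (DW u) < r" if v: "dist v u < r / 2 / (2 * (C + 1))" for v
      proof -
        have "norm (DW v - DW u) \<le> r / 2"
        proof (rule norm_blinfun_bound)
          fix a
          show "norm ((DW v - DW u) a) \<le> r / 2 * norm a"
          proof (rule norm_blinfun_bound)
            fix b
            have "norm ((DW v - DW u) a b) \<le> (r / 2 / 2 + C * norm (v - u)) * norm a * norm b"
              using C(2)[of v a b 0 u] by (simp add: blinfun.diff_left DW DW1 E0)
            also have "\<dots> \<le> r / 2 * norm a * norm b"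
              using shrink[OF v _ C(1)] \<open>0 < r\<close> by (intro mult_right_mono) auto
            finally show "norm ((DW v - DW u) a b) \<le> r / 2 * norm a * norm b" .
          qed (use \<open>0 < r\<close> in simp)
        qed (use \<open>0 < r\<close> in simp)
        then show ?thesis using \<open>0 < r\<close> by (simp add: dist_norm)
      qed
      moreover have "0 < r / 2 / (2 * (C + 1))" using \<open>0 < r\<close> C(1) by simp
      ultimately show "\<exists>d>0. \<forall>x'\<in>UNIV. dist x' u < d \<longrightarrow> dist (DW x') (DW u) < r" by blast
    qed
  qed
qed

end


section \<open>Slow solutions of linear equations\<close>

text \<open>
  Multiplication by complex scalars in the complexification of a real vector space, whose elements
  are represented by the pair of their real and imaginary parts.
\<close>

definition cs :: "complex \<Rightarrow> 'y \<times> 'y \<Rightarrow> 'y \<times> 'y::real_vector" where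
  "cs l p = (Re l *\<^sub>R fst p - Im l *\<^sub>R snd p, Re l *\<^sub>R snd p + Im l *\<^sub>R fst p)"

lemma norm_cs: "norm (cs l (p :: 'y \<times> 'y::real_inner)) = cmod l * norm p"
proof -
  obtain x y where p: "p = (x, y)" by (cases p)
  have "(norm (Re l *\<^sub>R x - Im l *\<^sub>R y))\<^sup>2 + (norm (Re l *\<^sub>R y + Im l *\<^sub>R x))\<^sup>2
      = ((Re l)\<^sup>2 + (Im l)\<^sup>2) * ((norm x)\<^sup>2 + (norm y)\<^sup>2)"
    unfolding power2_norm_eq_inner by (simp add: inner_simps inner_commute algebra_simps power2_eq_square)
  then show ?thesis by (simp add: p cs_def norm_Pair cmod_def real_sqrt_mult)
qed

lemma bounded_bilinear_cs: "bounded_bilinear (cs :: complex \<Rightarrow> 'y \<times> 'y::real_inner \<Rightarrow> _)"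
  by (rule bounded_bilinear.intro)
    (auto simp: norm_cs intro!: exI[of _ 1], auto simp: cs_def algebra_simps)

interpretation cs: bounded_bilinear "cs :: complex \<Rightarrow> 'y \<times> 'y::real_inner \<Rightarrow> _"
  by (rule bounded_bilinear_cs)

lemma cs_cs: "cs a (cs b p) = cs (a * b) p"
  by (simp add: cs_def algebra_simps)

lemma cs_1 [simp]: "cs 1 p = p" by (simp add: cs_def)

lemma cs_eq_0_iff: "cs l (p :: 'y \<times> 'y::real_inner) = 0 \<longleftrightarrow> l = 0 \<or> p = 0"
  using norm_cs[of l p] by (metis mult_eq_0_iff norm_eq_zero)

lemma has_vector_derivative_cs:
  assumes "(c has_vector_derivative c') (at t)" "(w has_vector_derivative w') (at t)"
  shows "((\<lambda>t. cs (c t) (w t :: 'y \<times> 'y::real_inner)) has_vector_derivative (cs (c t) w' + cs c' (w t))) (at t)"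
  using cs.has_vector_derivative[OF assms] .

lemma has_vector_derivative_cexp:
  fixes l :: complex shows
  "((\<lambda>t. exp (l * of_real t)) has_vector_derivative (l * exp (l * of_real t))) (at t)"
proof -
  have "((\<lambda>z. exp (l * z)) has_field_derivative (l * exp (l * of_real t))) (at (of_real t))"
    by (auto intro!: derivative_eq_intros)
  then show ?thesis by (rule has_vector_derivative_real_field)
qed

lemma norm_cexp: "cmod (exp (l * of_real t)) = exp (Re l * t)"
  by (simp add: norm_exp_eq_Re)

lemma continuous_antiderivative:
  fixes g :: "real \<Rightarrow> 'a::euclidean_space"
  assumes "continuous_on UNIV g"
  obtains P where "\<And>t. (P has_vector_derivative g t) (at t)"
proof -
  have "\<exists>F. \<forall>x. -\<infinity> < ereal x \<longrightarrow> ereal x < \<infinity> \<longrightarrow> (F has_vector_derivative g x) (at x)"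
    by (rule einterval_antiderivative) (use assms in \<open>auto simp: continuous_on_eq_continuous_at\<close>)
  then show ?thesis using that by auto
qed

text \<open>
  A real function \<open>Q\<close> whose derivative dominates that of \<open>P\<close> takes the place of an integral estimate.
\<close>

lemma increment_bound:
  fixes P :: "real \<Rightarrow> 'a::real_normed_vector"
  assumes "a \<le> b" "\<And>t. (P has_vector_derivative P' t) (at t)" "\<And>t. (Q has_real_derivative Q' t) (at t)"
    and "\<And>t. a \<le> t \<Longrightarrow> norm (P' t) \<le> Q' t"
  shows "norm (P b - P a) \<le> Q b - Q a"
proof (cases "a = b")
  case False
  show ?thesis
  proof (rule differentiable_bound_general[where f'=P' and \<phi>'=Q'])
    show "a < b" using assms(1) False by simp
    show "continuous_on {a..b} P"
      using assms(2) by (meson continuous_at_imp_continuous_on has_vector_derivative_continuous)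
    show "continuous_on {a..b} Q"
      using assms(3) by (meson DERIV_isCont continuous_at_imp_continuous_on)
  qed (use assms in \<open>auto simp: has_real_derivative_iff_has_vector_derivative[symmetric]\<close>)
qed simp

lemma has_derivative_exp_decay:
  "b \<noteq> 0 \<Longrightarrow> ((\<lambda>s. - C / b * exp (- b * s)) has_real_derivative C * exp (- b * s)) (at s)"
  by (auto intro!: derivative_eq_intros)

text \<open>
  The solution is the integral of \<open>- cs (exp (l * (t - s))) (f s)\<close> over \<open>s\<close> from \<open>t\<close> to infinity. It
  is written as \<open>cs (exp (l * t)) (P t - Pinf)\<close> with a primitive \<open>P\<close> of \<open>cs (exp (- l * s)) (f s)\<close>;
  the limit \<open>Pinf\<close> of \<open>P\<close> at infinity exists because \<open>f\<close> grows slower than \<open>exp (Re l * s)\<close>.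
\<close>

lemma scalar_slow_solution_pos:
  fixes f :: "real \<Rightarrow> 'y \<times> 'y::euclidean_space"
  assumes \<zeta>: "0 \<le> \<zeta>" "\<zeta> < Re l" and f: "exp_bounded \<zeta> D f"
  shows "\<exists>w. (\<forall>t. (w has_vector_derivative cs l (w t) + f t) (at t)) \<and> exp_bounded \<zeta> (D / (Re l - \<zeta>)) w"
proof -
  define a where "a = Re l"
  have D: "0 \<le> D" using f by (rule exp_bounded_nonneg)
  have a\<zeta>: "0 < a - \<zeta>" using \<zeta> by (simp add: a_def)
  define g where "g s = cs (exp (- l * of_real s)) (f s)" for s
  have "continuous_on UNIV g" unfolding g_def[abs_def]
    by (intro cs.continuous_on continuous_intros exp_bounded_continuous[OF f])
  then obtain P where P: "\<And>t. (P has_vector_derivative g t) (at t)" using continuous_antiderivative by blast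
  have inc: "norm (P s - P t) \<le> D / (a - \<zeta>) * exp (\<zeta> * \<bar>t\<bar> - a * t)" if "t \<le> s" for s t
  proof -
    \<comment> \<open>for \<open>r \<ge> t\<close> the weight \<open>exp (\<zeta> * \<bar>r\<bar>)\<close> is at most \<open>exp (\<zeta> * (\<bar>t\<bar> + (r - t)))\<close>\<close>
    define C where "C = D * exp (\<zeta> * \<bar>t\<bar> - \<zeta> * t)"
    have C: "0 \<le> C" using D by (simp add: C_def)
    have "norm (P s - P t) \<le> - C / (a - \<zeta>) * exp (- (a - \<zeta>) * s) - (- C / (a - \<zeta>) * exp (- (a - \<zeta>) * t))"
    proof (rule increment_bound[OF that P, where Q'="\<lambda>s. C * exp (- (a - \<zeta>) * s)"])
      show "((\<lambda>s. - C / (a - \<zeta>) * exp (- (a - \<zeta>) * s)) has_real_derivative C * exp (- (a - \<zeta>) * s)) (at s)" for s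
        by (rule has_derivative_exp_decay) (use a\<zeta> in simp)
      fix r assume "t \<le> r"
      have "norm (g r) = exp (- a * r) * norm (f r)"
        using norm_cexp[of "- l" r] by (simp add: g_def norm_cs a_def)
      also have "\<dots> \<le> exp (- a * r) * (D * exp (\<zeta> * \<bar>r\<bar>))"
        by (intro mult_left_mono exp_boundedD[OF f]) simp
      also have "\<dots> \<le> exp (- a * r) * (D * exp (\<zeta> * (\<bar>t\<bar> + (r - t))))"
        using \<zeta>(1) D \<open>t \<le> r\<close> by (intro mult_left_mono) (auto intro!: mult_left_mono)
      also have "\<dots> = C * exp (- (a - \<zeta>) * r)"
        by (simp add: C_def algebra_simps flip: exp_add)
      finally show "norm (g r) \<le> C * exp (- (a - \<zeta>) * r)" .
    qed
    also have "\<dots> \<le> C / (a - \<zeta>) * exp (- (a - \<zeta>) * t)"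
      using C a\<zeta> by simp
    also have "\<dots> = D / (a - \<zeta>) * exp (\<zeta> * \<bar>t\<bar> - a * t)"
      by (simp add: C_def algebra_simps flip: exp_add)
    finally show ?thesis .
  qed
  have "Cauchy (\<lambda>n. P (real n))"
  proof (rule metric_CauchyI)
    fix e :: real assume "0 < e"
    have "(\<lambda>n. D / (a - \<zeta>) * exp (- (a - \<zeta>) * real n)) \<longlonglongrightarrow> D / (a - \<zeta>) * 0"
      by (intro tendsto_mult tendsto_const filterlim_compose[OF exp_at_bot]
          filterlim_tendsto_neg_mult_at_bot[OF tendsto_const _ filterlim_real_sequentially]) (use a\<zeta> in auto)
    then have "\<forall>\<^sub>F n in sequentially. D / (a - \<zeta>) * exp (- (a - \<zeta>) * real n) < e"
      using \<open>0 < e\<close> by (auto dest: order_tendstoD)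
    then obtain N where N: "\<And>n. N \<le> n \<Longrightarrow> D / (a - \<zeta>) * exp (- (a - \<zeta>) * real n) < e"
      by (auto simp: eventually_sequentially)
    have le: "norm (P (real m) - P (real n)) < e" if "N \<le> n" "n \<le> m" for m n
    proof -
      have "norm (P (real m) - P (real n)) \<le> D / (a - \<zeta>) * exp (- (a - \<zeta>) * real n)"
        using inc[of "real n" "real m"] that by (simp add: algebra_simps)
      then show ?thesis using N[OF that(1)] by linarith
    qed
    show "\<exists>M. \<forall>m\<ge>M. \<forall>n\<ge>M. dist (P (real m)) (P (real n)) < e"
    proof (intro exI allI impI)
      fix m n assume "N \<le> m" "N \<le> n"
      then show "dist (P (real m)) (P (real n)) < e"
        using le[of n m] le[of m n] by (cases "n \<le> m") (auto simp: dist_norm norm_minus_commute)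
    qed
  qed
  then obtain Pinf where lim: "(\<lambda>n. P (real n)) \<longlonglongrightarrow> Pinf"
    using Cauchy_convergent convergent_def by blast
  have tail: "norm (P t - Pinf) \<le> D / (a - \<zeta>) * exp (\<zeta> * \<bar>t\<bar> - a * t)" for t
  proof (rule tendsto_upperbound)
    show "(\<lambda>n. norm (P t - P (real n))) \<longlonglongrightarrow> norm (P t - Pinf)"
      by (intro tendsto_intros lim)
    show "\<forall>\<^sub>F n in sequentially. norm (P t - P (real n)) \<le> D / (a - \<zeta>) * exp (\<zeta> * \<bar>t\<bar> - a * t)"
      using filterlim_real_sequentially[unfolded filterlim_at_top, rule_format, of t]
      by eventually_elim (metis inc norm_minus_commute)
  qed simp
  define w where "w t = cs (exp (l * of_real t)) (P t - Pinf)" for t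
  have w': "(w has_vector_derivative cs l (w t) + f t) (at t)" for t
  proof -
    have "((\<lambda>t. P t - Pinf) has_vector_derivative g t) (at t)"
      using P by (auto intro!: derivative_eq_intros)
    from has_vector_derivative_cs[OF has_vector_derivative_cexp[of l t] this]
    have "(w has_vector_derivative (cs (exp (l * of_real t)) (g t) + cs l (w t))) (at t)"
      by (simp add: w_def[abs_def] cs_cs)
    moreover have "cs (exp (l * of_real t)) (g t) = f t"
      by (simp add: g_def cs_cs flip: exp_add)
    ultimately show ?thesis by (simp add: add.commute)
  qed
  have "exp_bounded \<zeta> (D / (a - \<zeta>)) w"
  proof (rule exp_boundedI)
    show "continuous_on UNIV w"
      using w' by (meson continuous_at_imp_continuous_on has_vector_derivative_continuous)
    fix t
    have "norm (w t) = exp (a * t) * norm (P t - Pinf)"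
      by (simp add: w_def norm_cs norm_cexp a_def)
    also have "\<dots> \<le> exp (a * t) * (D / (a - \<zeta>) * exp (\<zeta> * \<bar>t\<bar> - a * t))"
      by (intro mult_left_mono tail) simp
    also have "\<dots> = D / (a - \<zeta>) * exp (\<zeta> * \<bar>t\<bar>)" by (simp add: exp_diff)
    finally show "norm (w t) \<le> D / (a - \<zeta>) * exp (\<zeta> * \<bar>t\<bar>)" .
  qed
  with w' show ?thesis by (auto simp: a_def)
qed

lemma exp_bounded_reflect: "exp_bounded \<zeta> D f \<Longrightarrow> exp_bounded \<zeta> D (\<lambda>t. f (- t))"
  unfolding exp_bounded_def by (auto intro!: continuous_on_compose2[of UNIV f] continuous_intros) (metis abs_minus_cancel)

text \<open>
  Reflection of time reduces the case of a negative real part to that of a positive one.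
\<close>

lemma scalar_slow_solution:
  fixes f :: "real \<Rightarrow> 'y \<times> 'y::euclidean_space"
  assumes \<zeta>: "0 \<le> \<zeta>" "\<zeta> < \<bar>Re l\<bar>" and f: "exp_bounded \<zeta> D f"
  shows "\<exists>w. (\<forall>t. (w has_vector_derivative cs l (w t) + f t) (at t)) \<and> exp_bounded \<zeta> (D / (\<bar>Re l\<bar> - \<zeta>)) w"
proof (cases "Re l > 0")
  case True
  then show ?thesis using scalar_slow_solution_pos[OF \<zeta>(1) _ f, of l] \<zeta>(2) by simp
next
  case False
  have "exp_bounded \<zeta> D (\<lambda>t. - f (- t))"
    using exp_bounded_scaleR[OF exp_bounded_reflect[OF f], of "-1"] by simp
  then obtain w where w: "\<And>t. (w has_vector_derivative cs (- l) (w t) + - f (- t)) (at t)"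
    "exp_bounded \<zeta> (D / (- Re l - \<zeta>)) w"
    using scalar_slow_solution_pos[OF \<zeta>(1), of "- l" D "\<lambda>t. - f (- t)"] \<zeta>(2) False by auto
  have "((\<lambda>t. w (- t)) has_vector_derivative cs l (w (- t)) + f t) (at t)" for t
  proof -
    have "((w \<circ> uminus) has_vector_derivative (-1) *\<^sub>R (cs (- l) (w (- t)) + - f (- (- t)))) (at t)"
      by (rule vector_diff_chain_at[OF _ w(1)]) (auto intro!: derivative_eq_intros)
    then show ?thesis by (simp add: o_def cs.minus_left add.commute)
  qed
  moreover have "exp_bounded \<zeta> (D / (\<bar>Re l\<bar> - \<zeta>)) (\<lambda>t. w (- t))"
    using exp_bounded_reflect[OF w(2)] False by simp
  ultimately show ?thesis by blast
qed

text \<open>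
  A solution is a constant multiple of \<open>exp (l * t)\<close>, which outgrows the weight at one end of the
  time axis.
\<close>

lemma scalar_slow_unique:
  fixes w :: "real \<Rightarrow> 'y \<times> 'y::euclidean_space"
  assumes \<zeta>: "0 \<le> \<zeta>" "\<zeta> < \<bar>Re l\<bar>" and w: "slow \<zeta> w" and w': "\<And>t. (w has_vector_derivative cs l (w t)) (at t)"
  shows "w t = 0"
proof -
  obtain D where D: "exp_bounded \<zeta> D w" using w by (auto simp: slow_def)
  define h where "h t = cs (exp (- l * of_real t)) (w t)" for t
  have "(h has_vector_derivative 0) (at t)" for t
    using has_vector_derivative_cs[OF has_vector_derivative_cexp[of "- l" t] w'[of t]]
    by (simp add: h_def[abs_def] cs_cs cs.minus_left mult.commute)
  then obtain c where c: "\<And>t. h t = c"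
    using has_vector_derivative_zero_constant[of UNIV h] by auto
  have bound: "norm c \<le> D * exp (- Re l * t + \<zeta> * \<bar>t\<bar>)" for t
  proof -
    have "norm c = exp (- Re l * t) * norm (w t)"
      using norm_cexp[of "- l" t] by (simp add: h_def norm_cs flip: c[of t])
    also have "\<dots> \<le> exp (- Re l * t) * (D * exp (\<zeta> * \<bar>t\<bar>))"
      by (intro mult_left_mono exp_boundedD[OF D]) simp
    finally show ?thesis by (simp only: exp_add mult_ac)
  qed
  have bound': "norm c \<le> D * exp (- (\<bar>Re l\<bar> - \<zeta>) * real n)" for n
    using bound[of "sgn (Re l) * real n"]
    by (cases "Re l > 0") (use \<zeta> in \<open>auto simp: algebra_simps sgn_if split: if_splits\<close>)
  have "(\<lambda>n. D * exp (- (\<bar>Re l\<bar> - \<zeta>) * real n)) \<longlonglongrightarrow> D * 0"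
    by (intro tendsto_mult tendsto_const filterlim_compose[OF exp_at_bot]
        filterlim_tendsto_neg_mult_at_bot[OF tendsto_const _ filterlim_real_sequentially]) (use \<zeta> in auto)
  then have "norm c \<le> D * 0"
    by (rule tendsto_lowerbound) (use bound' in auto)
  then have "h t = 0" using c[of t] by simp
  then show ?thesis by (simp add: h_def cs_eq_0_iff)
qed


text \<open>
  The complexification of a real linear map \<open>B\<close>, and the annihilation of vectors by products of
  factors \<open>B - l\<close>. Solving \<open>w' = B w + f\<close> one factor at a time leads to scalar equations only and
  needs neither a Jordan form nor an exponential of \<open>B\<close>.
\<close>

context
  fixes B :: "'y::euclidean_space \<Rightarrow> 'y"
  assumes lin: "linear B"
begin

definition cB :: "'y \<times> 'y \<Rightarrow> 'y \<times> 'y" where "cB p = (B (fst p), B (snd p))"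

lemma linear_cB: "linear cB"
  by (rule linearI) (auto simp: cB_def linear_add[OF lin] linear_scale[OF lin])

lemmas cB_simps = linear_add[OF linear_cB] linear_diff[OF linear_cB] linear_scale[OF linear_cB] linear_0[OF linear_cB]

lemma bounded_linear_cB: "bounded_linear cB"
  using linear_cB by (simp add: linear_conv_bounded_linear)

lemma cB_cs: "cB (cs l p) = cs l (cB p)"
  by (simp add: cB_def cs_def linear_add[OF lin] linear_diff[OF lin] linear_scale[OF lin])

primrec ann :: "complex list \<Rightarrow> 'y \<times> 'y \<Rightarrow> 'y \<times> 'y" where
  "ann [] w = w"
| "ann (l # ls) w = ann ls (cB w - cs l w)"

lemma bounded_linear_shift: "bounded_linear (\<lambda>w. cB w - cs l w)"
  by (intro bounded_linear_sub bounded_linear_cB cs.bounded_linear_right)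

lemma shift_vector_derivative:
  assumes "(w has_vector_derivative d) (at t)"
  shows "((\<lambda>t. cB (w t) - cs l (w t)) has_vector_derivative (cB d - cs l d)) (at t)"
  using bounded_linear.has_vector_derivative[OF bounded_linear_shift assms] .

text \<open>
  If \<open>w\<close> is a solution, so is \<open>(B - l) w\<close>, which is annihilated by one factor less. It vanishes by
  induction, and \<open>w\<close> solves the scalar equation \<open>w' = l w\<close>.
\<close>

lemma hyperbolic_slow_unique:
  assumes "\<And>l. l \<in> set ls \<Longrightarrow> \<zeta> < \<bar>Re l\<bar>" "0 \<le> \<zeta>" "slow \<zeta> w"
    and "\<And>t. (w has_vector_derivative cB (w t)) (at t)" "\<And>t. ann ls (w t) = 0"
  shows "w t = 0"
  using assms
proof (induction ls arbitrary: w t)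
  case (Cons l ls)
  obtain D where D: "exp_bounded \<zeta> D w" using Cons.prems(3) by (auto simp: slow_def)
  obtain C where "exp_bounded \<zeta> (C * D) (\<lambda>t. cB (w t) - cs l (w t))"
    using exp_bounded_linear_image[OF bounded_linear_shift] D by blast
  then have sl: "slow \<zeta> (\<lambda>t. cB (w t) - cs l (w t))" by (rule exp_bounded_slow)
  have v: "cB (w t) - cs l (w t) = 0" for t
  proof (rule Cons.IH[OF _ _ sl])
    show "((\<lambda>t. cB (w t) - cs l (w t)) has_vector_derivative cB (cB (w t) - cs l (w t))) (at t)" for t
      using shift_vector_derivative[OF Cons.prems(4)] by (simp add: cB_simps cB_cs)
  qed (use Cons.prems in auto)
  have "(w has_vector_derivative cs l (w t)) (at t)" for t
    using Cons.prems(4)[of t] v[of t] by simp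
  then show ?case
    by (rule scalar_slow_unique[of \<zeta> l, rotated 3]) (use Cons.prems in auto)
qed simp

text \<open>
  By induction there is a solution \<open>v\<close> of \<open>v' = B v + (B - l) f\<close>. A slow solution \<open>w\<close> of the scalar
  equation \<open>w' = l w + (v + f)\<close> then satisfies \<open>(B - l) w = v\<close>, because the defect \<open>(B - l) w - v\<close>
  solves the homogeneous scalar equation. Hence \<open>w' = B w + f\<close>.
\<close>

lemma hyperbolic_slow_solution:
  assumes "\<And>l. l \<in> set ls \<Longrightarrow> \<zeta> < \<bar>Re l\<bar>" "0 \<le> \<zeta>"
  shows "\<exists>\<kappa>\<ge>0. \<forall>D f. exp_bounded \<zeta> D f \<longrightarrow> (\<forall>t. ann ls (f t) = 0) \<longrightarrow>
    (\<exists>w. (\<forall>t. (w has_vector_derivative cB (w t) + f t) (at t)) \<and> (\<forall>t. ann ls (w t) = 0) \<and> exp_bounded \<zeta> (\<kappa> * D) w)"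
  using assms
proof (induction ls)
  case Nil
  have "exp_bounded \<zeta> (0 * D) (\<lambda>_::real. 0 :: 'y \<times> 'y)" for D by (simp add: exp_bounded_def)
  then show ?case by (intro exI[of _ 0]) (auto simp: cB_simps intro!: exI[of _ "\<lambda>_. 0"] derivative_eq_intros)
next
  case (Cons l ls)
  obtain \<kappa> where \<kappa>: "0 \<le> \<kappa>" "\<And>D f. exp_bounded \<zeta> D f \<Longrightarrow> (\<forall>t. ann ls (f t) = 0) \<Longrightarrow>
    (\<exists>w. (\<forall>t. (w has_vector_derivative cB (w t) + f t) (at t)) \<and> (\<forall>t. ann ls (w t) = 0) \<and> exp_bounded \<zeta> (\<kappa> * D) w)"
    using Cons by auto
  obtain C where C: "0 \<le> C" "\<And>D f. exp_bounded \<zeta> D f \<Longrightarrow> exp_bounded \<zeta> (C * D) (\<lambda>t. cB (f t) - cs l (f t))"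
    using exp_bounded_linear_image[OF bounded_linear_shift[of l]] by blast
  define b where "b = \<bar>Re l\<bar> - \<zeta>"
  have b: "0 < b" using Cons.prems by (simp add: b_def)
  have "\<exists>w. (\<forall>t. (w has_vector_derivative cB (w t) + f t) (at t)) \<and> (\<forall>t. ann (l # ls) (w t) = 0) \<and>
      exp_bounded \<zeta> ((\<kappa> * C + 1) / b * D) w"
    if f: "exp_bounded \<zeta> D f" "\<forall>t. ann (l # ls) (f t) = 0" for D f
  proof -
    obtain v where v: "\<And>t. (v has_vector_derivative cB (v t) + (cB (f t) - cs l (f t))) (at t)"
      "\<And>t. ann ls (v t) = 0" "exp_bounded \<zeta> (\<kappa> * (C * D)) v"
      using \<kappa>(2)[OF C(2)[OF f(1)]] f(2) by auto
    have "exp_bounded \<zeta> (\<kappa> * (C * D) + D) (\<lambda>t. v t + f t)" by (rule exp_bounded_add[OF v(3) f(1)])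
    then obtain w where w: "\<And>t. (w has_vector_derivative cs l (w t) + (v t + f t)) (at t)"
      "exp_bounded \<zeta> ((\<kappa> * (C * D) + D) / b) w"
      using scalar_slow_solution[of \<zeta> l] Cons.prems unfolding b_def by fastforce
    \<comment> \<open>the defect solves the homogeneous equation\<close>
    define e where "e t = (cB (w t) - cs l (w t)) - v t" for t
    have e0: "e t = 0" for t
    proof (rule scalar_slow_unique[of \<zeta> l])
      have "slow \<zeta> (\<lambda>t. cB (w t) - cs l (w t))"
        using C(2)[OF w(2)] by (rule exp_bounded_slow)
      then show "slow \<zeta> e" unfolding e_def[abs_def] by (rule slow_diff[OF _ exp_bounded_slow[OF v(3)]])
      fix t
      have "(e has_vector_derivative (cB (cs l (w t) + (v t + f t)) - cs l (cs l (w t) + (v t + f t)))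
          - (cB (v t) + (cB (f t) - cs l (f t)))) (at t)"
        unfolding e_def[abs_def] by (intro has_vector_derivative_diff shift_vector_derivative w v)
      also have "(cB (cs l (w t) + (v t + f t)) - cs l (cs l (w t) + (v t + f t)))
          - (cB (v t) + (cB (f t) - cs l (f t))) = cs l (e t)"
        by (simp add: e_def cB_simps cB_cs cs.add_right cs.diff_right)
      finally show "(e has_vector_derivative cs l (e t)) (at t)" .
    qed (use Cons.prems in auto)
    have "cs l (w t) + (v t + f t) = cB (w t) + f t" "cB (w t) - cs l (w t) = v t" for t
      using e0[of t] by (auto simp: e_def algebra_simps)
    then have "(w has_vector_derivative cB (w t) + f t) (at t)" "ann (l # ls) (w t) = 0" for t
      using w(1)[of t] v(2)[of t] by (simp_all add: add.assoc[symmetric])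
    moreover have "(\<kappa> * (C * D) + D) / b = (\<kappa> * C + 1) / b * D" by (simp add: field_simps)
    ultimately show ?thesis using w(2) by metis
  qed
  moreover have "0 \<le> (\<kappa> * C + 1) / b" using \<kappa>(1) C(1) b by simp
  ultimately show ?case by blast
qed


text \<open>
  The vector \<open>p(B) v\<close>, by Horner's scheme.
\<close>

definition act :: "complex poly \<Rightarrow> 'y \<times> 'y \<Rightarrow> 'y \<times> 'y" where
  "act p v = fold_coeffs (\<lambda>a x. cs a v + cB x) p 0"

lemma act_0 [simp]: "act 0 v = 0" by (simp add: act_def)

lemma act_pCons [simp]: "act (pCons a p) v = cs a v + cB (act p v)"
  by (cases "p = 0 \<and> a = 0") (auto simp: act_def cB_simps cs.zero_left)

lemma act_add: "act (p + q) v = act p v + act q v"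
  by (induction p q rule: poly_induct2) (simp_all add: cs.add_left cB_simps)

lemma act_smult: "act (smult a p) v = cs a (act p v)"
  by (induction p) (simp_all add: cs.zero_right cs.add_right cs_cs cB_cs)

lemma act_linear_factor: "act ([:- r, 1:] * q) v = cB (act q v) - cs r (act q v)"
proof -
  have "[:- r, 1:] * q = smult (- r) q + pCons 0 q" by simp
  then show ?thesis by (simp only: act_add act_smult act_pCons cs.zero_left cs.minus_left) simp
qed

lemma act_monom: "act (monom a n) v = cs a ((cB ^^ n) v)"
  by (induction n) (simp_all add: monom_0 monom_Suc cs.zero_left cB_simps cB_cs)

lemma act_sum: "act (\<Sum>i\<in>A. p i) v = (\<Sum>i\<in>A. act (p i) v)"
  by (induction A rule: infinite_finite_induct) (simp_all add: act_add)

text \<open>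
  The vectors \<open>v, B v, B\<^sup>2 v, \<dots>\<close> are linearly dependent over the reals.
\<close>

lemma annihilating_polynomial: "\<exists>p. p \<noteq> 0 \<and> act p v = 0"
proof -
  let ?n = "DIM('y \<times> 'y)"
  let ?f = "\<lambda>k. (cB ^^ k) v"
  have "\<exists>c. (\<exists>k\<le>?n. c k \<noteq> 0) \<and> (\<Sum>k\<le>?n. c k *\<^sub>R ?f k) = 0"
  proof (cases "inj_on ?f {..?n}")
    case True
    then have "card (?f ` {..?n}) = ?n + 1" by (simp add: card_image)
    then have "dependent (?f ` {..?n})" by (intro dependent_biggerset) auto
    then obtain u where u: "\<exists>x\<in>?f ` {..?n}. u x \<noteq> 0" "(\<Sum>x\<in>?f ` {..?n}. u x *\<^sub>R x) = 0"
      by (auto simp: dependent_finite)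
    show ?thesis
      by (rule exI[of _ "u \<circ> ?f"]) (use u sum.reindex[OF True, of "\<lambda>x. u x *\<^sub>R x"] in \<open>auto simp: o_def\<close>)
  next
    case False
    then obtain i j where ij: "i \<le> ?n" "j \<le> ?n" "i \<noteq> j" "?f i = ?f j" by (auto simp: inj_on_def)
    define c where "c k = (if k = i then 1 else if k = j then - 1 else 0 :: real)" for k
    have "(\<Sum>k\<le>?n. c k *\<^sub>R ?f k) = (\<Sum>k\<in>{i, j}. c k *\<^sub>R ?f k)"
      by (rule sum.mono_neutral_right) (use ij in \<open>auto simp: c_def\<close>)
    also have "\<dots> = 0" using ij by (simp add: c_def)
    finally show ?thesis using ij(1) by (intro exI[of _ c]) (auto simp: c_def)
  qed
  then obtain c where c: "\<exists>k\<le>?n. c k \<noteq> 0" "(\<Sum>k\<le>?n. c k *\<^sub>R ?f k) = 0" by blast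
  define p where "p = (\<Sum>k\<le>?n. monom (complex_of_real (c k)) k)"
  have "act p v = (\<Sum>k\<le>?n. c k *\<^sub>R ?f k)"
    unfolding p_def act_sum act_monom by (simp add: cs_def scaleR_prod_def)
  moreover have "coeff p k = of_real (c k)" if "k \<le> ?n" for k
    using that by (simp add: p_def coeff_sum)
  ultimately show ?thesis using c by (intro exI[of _ p]) auto
qed

text \<open>
  Split a linear factor \<open>X - r\<close> off a polynomial \<open>p\<close> with \<open>p(B) v = 0\<close>: either the cofactor already
  annihilates \<open>v\<close>, or it maps \<open>v\<close> to an eigenvector.
\<close>

lemma eigenvector_exists:
  assumes V: "subspace V" "\<And>l w. w \<in> V \<Longrightarrow> cs l w \<in> V" "\<And>w. w \<in> V \<Longrightarrow> cB w \<in> V"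
    and v: "v \<in> V" "v \<noteq> 0"
  shows "\<exists>l u. u \<in> V \<and> u \<noteq> 0 \<and> cB u = cs l u"
proof -
  have act_V: "act p v \<in> V" for p
    by (induction p) (auto intro: subspace_0 subspace_add V v)
  have "p \<noteq> 0 \<Longrightarrow> act p v = 0 \<Longrightarrow> \<exists>l u. u \<in> V \<and> u \<noteq> 0 \<and> cB u = cs l u" for p
  proof (induction "degree p" arbitrary: p rule: less_induct)
    case less
    show ?case
    proof (cases "degree p = 0")
      case True
      then obtain a where "p = [:a:]" by (metis degree_eq_zeroE)
      then show ?thesis using less.prems v(2) by (simp add: cB_simps cs_eq_0_iff)
    next
      case False
      then obtain r where "poly p r = 0"
        using fundamental_theorem_of_algebra[of p] by (auto simp: constant_degree)
      then obtain q where q: "p = [:- r, 1:] * q" by (auto simp: poly_eq_0_iff_dvd)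
      have "q \<noteq> 0" using q less.prems(1) by auto
      then have "degree q < degree p" unfolding q by (subst degree_mult_eq) auto
      show ?thesis
      proof (cases "act q v = 0")
        case True
        then show ?thesis using less.hyps[OF \<open>degree q < degree p\<close> \<open>q \<noteq> 0\<close>] by blast
      next
        case False
        moreover have "cB (act q v) = cs r (act q v)"
          using less.prems(2) unfolding q act_linear_factor by simp
        ultimately show ?thesis using act_V by blast
      qed
    qed
  qed
  then show ?thesis using annihilating_polynomial[of v] by blast
qed

text \<open>
  A basis of \<open>V\<close> containing the vector \<open>v\<close> of the kernel loses at least this member under \<open>T\<close>.
\<close>

lemma dim_image_kernel_less:
  fixes T :: "'a::euclidean_space \<Rightarrow> 'b::euclidean_space"
  assumes T: "linear T" and V: "subspace V" and v: "v \<in> V" "v \<noteq> 0" "T v = 0"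
  shows "dim (T ` V) < dim V"
proof -
  obtain S where S: "{v} \<subseteq> S" "S \<subseteq> V" "independent S" "V \<subseteq> span S"
    using maximal_independent_subset_extend[of "{v}" V] v by auto
  have fin: "finite S" using S(3) by (simp add: independent_imp_finite)
  have "dim V = card S" using S V by (metis dim_unique)
  have "T ` V \<subseteq> span (T ` S)" using S(4) by (metis T image_mono linear_span_image)
  also have "T ` S = insert 0 (T ` (S - {v}))" using S(1) v(3) by auto
  also have "span \<dots> = span (T ` (S - {v}))" by (rule span_insert_0)
  finally have "dim (T ` V) \<le> card (T ` (S - {v}))" using fin by (intro dim_le_card) auto
  also have "\<dots> \<le> card (S - {v})" using fin by (intro card_image_le) auto
  also have "\<dots> < card S" using S(1) fin by (intro psubset_card_mono) auto
  finally show ?thesis using \<open>dim V = card S\<close> by simp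
qed

text \<open>
  If \<open>l\<close> is an eigenvalue of \<open>B\<close> on \<open>V\<close>, the invariant subspace \<open>(B - l) V\<close> has smaller dimension. So
  all factors of the annihilating product can be chosen to belong to eigenvalues on \<open>V\<close>.
\<close>

lemma annihilator_exists:
  assumes "subspace V" "\<And>l w. w \<in> V \<Longrightarrow> cs l w \<in> V" "\<And>w. w \<in> V \<Longrightarrow> cB w \<in> V"
  shows "\<exists>ls. (\<forall>w\<in>V. ann ls w = 0) \<and> (\<forall>l\<in>set ls. \<exists>u\<in>V. u \<noteq> 0 \<and> cB u = cs l u)"
  using assms
proof (induction "dim V" arbitrary: V rule: less_induct)
  case less
  show ?case
  proof (cases "V \<subseteq> {0}")
    case True
    then show ?thesis by (intro exI[of _ "[]"]) auto
  next
    case False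
    then obtain l u where u: "u \<in> V" "u \<noteq> 0" "cB u = cs l u"
      using eigenvector_exists[OF less.prems] by blast
    let ?T = "\<lambda>w. cB w - cs l w"
    have T: "linear ?T" using bounded_linear_shift by (rule bounded_linear.linear)
    have sub: "?T ` V \<subseteq> V"
      by (intro image_subsetI subspace_diff[OF less.prems(1)] less.prems(2,3))
    have "\<exists>ls. (\<forall>w\<in>?T ` V. ann ls w = 0) \<and> (\<forall>l\<in>set ls. \<exists>u\<in>?T ` V. u \<noteq> 0 \<and> cB u = cs l u)"
    proof (rule less.hyps)
      show "dim (?T ` V) < dim V" by (rule dim_image_kernel_less[OF T less.prems(1) u(1,2)]) (simp add: u(3))
      show "subspace (?T ` V)" by (rule linear_subspace_image[OF T less.prems(1)])
      show "cs m w \<in> ?T ` V" if w: "w \<in> ?T ` V" for m w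
      proof -
        obtain x where "x \<in> V" "w = ?T x" using w by blast
        then have "cs m w = ?T (cs m x)" by (simp add: cs.diff_right cB_cs cs_cs mult.commute)
        then show ?thesis using less.prems(2)[OF \<open>x \<in> V\<close>, of m] by blast
      qed
      show "cB w \<in> ?T ` V" if w: "w \<in> ?T ` V" for w
      proof -
        obtain x where "x \<in> V" "w = ?T x" using w by blast
        then have "cB w = ?T (cB x)" by (simp add: cB_simps cB_cs)
        then show ?thesis using less.prems(3)[OF \<open>x \<in> V\<close>] by blast
      qed
    qed
    then obtain ls where ls: "\<And>w. w \<in> V \<Longrightarrow> ann ls (?T w) = 0" "\<forall>l\<in>set ls. \<exists>u\<in>?T ` V. u \<noteq> 0 \<and> cB u = cs l u"
      by auto
    have "\<forall>w\<in>V. ann (l # ls) w = 0" using ls(1) by simp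
    moreover have "\<exists>u\<in>V. u \<noteq> 0 \<and> cB u = cs m u" if m: "m \<in> set (l # ls)" for m
    proof (cases "m = l")
      case True
      then show ?thesis using u by blast
    next
      case False
      then have "m \<in> set ls" using m by simp
      then obtain x where "x \<in> ?T ` V" "x \<noteq> 0" "cB x = cs m x" using ls(2) by blast
      then show ?thesis using sub by blast
    qed
    ultimately show ?thesis by blast
  qed
qed

end

lemma slow_primitive:
  fixes f :: "real \<Rightarrow> 'a::euclidean_space"
  assumes \<zeta>: "0 < \<zeta>" and f: "exp_bounded \<zeta> D f"
  shows "\<exists>w. (\<forall>t. (w has_vector_derivative f t) (at t)) \<and> w 0 = a \<and> exp_bounded \<zeta> (norm a + D / \<zeta>) w"
proof -
  obtain P where P: "\<And>t. (P has_vector_derivative f t) (at t)"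
    using continuous_antiderivative[OF exp_bounded_continuous[OF f]] by blast
  define w where "w t = a + (P t - P 0)" for t
  have w': "(w has_vector_derivative f t) (at t)" for t
    unfolding w_def[abs_def] using P by (auto intro!: derivative_eq_intros)
  have D: "0 \<le> D" using f by (rule exp_bounded_nonneg)
  have grow: "norm (Q b - Q 0) \<le> D / \<zeta> * exp (\<zeta> * b)"
    if "0 \<le> b" "\<And>t. (Q has_vector_derivative Q' t) (at t)" "\<And>t. norm (Q' t) \<le> D * exp (\<zeta> * \<bar>t\<bar>)"
    for Q Q' :: "real \<Rightarrow> 'a" and b
  proof -
    have "norm (Q b - Q 0) \<le> D / \<zeta> * exp (\<zeta> * b) - D / \<zeta> * exp (\<zeta> * 0)"
    proof (rule increment_bound[where Q'="\<lambda>t. D * exp (\<zeta> * t)"])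
      show "((\<lambda>b. D / \<zeta> * exp (\<zeta> * b)) has_real_derivative D * exp (\<zeta> * t)) (at t)" for t
        using \<zeta> by (auto intro!: derivative_eq_intros)
      show "norm (Q' t) \<le> D * exp (\<zeta> * t)" if "0 \<le> t" for t
        using \<open>\<And>t. norm (Q' t) \<le> D * exp (\<zeta> * \<bar>t\<bar>)\<close>[of t] that by simp
    qed fact+
    moreover have "0 \<le> D / \<zeta>" using D \<zeta> by simp
    ultimately show ?thesis by simp
  qed
  have "norm (P t - P 0) \<le> D / \<zeta> * exp (\<zeta> * \<bar>t\<bar>)" for t
  proof (cases "0 \<le> t")
    case True
    then show ?thesis using grow[OF True P exp_boundedD[OF f]] by simp
  next
    case False
    have "((P \<circ> uminus) has_vector_derivative (-1) *\<^sub>R f (- t)) (at t)" for t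
      by (rule vector_diff_chain_at[OF _ P]) (auto intro!: derivative_eq_intros)
    then have Q: "((\<lambda>t. P (- t)) has_vector_derivative - f (- t)) (at t)" for t by (simp add: o_def)
    have "norm (- f (- s)) \<le> D * exp (\<zeta> * \<bar>s\<bar>)" for s using exp_boundedD[OF f, of "- s"] by simp
    from grow[of "- t", OF _ Q this] False show ?thesis by simp
  qed
  have "exp_bounded \<zeta> (norm a + D / \<zeta>) w"
  proof (rule exp_boundedI)
    show "continuous_on UNIV w"
      using w' by (meson continuous_at_imp_continuous_on has_vector_derivative_continuous)
    fix t
    have "1 \<le> exp (\<zeta> * \<bar>t\<bar>)" using \<zeta> by simp
    then have "norm a \<le> norm a * exp (\<zeta> * \<bar>t\<bar>)" using mult_left_mono[of 1 "exp (\<zeta> * \<bar>t\<bar>)" "norm a"] by simp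
    then show "norm (w t) \<le> (norm a + D / \<zeta>) * exp (\<zeta> * \<bar>t\<bar>)"
      using \<open>norm (P t - P 0) \<le> D / \<zeta> * exp (\<zeta> * \<bar>t\<bar>)\<close> norm_triangle_ineq[of a "P t - P 0"]
      by (simp add: w_def distrib_right)
  qed
  with w' show ?thesis by (intro exI[of _ w]) (auto simp: w_def)
qed


text \<open>
  The vectors \<open>e\<close> and \<open>q\<close> form a Jordan chain for the eigenvalue 0, and \<open>\<pi>\<close> assigns to a vector its
  coordinates with respect to this chain. By the condition on \<open>\<pi> \<circ> B\<close> the kernel of \<open>\<pi>\<close> is invariant
  under \<open>B\<close>; it is the hyperbolic subspace.
\<close>

locale double_zero_splitting =
  fixes B :: "'y::euclidean_space \<Rightarrow> 'y" and e q :: 'y and c :: real and \<pi> :: "'y \<Rightarrow> real \<times> real"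
  assumes lin_B: "linear B" and lin_\<pi>: "linear \<pi>"
    and B_e: "B e = 0" and B_q: "B q = c *\<^sub>R e"
    and \<pi>_e: "\<pi> e = (1, 0)" and \<pi>_q: "\<pi> q = (0, 1)"
    and \<pi>_B: "\<And>y. \<pi> (B y) = (c * snd (\<pi> y), 0)"
    and hyperbolic: "\<And>l v. v \<noteq> 0 \<Longrightarrow> \<pi> (fst v) = 0 \<Longrightarrow> \<pi> (snd v) = 0 \<Longrightarrow> cB B v = cs l v \<Longrightarrow> Re l \<noteq> 0"
begin

definition \<sigma> :: "real \<times> real \<Rightarrow> 'y" where "\<sigma> u = fst u *\<^sub>R e + snd u *\<^sub>R q"

lemma \<pi>_\<sigma> [simp]: "\<pi> (\<sigma> u) = u"
  by (simp add: \<sigma>_def linear_add[OF lin_\<pi>] linear_scale[OF lin_\<pi>] \<pi>_e \<pi>_q)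

lemma bounded_linear_\<sigma>: "bounded_linear \<sigma>"
  unfolding \<sigma>_def[abs_def]
  by (intro bounded_linear_add bounded_linear_scaleR_const bounded_linear_fst bounded_linear_snd)

lemma bounded_linear_\<pi>: "bounded_linear \<pi>" using lin_\<pi> by (simp add: linear_conv_bounded_linear)

lemma B_\<sigma>: "B (\<sigma> u) = \<sigma> (c * snd u, 0)"
  by (simp add: \<sigma>_def linear_add[OF lin_B] linear_scale[OF lin_B] B_e B_q)

text \<open>
  Existence and uniqueness of slow solutions with prescribed centre coordinates at time 0.
\<close>

definition solvable :: "real \<Rightarrow> real \<Rightarrow> bool" where
  "solvable \<zeta> \<kappa> \<longleftrightarrow> (\<forall>u D f. exp_bounded \<zeta> D f \<longrightarrow>
       (\<exists>y. (\<forall>t. (y has_vector_derivative B (y t) + f t) (at t)) \<and> \<pi> (y 0) = u \<and>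
            exp_bounded \<zeta> (\<kappa> * (norm u + D)) y))"

definition determined :: "real \<Rightarrow> bool" where
  "determined \<zeta> \<longleftrightarrow> (\<forall>y. slow \<zeta> y \<longrightarrow> (\<forall>t. (y has_vector_derivative B (y t)) (at t)) \<longrightarrow>
      \<pi> (y 0) = 0 \<longrightarrow> (\<forall>t. y t = 0))"

text \<open>
  The centre coordinates \<open>(a, b)\<close> of a solution satisfy \<open>a' = c b + \<dots>\<close>, \<open>b' = \<dots>\<close> and are found by two
  integrations, which every positive weight tolerates. The projection to the kernel of \<open>\<pi>\<close> solves a
  hyperbolic equation. The bound \<open>\<beta>\<close> is the least distance from the imaginary axis of the
  eigenvalues in an annihilating product for the hyperbolic subspace, or 1 if that is smaller.
\<close>

theorem slow_linear_solution:
  "\<exists>\<beta>>0. \<forall>\<zeta>. 0 < \<zeta> \<and> \<zeta> < \<beta> \<longrightarrow> (\<exists>\<kappa>\<ge>0. solvable \<zeta> \<kappa>) \<and> determined \<zeta>"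
proof -
  define W where "W = {v :: 'y \<times> 'y. \<pi> (fst v) = 0 \<and> \<pi> (snd v) = 0}"
  note \<pi>_simps = linear_add[OF lin_\<pi>] linear_diff[OF lin_\<pi>] linear_scale[OF lin_\<pi>] linear_0[OF lin_\<pi>]
  have "\<exists>ls. (\<forall>w\<in>W. ann B ls w = 0) \<and> (\<forall>l\<in>set ls. \<exists>u\<in>W. u \<noteq> 0 \<and> cB B u = cs l u)"
  proof (rule annihilator_exists[OF lin_B])
    show "subspace W" unfolding subspace_def by (auto simp: W_def \<pi>_simps)
    show "cs l w \<in> W" if "w \<in> W" for l w using that by (auto simp: W_def cs_def \<pi>_simps)
    show "cB B w \<in> W" if "w \<in> W" for w using that by (simp add: W_def cB_def[OF lin_B] \<pi>_B zero_prod_def)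
  qed
  then obtain ls where ls: "\<And>w. w \<in> W \<Longrightarrow> ann B ls w = 0"
    "\<And>l. l \<in> set ls \<Longrightarrow> Re l \<noteq> 0" using hyperbolic unfolding W_def by blast
  define \<beta> where "\<beta> = Min (insert 1 ((\<lambda>l. \<bar>Re l\<bar>) ` set ls))"
  have \<beta>: "0 < \<beta>" "\<And>l. l \<in> set ls \<Longrightarrow> \<beta> \<le> \<bar>Re l\<bar>"
    using ls(2) by (auto simp: \<beta>_def)
  \<comment> \<open>the projection to the hyperbolic subspace along the Jordan chain\<close>
  define Ph where "Ph y = y - \<sigma> (\<pi> y)" for y
  have bl_Ph: "bounded_linear Ph" unfolding Ph_def[abs_def]
    by (intro bounded_linear_sub bounded_linear_ident bounded_linear_compose[OF bounded_linear_\<sigma> bounded_linear_\<pi>])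
  note Ph_simps = linear_add[OF bounded_linear.linear[OF bl_Ph]]
  have \<pi>_Ph: "\<pi> (Ph y) = 0" for y by (simp add: Ph_def \<pi>_simps)
  have Ph_B: "Ph (B y) = B (Ph y)" for y
    by (simp add: Ph_def linear_diff[OF lin_B] \<pi>_B B_\<sigma>)
  have \<pi>_Ph': "\<pi> y = 0 \<Longrightarrow> Ph y = y" for y
    using linear_0[OF bounded_linear.linear[OF bounded_linear_\<sigma>]] by (simp add: Ph_def)
  have lin_pair: "bounded_linear (\<lambda>y::'y. (y, 0::'y))"
    by (intro bounded_linear_Pair bounded_linear_ident bounded_linear_zero)
  have cB_pair: "cB B (y, 0) = (B y, 0)" for y by (simp add: cB_def[OF lin_B] linear_0[OF lin_B])
  show ?thesis
    unfolding solvable_def determined_def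
  proof (rule exI[of _ \<beta>], intro conjI \<beta>(1) allI impI)
    fix \<zeta> assume "0 < \<zeta> \<and> \<zeta> < \<beta>"
    then have \<zeta>: "0 < \<zeta>" "\<zeta> < \<beta>" by auto
    have \<zeta>': "\<And>l. l \<in> set ls \<Longrightarrow> \<zeta> < \<bar>Re l\<bar>" "0 \<le> \<zeta>" using \<beta>(2) \<zeta> by fastforce+
    obtain \<kappa>h where \<kappa>h: "0 \<le> \<kappa>h" "\<And>D f. exp_bounded \<zeta> D f \<Longrightarrow> (\<forall>t. ann B ls (f t) = 0) \<Longrightarrow>
        \<exists>w. (\<forall>t. (w has_vector_derivative cB B (w t) + f t) (at t)) \<and> (\<forall>t. ann B ls (w t) = 0) \<and> exp_bounded \<zeta> (\<kappa>h * D) w"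
      using hyperbolic_slow_solution[OF lin_B \<zeta>'] by blast
    obtain C1 where C1: "0 \<le> C1" "\<And>D f. exp_bounded \<zeta> D f \<Longrightarrow> exp_bounded \<zeta> (C1 * D) (\<lambda>t. fst (\<pi> (f t)))"
      using exp_bounded_linear_image[OF bounded_linear_compose[OF bounded_linear_fst bounded_linear_\<pi>]] by blast
    obtain C2 where C2: "0 \<le> C2" "\<And>D f. exp_bounded \<zeta> D f \<Longrightarrow> exp_bounded \<zeta> (C2 * D) (\<lambda>t. snd (\<pi> (f t)))"
      using exp_bounded_linear_image[OF bounded_linear_compose[OF bounded_linear_snd bounded_linear_\<pi>]] by blast
    obtain C3 where C3: "0 \<le> C3" "\<And>D f. exp_bounded \<zeta> D f \<Longrightarrow> exp_bounded \<zeta> (C3 * D) (\<lambda>t. (Ph (f t), 0::'y))"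
      using exp_bounded_linear_image[OF bounded_linear_compose[OF lin_pair bl_Ph]] by blast
    obtain C4 where C4: "0 \<le> C4" "\<And>D f. exp_bounded \<zeta> D f \<Longrightarrow> exp_bounded \<zeta> (C4 * D) (\<lambda>t. Ph (fst (f t :: 'y \<times> 'y)))"
      using exp_bounded_linear_image[OF bounded_linear_compose[OF bl_Ph bounded_linear_fst]] by blast
    \<comment> \<open>bounds for the two centre coordinates relative to \<open>norm u + D\<close>\<close>
    define Cb where "Cb = 1 + C2 / \<zeta>"
    define Ca where "Ca = 1 + (\<bar>c\<bar> * Cb + C1) / \<zeta>"
    have Cab: "0 \<le> Cb" "0 \<le> Ca" using C1 C2 \<zeta> by (auto simp: Cb_def Ca_def)
    define K where "K = (Ca * norm e + Cb * norm q) + C4 * (\<kappa>h * C3)"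
    have K: "0 \<le> K" using Cab C3 C4 \<kappa>h by (simp add: K_def)
    have "\<exists>y. (\<forall>t. (y has_vector_derivative B (y t) + f t) (at t)) \<and> \<pi> (y 0) = u \<and>
            exp_bounded \<zeta> (K * (norm u + D)) y" if f: "exp_bounded \<zeta> D f" for u D f
    proof -
      have D: "0 \<le> D" using f by (rule exp_bounded_nonneg)
      obtain b where b: "\<And>t. (b has_vector_derivative snd (\<pi> (f t))) (at t)" "b 0 = snd u"
        "exp_bounded \<zeta> (norm (snd u) + C2 * D / \<zeta>) b"
        using slow_primitive[OF \<zeta>(1) C2(2)[OF f]] by blast
      have "norm (snd u) + C2 * D / \<zeta> \<le> Cb * (norm u + D)"
      proof -
        have "norm (snd u) \<le> norm u" using norm_snd_le[of "snd u" "fst u"] by simp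
        moreover have "C2 * D / \<zeta> \<le> C2 * (norm u + D) / \<zeta>"
          using C2(1) \<zeta>(1) by (intro divide_right_mono mult_left_mono) auto
        ultimately show ?thesis using D by (simp add: Cb_def distrib_right)
      qed
      then have b': "exp_bounded \<zeta> (Cb * (norm u + D)) b" using exp_bounded_mono[OF b(3)] by simp
      have "exp_bounded \<zeta> (\<bar>c\<bar> * (Cb * (norm u + D)) + C1 * D) (\<lambda>t. c * b t + fst (\<pi> (f t)))"
        using exp_bounded_add[OF exp_bounded_scaleR[OF b', of c] C1(2)[OF f]] by simp
      from slow_primitive[OF \<zeta>(1) this, of "fst u"] obtain a where
        a: "\<And>t. (a has_vector_derivative c * b t + fst (\<pi> (f t))) (at t)" "a 0 = fst u"
        "exp_bounded \<zeta> (norm (fst u) + (\<bar>c\<bar> * (Cb * (norm u + D)) + C1 * D) / \<zeta>) a"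
        by blast
      have "norm (fst u) + (\<bar>c\<bar> * (Cb * (norm u + D)) + C1 * D) / \<zeta>
          \<le> (norm u + D) + (\<bar>c\<bar> * (Cb * (norm u + D)) + C1 * (norm u + D)) / \<zeta>"
        using norm_fst_le[of "fst u" "snd u"] D \<zeta>(1) C1(1) Cab
        by (intro add_mono divide_right_mono mult_left_mono) auto
      also have "\<dots> = Ca * (norm u + D)" using \<zeta>(1) by (simp add: Ca_def field_simps)
      finally have a': "exp_bounded \<zeta> (Ca * (norm u + D)) a" using exp_bounded_mono[OF a(3)] by simp
      have "\<forall>t. ann B ls (Ph (f t), 0) = 0"
        using ls(1) by (simp add: W_def \<pi>_Ph \<pi>_simps)
      with \<kappa>h(2)[OF C3(2)[OF f]] obtain w where
        w: "\<And>t. (w has_vector_derivative cB B (w t) + (Ph (f t), 0)) (at t)" "exp_bounded \<zeta> (\<kappa>h * (C3 * D)) w"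
        by blast
      define yh where "yh t = Ph (fst (w t))" for t
      define y where "y t = (a t *\<^sub>R e + b t *\<^sub>R q) + yh t" for t
      have yh': "(yh has_vector_derivative B (yh t) + Ph (f t)) (at t)" for t
      proof -
        have "(yh has_vector_derivative Ph (fst (cB B (w t) + (Ph (f t), 0)))) (at t)"
          unfolding yh_def[abs_def]
          by (rule bounded_linear.has_vector_derivative[OF bounded_linear_compose[OF bl_Ph bounded_linear_fst] w(1)])
        then show ?thesis by (simp add: cB_def[OF lin_B] yh_def Ph_simps Ph_B \<pi>_Ph' \<pi>_Ph)
      qed
      have "(y has_vector_derivative B (y t) + f t) (at t)" for t
      proof -
        have "(y has_vector_derivative ((c * b t + fst (\<pi> (f t))) *\<^sub>R e + snd (\<pi> (f t)) *\<^sub>R q) + (B (yh t) + Ph (f t))) (at t)"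
          unfolding y_def[abs_def]
          by (intro has_vector_derivative_add yh' bounded_linear.has_vector_derivative[OF bounded_linear_scaleR_left] a b)
        moreover have "B (y t) = (c * b t) *\<^sub>R e + B (yh t)"
          by (simp add: y_def linear_add[OF lin_B] linear_scale[OF lin_B] B_e B_q)
        then have "((c * b t + fst (\<pi> (f t))) *\<^sub>R e + snd (\<pi> (f t)) *\<^sub>R q) + (B (yh t) + Ph (f t)) = B (y t) + f t"
          by (simp add: Ph_def \<sigma>_def scaleR_add_left)
        ultimately show ?thesis by simp
      qed
      moreover have "\<pi> (y 0) = u"
        by (simp add: y_def \<pi>_simps \<pi>_e \<pi>_q yh_def \<pi>_Ph a(2) b(2))
      moreover have "exp_bounded \<zeta> (K * (norm u + D)) y"
      proof (rule exp_boundedI)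
        show "continuous_on UNIV y"
          using \<open>\<And>t. (y has_vector_derivative B (y t) + f t) (at t)\<close>
          by (meson continuous_at_imp_continuous_on has_vector_derivative_continuous)
        fix t
        let ?E = "exp (\<zeta> * \<bar>t\<bar>)"
        have "norm (a t *\<^sub>R e) \<le> (Ca * (norm u + D) * ?E) * norm e"
          using exp_boundedD[OF a', of t] by (simp add: mult_right_mono)
        moreover have "norm (b t *\<^sub>R q) \<le> (Cb * (norm u + D) * ?E) * norm q"
          using exp_boundedD[OF b', of t] by (simp add: mult_right_mono)
        moreover have "norm (yh t) \<le> C4 * (\<kappa>h * (C3 * D)) * ?E"
          unfolding yh_def by (rule exp_boundedD[OF C4(2)[OF w(2)]])
        moreover have "C4 * (\<kappa>h * (C3 * D)) * ?E \<le> C4 * (\<kappa>h * (C3 * (norm u + D))) * ?E"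
          using C4 C3 \<kappa>h by (intro mult_right_mono mult_left_mono) auto
        moreover have "norm (y t) \<le> norm (a t *\<^sub>R e) + norm (b t *\<^sub>R q) + norm (yh t)"
          unfolding y_def by (meson add_right_mono norm_triangle_ineq norm_triangle_mono order_refl)
        ultimately show "norm (y t) \<le> K * (norm u + D) * ?E"
          by (simp add: K_def algebra_simps)
      qed
      ultimately show ?thesis by blast
    qed
    with K show "\<exists>\<kappa>\<ge>0. \<forall>u D f. exp_bounded \<zeta> D f \<longrightarrow>
       (\<exists>y. (\<forall>t. (y has_vector_derivative B (y t) + f t) (at t)) \<and> \<pi> (y 0) = u \<and>
            exp_bounded \<zeta> (\<kappa> * (norm u + D)) y)" by blast
    fix y t assume y: "slow \<zeta> y" "\<forall>t. (y has_vector_derivative B (y t)) (at t)" "\<pi> (y 0) = 0"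
    have \<pi>y: "((\<lambda>t. \<pi> (y t)) has_vector_derivative (c * snd (\<pi> (y t)), 0)) (at t)" for t
      using bounded_linear.has_vector_derivative[OF bounded_linear_\<pi> y(2)[rule_format]] by (simp add: \<pi>_B)
    have "((\<lambda>t. snd (\<pi> (y t))) has_vector_derivative 0) (at t)" for t
      using bounded_linear.has_vector_derivative[OF bounded_linear_snd \<pi>y[of t]] by simp
    then obtain s where s: "\<And>t. snd (\<pi> (y t)) = s"
      using has_vector_derivative_zero_constant[of UNIV "\<lambda>t. snd (\<pi> (y t))"] by auto
    then have snd0: "snd (\<pi> (y t)) = 0" for t using y(3) by (metis snd_zero)
    have "((\<lambda>t. fst (\<pi> (y t))) has_vector_derivative 0) (at t)" for t
      using bounded_linear.has_vector_derivative[OF bounded_linear_fst \<pi>y[of t]] snd0 by simp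
    then obtain s' where s': "\<And>t. fst (\<pi> (y t)) = s'"
      using has_vector_derivative_zero_constant[of UNIV "\<lambda>t. fst (\<pi> (y t))"] by auto
    then have fst0: "fst (\<pi> (y t)) = 0" for t using y(3) by (metis fst_zero)
    have \<pi>0: "\<pi> (y t) = 0" for t using fst0 snd0 by (simp add: prod_eq_iff)
    have "(\<lambda>t. (y t, 0)) t = (0 :: 'y \<times> 'y)"
    proof (rule hyperbolic_slow_unique[OF lin_B \<zeta>'])
      obtain D where D: "exp_bounded \<zeta> D y" using y(1) by (auto simp: slow_def)
      show "slow \<zeta> (\<lambda>t. (y t, 0::'y))"
        using exp_bounded_linear_image[OF lin_pair] D by (meson exp_bounded_slow)
      show "((\<lambda>t. (y t, 0)) has_vector_derivative cB B (y t, 0)) (at t)" for t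
        using bounded_linear.has_vector_derivative[OF lin_pair y(2)[rule_format]] by (simp add: cB_pair)
      show "ann B ls (y t, 0) = 0" for t by (rule ls(1)) (simp add: W_def \<pi>0 \<pi>_simps)
    qed
    then show "y t = 0" by (simp add: zero_prod_def)
  qed
qed

end


section \<open>The manifold of slow solutions\<close>

lemma slow_shift:
  assumes "0 \<le> \<zeta>" "slow \<zeta> f" shows "slow \<zeta> (\<lambda>s. f (t + s))"
proof -
  obtain D where D: "exp_bounded \<zeta> D f" using assms(2) by (auto simp: slow_def)
  have "exp_bounded \<zeta> (D * exp (\<zeta> * \<bar>t\<bar>)) (\<lambda>s. f (t + s))"
  proof (rule exp_boundedI)
    show "continuous_on UNIV (\<lambda>s. f (t + s))"
      by (rule continuous_on_compose2[OF exp_bounded_continuous[OF D]]) (auto intro!: continuous_intros)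
    fix s
    have "norm (f (t + s)) \<le> D * exp (\<zeta> * \<bar>t + s\<bar>)" by (rule exp_boundedD[OF D])
    also have "\<dots> \<le> D * exp (\<zeta> * (\<bar>t\<bar> + \<bar>s\<bar>))"
      using assms(1) exp_bounded_nonneg[OF D] by (intro mult_left_mono) (auto intro!: mult_left_mono)
    finally show "norm (f (t + s)) \<le> D * exp (\<zeta> * \<bar>t\<bar>) * exp (\<zeta> * \<bar>s\<bar>)"
      by (simp add: distrib_left exp_add)
  qed
  then show ?thesis by (rule exp_bounded_slow)
qed

text \<open>
  The equation \<open>z = L y + \<dots>\<close> is carried along instead of being solved for \<open>z\<close>: it involves no
  derivative, so it simply becomes a second component of the solution operator.
\<close>

locale slow_dae = double_zero_splitting B e q c \<pi>
  for B :: "'y::euclidean_space \<Rightarrow> 'y" and e q :: 'y and c :: real and \<pi> :: "'y \<Rightarrow> real \<times> real" +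
  fixes L :: "'y \<Rightarrow> 'z::euclidean_space"
  assumes lin_L: "linear L"
begin

lemma bounded_linear_L: "bounded_linear L" using lin_L by (simp add: linear_conv_bounded_linear)
lemma bounded_linear_B: "bounded_linear B" using lin_B by (simp add: linear_conv_bounded_linear)

text \<open>
  The conditions say that \<open>\<Phi>\<close> is a \<open>C\<^sup>2\<close> section of \<open>\<pi>\<close>, that its values satisfy the constraint,
  that the vector field is tangent to its image, and that this image contains all equilibria.
\<close>

definition slow_manifold_of :: "('y \<times> 'z \<Rightarrow> 'y \<times> 'z) \<Rightarrow> (real \<times> real \<Rightarrow> 'y \<times> 'z) \<Rightarrow> bool" where
  "slow_manifold_of G \<Phi> \<longleftrightarrow> C2_on UNIV \<Phi> \<and> (\<forall>u. \<pi> (fst (\<Phi> u)) = u) \<and>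
       (\<forall>u. snd (\<Phi> u) = L (fst (\<Phi> u)) + snd (G (\<Phi> u))) \<and>
       (\<forall>u D. ((\<lambda>u. fst (\<Phi> u)) has_derivative D) (at u) \<longrightarrow>
          D (\<pi> (B (fst (\<Phi> u)) + fst (G (\<Phi> u)))) = B (fst (\<Phi> u)) + fst (G (\<Phi> u))) \<and>
       (\<forall>x. B (fst x) + fst (G x) = 0 \<longrightarrow> snd x = L (fst x) + snd (G x) \<longrightarrow> \<Phi> (\<pi> (fst x)) = x)"

text \<open>
  The manifold consists of the initial values of slow solutions. Tangency is obtained by
  differentiating \<open>X u t = \<Phi> (\<pi> (fst (X u t)))\<close> at \<open>t = 0\<close>; this identity holds because the curve
  \<open>s \<mapsto> X u (t + s)\<close> is the slow solution with centre coordinates \<open>\<pi> (fst (X u t))\<close>. An equilibrium is a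
  constant, hence slow, solution.
\<close>

theorem slow_manifold_exists:
  "\<exists>\<epsilon>>0. \<forall>G. small_nonlinearity \<epsilon> G \<longrightarrow> (\<exists>\<Phi>. slow_manifold_of G \<Phi>)"
proof -
  obtain \<beta> where \<beta>0: "0 < \<beta>" "\<forall>\<zeta>. 0 < \<zeta> \<and> \<zeta> < \<beta> \<longrightarrow> (\<exists>\<kappa>\<ge>0. solvable \<zeta> \<kappa>) \<and> determined \<zeta>"
    using slow_linear_solution by blast
  have \<beta>: "0 < \<beta>" "\<And>\<zeta>. 0 < \<zeta> \<Longrightarrow> \<zeta> < \<beta> \<Longrightarrow> \<exists>\<kappa>\<ge>0. solvable \<zeta> \<kappa>"
    "\<And>\<zeta> y t. 0 < \<zeta> \<Longrightarrow> \<zeta> < \<beta> \<Longrightarrow> slow \<zeta> y \<Longrightarrow> (\<And>t. (y has_vector_derivative B (y t)) (at t)) \<Longrightarrow>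
       \<pi> (y 0) = 0 \<Longrightarrow> y t = 0"
    using \<beta>0 by (simp, simp, simp add: determined_def)
  \<comment> \<open>the three weights \<open>\<eta>\<close>, \<open>2 \<eta>\<close>, \<open>3 \<eta>\<close> all lie below the spectral gap \<open>\<beta>\<close>\<close>
  define \<eta> where "\<eta> = \<beta> / 4"
  define Z where "Z = {\<eta>, 2*\<eta>, 3*\<eta>}"
  have \<eta>: "0 < \<eta>" "\<And>\<zeta>. \<zeta> \<in> Z \<Longrightarrow> 0 < \<zeta> \<and> \<zeta> < \<beta> \<and> \<zeta> \<le> 3 * \<eta>" "3*\<eta> \<in> Z"
    using \<beta>(1) by (auto simp: \<eta>_def Z_def)
  have "\<forall>\<zeta>\<in>Z. \<exists>\<kappa>\<ge>0. solvable \<zeta> \<kappa>"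
    using \<beta>(2) \<eta>(2) by simp
  then obtain k where k: "\<And>\<zeta>. \<zeta> \<in> Z \<Longrightarrow> 0 \<le> k \<zeta>" "\<And>\<zeta>. \<zeta> \<in> Z \<Longrightarrow> solvable \<zeta> (k \<zeta>)"
    by metis
  define \<kappa>y where "\<kappa>y = Max (k ` Z)"
  have \<kappa>y: "0 \<le> \<kappa>y" "\<And>\<zeta>. \<zeta> \<in> Z \<Longrightarrow> k \<zeta> \<le> \<kappa>y"
    using k(1)[OF \<eta>(3)] \<eta>(3) unfolding \<kappa>y_def by (auto simp: Z_def max_def)
  define isY where "isY u f y \<longleftrightarrow> slow (3*\<eta>) y \<and> (\<forall>t. (y has_vector_derivative B (y t) + f t) (at t)) \<and> \<pi> (y 0) = u"
    for u :: "real \<times> real" and f y :: "real \<Rightarrow> 'y"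
  have uniq: "y t = y' t" if "isY u f y" "isY u f y'" for u f y y' t
  proof -
    have "y t - y' t = 0"
    proof (rule \<beta>(3)[of "3*\<eta>" "\<lambda>t. y t - y' t"])
      show "slow (3*\<eta>) (\<lambda>t. y t - y' t)" using that by (auto simp: isY_def intro: slow_diff)
      show "((\<lambda>t. y t - y' t) has_vector_derivative B (y t - y' t)) (at t)" for t
        using has_vector_derivative_diff[of y "B (y t) + f t" "at t" y' "B (y' t) + f t"] that
        by (auto simp: isY_def linear_diff[OF lin_B])
      show "\<pi> (y 0 - y' 0) = 0" using that by (simp add: isY_def linear_diff[OF lin_\<pi>])
    qed (use \<eta>(2)[OF \<eta>(3)] in auto)
    then show ?thesis by simp
  qed
  define Y where "Y u f = (SOME y. isY u f y)" for u f
  have ex: "\<exists>y. isY u f y \<and> exp_bounded \<zeta> (\<kappa>y * (norm u + D)) y" if \<zeta>f: "\<zeta> \<in> Z" "exp_bounded \<zeta> D f" for \<zeta> D u f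
  proof -
    obtain y where y: "\<forall>t. (y has_vector_derivative B (y t) + f t) (at t)" "\<pi> (y 0) = u"
      "exp_bounded \<zeta> (k \<zeta> * (norm u + D)) y" using k(2)[OF \<zeta>f(1)] \<zeta>f(2) unfolding solvable_def by blast
    have "exp_bounded \<zeta> (\<kappa>y * (norm u + D)) y"
      by (rule exp_bounded_mono[OF y(3)])
        (use \<kappa>y(2)[OF that(1)] exp_bounded_nonneg[OF that(2)] in \<open>auto intro!: mult_right_mono\<close>)
    moreover have "slow (3*\<eta>) y" using exp_bounded_slow[OF y(3)] \<eta>(2)[OF that(1)] slow_mono by blast
    ultimately show ?thesis using y unfolding isY_def by blast
  qed
  have Y: "isY u f (Y u f)" if "slow (3*\<eta>) f" for u f
    unfolding Y_def using ex[OF \<eta>(3)] that unfolding slow_def by (metis someI_ex)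
  have Y_eq: "Y u f t = y t" if "isY u f y" "slow (3*\<eta>) f" for u f y t
    by (rule uniq[OF Y[OF that(2)] that(1)])
  have Y_bound: "exp_bounded \<zeta> (\<kappa>y * (norm u + D)) (Y u f)" if \<zeta>f: "\<zeta> \<in> Z" "exp_bounded \<zeta> D f" for \<zeta> D u f
  proof -
    obtain y where y: "isY u f y" "exp_bounded \<zeta> (\<kappa>y * (norm u + D)) y" using ex[OF \<zeta>f] by blast
    have "slow (3*\<eta>) f" using exp_bounded_slow[OF that(2)] \<eta>(2)[OF that(1)] slow_mono by blast
    then have "Y u f = y" using Y_eq[OF y(1)] by blast
    with y(2) show ?thesis by simp
  qed
  obtain CL where CL: "0 \<le> CL" "\<And>y. norm (L y) \<le> norm y * CL"
    using bounded_linear.nonneg_bounded[OF bounded_linear_L] by blast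
  define \<kappa> where "\<kappa> = (1 + CL) * \<kappa>y + 1"
  have \<kappa>: "0 < \<kappa>" using CL(1) \<kappa>y(1) by (simp add: \<kappa>_def add_nonneg_pos)
  define Sol where "Sol u f t = (Y u (\<lambda>t. fst (f t)) t, L (Y u (\<lambda>t. fst (f t)) t) + snd (f t :: 'y \<times> 'z))" for u f t
  have eb_fst: "exp_bounded \<zeta> D (\<lambda>t. fst (f t))" if "exp_bounded \<zeta> D f" for \<zeta> D and f :: "real \<Rightarrow> 'y \<times> 'z"
  proof (rule exp_boundedI)
    show "continuous_on UNIV (\<lambda>t. fst (f t))" by (intro continuous_on_fst exp_bounded_continuous[OF that])
    show "norm (fst (f t)) \<le> D * exp (\<zeta> * \<bar>t\<bar>)" for t
      using exp_boundedD[OF that, of t] norm_fst_le[of "fst (f t)" "snd (f t)"] by simp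
  qed
  have slow_fst: "slow \<zeta> (\<lambda>t. fst (f t))" if "slow \<zeta> f" for \<zeta> and f :: "real \<Rightarrow> 'y \<times> 'z"
    using that eb_fst unfolding slow_def by blast
  define \<epsilon> where "\<epsilon> = 1 / (2 * \<kappa>)"
  have \<epsilon>: "0 < \<epsilon>" "\<kappa> * \<epsilon> \<le> 1/2" using \<kappa> by (auto simp: \<epsilon>_def)
  have op: "slow_solution_operator Sol \<eta> \<kappa> \<epsilon>"
  proof
    fix f g :: "real \<Rightarrow> 'y \<times> 'z" and u v t r
    assume f: "slow (3*\<eta>) f"
    note f1 = slow_fst[OF f]
    have "isY (r *\<^sub>R u) (\<lambda>t. fst (r *\<^sub>R f t)) (\<lambda>t. r *\<^sub>R Y u (\<lambda>t. fst (f t)) t)"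
      using Y[OF f1, of u] unfolding isY_def
      by (auto intro!: slow_scaleR derivative_eq_intros simp: linear_scale[OF lin_B] linear_scale[OF lin_\<pi>] scaleR_add_right)
    from Y_eq[OF this slow_fst[OF slow_scaleR[OF f]]]
    show "Sol (r *\<^sub>R u) (\<lambda>t. r *\<^sub>R f t) t = r *\<^sub>R Sol u f t"
      by (simp add: Sol_def linear_scale[OF lin_L] scaleR_add_right)
    assume g: "slow (3*\<eta>) g"
    note g1 = slow_fst[OF g]
    have "isY (u + v) (\<lambda>t. fst (f t + g t)) (\<lambda>t. Y u (\<lambda>t. fst (f t)) t + Y v (\<lambda>t. fst (g t)) t)"
      using Y[OF f1, of u] Y[OF g1, of v] unfolding isY_def
      by (auto intro!: slow_add derivative_eq_intros simp: linear_add[OF lin_B] linear_add[OF lin_\<pi>])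
    from Y_eq[OF this slow_fst[OF slow_add[OF f g]]]
    show "Sol (u + v) (\<lambda>t. f t + g t) t = Sol u f t + Sol v g t"
      by (simp add: Sol_def linear_add[OF lin_L])
  next
    fix \<zeta> D u and f :: "real \<Rightarrow> 'y \<times> 'z"
    assume \<zeta>: "\<zeta> \<in> {\<eta>, 2*\<eta>, 3*\<eta>}" and f: "exp_bounded \<zeta> D f"
    have Yb: "exp_bounded \<zeta> (\<kappa>y * (norm u + D)) (Y u (\<lambda>t. fst (f t)))"
      using Y_bound[OF _ eb_fst[OF f]] \<zeta> by (simp add: Z_def)
    show "exp_bounded \<zeta> (\<kappa> * (norm u + D)) (Sol u f)"
    proof (rule exp_boundedI)
      show "continuous_on UNIV (Sol u f)" unfolding Sol_def[abs_def]
        by (intro continuous_on_Pair continuous_on_add continuous_on_snd exp_bounded_continuous[OF f]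
            exp_bounded_continuous[OF Yb] bounded_linear.continuous_on[OF bounded_linear_L])
      fix t
      let ?E = "exp (\<zeta> * \<bar>t\<bar>)" and ?y = "Y u (\<lambda>t. fst (f t)) t"
      have "norm (Sol u f t) \<le> norm ?y + norm (L ?y + snd (f t))"
        unfolding Sol_def by (rule norm_Pair_le)
      also have "\<dots> \<le> norm ?y + (norm (L ?y) + norm (snd (f t)))" by (intro add_left_mono norm_triangle_ineq)
      also have "\<dots> \<le> norm ?y + (norm ?y * CL + norm (f t))"
        using norm_snd_le[of "snd (f t)" "fst (f t)"] by (intro add_mono CL(2)) auto
      also have "\<dots> = (1 + CL) * norm ?y + norm (f t)" by (simp add: algebra_simps)
      also have "\<dots> \<le> (1 + CL) * (\<kappa>y * (norm u + D) * ?E) + (norm u + D) * ?E"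
      proof (intro add_mono mult_left_mono exp_boundedD[OF Yb])
        have "norm (f t) \<le> D * ?E" by (rule exp_boundedD[OF f])
        also have "\<dots> \<le> (norm u + D) * ?E" by (intro mult_right_mono) auto
        finally show "norm (f t) \<le> (norm u + D) * ?E" .
      qed (use CL(1) in simp)
      also have "\<dots> = \<kappa> * (norm u + D) * ?E" by (simp add: \<kappa>_def algebra_simps)
      finally show "norm (Sol u f t) \<le> \<kappa> * (norm u + D) * ?E" .
    qed
  qed (use \<eta> \<kappa> \<epsilon> in auto)
  show ?thesis
  proof (rule exI[of _ \<epsilon>], intro conjI \<epsilon>(1) allI impI)
    fix G :: "'y \<times> 'z \<Rightarrow> 'y \<times> 'z"
    assume "small_nonlinearity \<epsilon> G"
    then obtain G' G'' M where "G 0 = 0" "\<forall>x. (G has_derivative blinfun_apply (G' x)) (at x)"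
     "\<forall>x. (G' has_derivative blinfun_apply (G'' x)) (at x)"
     "\<forall>x. norm (G' x) \<le> \<epsilon>" "\<forall>x. norm (G'' x) \<le> M"
     "\<forall>r>0. \<exists>C\<ge>0. \<forall>x y. norm (G'' x - G'' y) \<le> r + C * norm (x - y)"
      unfolding small_nonlinearity_def by blast
    then interpret slow_fixed_points Sol \<eta> \<kappa> \<epsilon> G G' G'' M
      using op by (intro slow_fixed_points.intro slow_fixed_points_axioms.intro) auto
    define f where "f x = B (fst x) + fst (G x)" for x
    have solves: "((\<lambda>t. fst (X u t)) has_vector_derivative f (X u t)) (at t)"
      "snd (X u t) = L (fst (X u t)) + snd (G (X u t))" "\<pi> (fst (X u 0)) = u" for u t
    proof -
      let ?g = "\<lambda>t. fst (G (X u t))"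
      have Xeq: "X u t = (Y u ?g t, L (Y u ?g t) + snd (G (X u t)))" for t
        using X_spec(2)[of u t] unfolding Sol_def .
      then have fst_X: "fst (X u t) = Y u ?g t" for t by (metis fst_conv)
      have "isY u ?g (Y u ?g)" by (rule Y[OF slow_fst[OF slow_GX]])
      then show "((\<lambda>t. fst (X u t)) has_vector_derivative f (X u t)) (at t)" "\<pi> (fst (X u 0)) = u"
        unfolding fst_X isY_def f_def by auto
      show "snd (X u t) = L (fst (X u t)) + snd (G (X u t))"
        unfolding fst_X using Xeq[of t] by (metis snd_conv)
    qed
    have is_X: "x t = X (\<pi> (fst (x 0))) t"
      if "slow \<eta> x" "\<And>t. ((\<lambda>t. fst (x t)) has_vector_derivative f (x t)) (at t)"
        "\<And>t. snd (x t) = L (fst (x t)) + snd (G (x t))" for x t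
    proof (rule X_unique[OF that(1)])
      fix t
      have "isY (\<pi> (fst (x 0))) (\<lambda>t. fst (G (x t))) (\<lambda>t. fst (x t))"
        unfolding isY_def using that(2) slow_mono[OF slow_fst[OF that(1)] eta_le(1)] by (simp add: f_def)
      from Y_eq[OF this slow_fst[OF slow_mono[OF slow_G[OF that(1)] eta_le(1)]]]
      show "x t = Sol (\<pi> (fst (x 0))) (\<lambda>s. G (x s)) t"
        unfolding Sol_def using that(3)[of t] by (simp add: prod_eq_iff)
    qed
    define \<Phi> where "\<Phi> u = X u 0" for u
    have inv: "\<Phi> (\<pi> (fst (X u t))) = X u t" for u t
    proof -
      have "X u (t + 0) = X (\<pi> (fst (X u (t + 0)))) 0"
      proof (rule is_X[of "\<lambda>s. X u (t + s)"])
        show "slow \<eta> (\<lambda>s. X u (t + s))" using slow_shift[OF _ X_spec(1)] eta_pos by simp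
        fix s
        show "snd (X u (t + s)) = L (fst (X u (t + s))) + snd (G (X u (t + s)))" by (rule solves(2))
        have "(((\<lambda>t. fst (X u t)) \<circ> (\<lambda>s. t + s)) has_vector_derivative 1 *\<^sub>R f (X u (t + s))) (at s)"
          by (rule vector_diff_chain_at[OF _ solves(1)]) (auto intro!: derivative_eq_intros)
        then show "((\<lambda>s. fst (X u (t + s))) has_vector_derivative f (X u (t + s))) (at s)" by (simp add: o_def)
      qed
      then show ?thesis by (simp add: \<Phi>_def)
    qed
    have tangent: "D (\<pi> (f (\<Phi> u))) = f (\<Phi> u)" if D: "((\<lambda>u. fst (\<Phi> u)) has_derivative D) (at u)" for u D
    proof -
      have 1: "((\<lambda>t. \<pi> (fst (X u t))) has_vector_derivative \<pi> (f (X u 0))) (at 0)"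
        by (rule bounded_linear.has_vector_derivative[OF bounded_linear_\<pi> solves(1)])
      have "((\<lambda>t. fst (\<Phi> (\<pi> (fst (X u t))))) has_vector_derivative D (\<pi> (f (X u 0)))) (at 0)"
      proof -
        have "((\<lambda>t. fst (\<Phi> (\<pi> (fst (X u t))))) has_derivative (\<lambda>a. D (a *\<^sub>R \<pi> (f (X u 0))))) (at 0)"
          using diff_chain_at[OF 1[unfolded has_vector_derivative_def], of "\<lambda>u. fst (\<Phi> u)" D] D solves(3)[of u]
          by (simp add: o_def)
        then show ?thesis
          unfolding has_vector_derivative_def using linear_scale[OF has_derivative_linear[OF D]] by simp
      qed
      then have "((\<lambda>t. fst (X u t)) has_vector_derivative D (\<pi> (f (X u 0)))) (at 0)" by (simp add: inv)
      from vector_derivative_unique_at[OF this solves(1)] show ?thesis by (simp add: \<Phi>_def)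
    qed
    have equil: "\<Phi> (\<pi> (fst x)) = x" if "f x = 0" "snd x = L (fst x) + snd (G x)" for x
    proof -
      have "exp_bounded \<eta> (norm x) (\<lambda>_::real. x)"
        using eta_pos by (intro exp_boundedI) (auto simp: mult_le_cancel_left1)
      then have "slow \<eta> (\<lambda>_::real. x)" by (rule exp_bounded_slow)
      from is_X[OF this] that show ?thesis by (simp add: \<Phi>_def)
    qed
    show "\<exists>\<Phi>. slow_manifold_of G \<Phi>" unfolding slow_manifold_of_def
      by (rule exI[of _ \<Phi>]) (use C2_on_X solves tangent equil in \<open>auto simp: \<Phi>_def[abs_def] f_def\<close>)
  qed
qed

end


section \<open>Spectral data of the pencil\<close>

lemma functional_vanishing_on_subspace:
  fixes x :: "'a::euclidean_space"
  assumes S: "subspace S" and x: "x \<notin> S"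
  obtains a where "\<And>y. y \<in> S \<Longrightarrow> a \<bullet> y = 0" "a \<bullet> x = 1"
proof -
  obtain y z where yz: "y \<in> span S" "\<And>w. w \<in> span S \<Longrightarrow> orthogonal z w" "x = y + z"
    using orthogonal_subspace_decomp_exists by blast
  have "z \<noteq> 0" using yz(1,3) x span_eq_iff[THEN iffD2, OF S] by auto
  moreover have "z \<bullet> x = z \<bullet> z" using yz by (auto simp: inner_add_right orthogonal_def)
  ultimately show thesis
    using that[of "z /\<^sub>R (z \<bullet> z)"] yz(2) by (auto simp: orthogonal_def span_base)
qed

text \<open>
  The second coordinate is a functional that vanishes on the range of \<open>B\<close>; it can be normalized to 1
  at \<open>q\<close> because a preimage of \<open>q\<close> would continue the Jordan chain. The first coordinate is \<open>c\<close> times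
  a preimage of the second one under the adjoint of \<open>B\<close>, which exists because the second one vanishes
  on the kernel of \<open>B\<close>; subtracting a multiple of the second coordinate makes it vanish at \<open>q\<close>.
\<close>

lemma double_zero_coordinates:
  fixes B :: "'y::euclidean_space \<Rightarrow> 'y"
  assumes B: "linear B" and e: "e \<noteq> 0" "B e = 0" and q: "B q = c *\<^sub>R e" "c \<noteq> 0"
    and ker: "\<And>y. B y = 0 \<Longrightarrow> y \<in> span {e}"
    and chain: "\<And>y. B (B (B y)) = 0 \<Longrightarrow> B (B y) = 0"
  obtains \<pi> :: "'y \<Rightarrow> real \<times> real"
    where "linear \<pi>" "\<pi> e = (1, 0)" "\<pi> q = (0, 1)" "\<And>y. \<pi> (B y) = (c * snd (\<pi> y), 0)"
proof -
  have "q \<notin> range B"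
  proof
    assume "q \<in> range B"
    then obtain x where x: "q = B x" by blast
    have "B (B (B x)) = 0" using q e(2) x by (simp add: linear_scale[OF B])
    then have "B (B x) = 0" by (rule chain)
    then show False using x q e(1) by simp
  qed
  then obtain a where a: "\<And>y. a \<bullet> B y = 0" "a \<bullet> q = 1"
    by (rule functional_vanishing_on_subspace[OF linear_subspace_image[OF B subspace_UNIV]]) blast
  have "B (q /\<^sub>R c) = e" using q by (simp add: linear_scale[OF B])
  then have ae: "a \<bullet> e = 0" using a(1) by metis
  have "c *\<^sub>R a \<in> range (adjoint B)"
  proof (rule ccontr)
    assume "\<not> ?thesis"
    then obtain w where w: "\<And>y. w \<bullet> adjoint B y = 0" "w \<bullet> (c *\<^sub>R a) = 1"
      by (rule functional_vanishing_on_subspace[OF linear_subspace_image[OF adjoint_linear[OF B] subspace_UNIV]]) blast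
    have "B w \<bullet> B w = 0" using w(1)[of "B w"] adjoint_works[OF B, of w "B w"] by simp
    then have "w \<in> span {e}" using ker by simp
    then obtain k where "w = k *\<^sub>R e" by (auto simp: span_singleton)
    then show False using w(2) ae by (simp add: inner_commute)
  qed
  then obtain a1 where a1: "adjoint B a1 = c *\<^sub>R a" by force
  have a1B: "a1 \<bullet> B y = c * (a \<bullet> y)" for y
    using adjoint_works[OF B, of y a1] a1 by (simp add: inner_commute)
  have a1e: "a1 \<bullet> e = 1" using a1B[of q] q a(2) by simp
  define \<pi> where "\<pi> y = (a1 \<bullet> y - (a1 \<bullet> q) * (a \<bullet> y), a \<bullet> y)" for y
  show thesis
  proof (rule that[of \<pi>])
    show "linear \<pi>" by (rule linearI) (auto simp: \<pi>_def inner_add_right algebra_simps)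
  qed (simp_all add: \<pi>_def a1e ae a a1B)
qed

lemma join_vec_nth [simp]: "join_vec v w $ Inl a = v $ a" "join_vec v w $ Inr b = w $ b"
  by (simp_all add: join_vec_def)

lemma join_vec_eq_iff: "join_vec v w = join_vec v' w' \<longleftrightarrow> v = v' \<and> w = w'"
  by (metis join_vec_nth vec_eq_iff)

lemma join_vec_0 [simp]: "join_vec 0 0 = 0"
  by (simp add: vec_eq_iff join_vec_def split: sum.split)

lemma E_mat_apply: "(\<Sum>j\<in>UNIV. (E_mat :: real ^ ('r::finite + 'p::finite) ^ ('r + 'p)) $ i $ j * x $ j)
    = (case i of Inl a \<Rightarrow> x $ Inl a | Inr b \<Rightarrow> 0)"
  by (cases i) (simp_all add: E_mat_def if_distrib[of "\<lambda>y. y * _"] cong: if_cong)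

text \<open>
  A complex eigenvector \<open>a + \<i> b\<close> of \<open>B\<close>, completed by the \<open>z\<close>-component \<open>L (a + \<i> b)\<close>, lies in the
  kernel of \<open>l E - A\<close>.
\<close>

lemma pencil_eigenvalue_of_reduced:
  fixes A :: "real ^ ('r::finite + 'p::finite) ^ ('r + 'p)" and B :: "real ^ 'r \<Rightarrow> real ^ 'r"
  assumes B: "linear B" and AB: "\<And>y. A *v join_vec y (L y) = join_vec (B y) 0"
    and v: "v \<noteq> 0" "cB B v = cs l v"
  shows "pencil_eigenvalue E_mat A l"
proof -
  let ?X = "\<lambda>y. join_vec y (L y)"
  obtain a b where ab: "v = (a, b)" by (cases v)
  have Ba: "B a = Re l *\<^sub>R a - Im l *\<^sub>R b" and Bb: "B b = Re l *\<^sub>R b + Im l *\<^sub>R a"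
    using v(2) by (simp_all add: ab cB_def[OF B] cs_def)
  define x :: "complex ^ ('r + 'p)" where "x = (\<chi> i. Complex (?X a $ i) (?X b $ i))"
  define M :: "complex ^ ('r + 'p) ^ ('r + 'p)"
    where "M = (\<chi> i j. l * complex_of_real (E_mat $ i $ j) - complex_of_real (A $ i $ j))"
  have "M *v x = 0"
  proof (rule vec_eq_iff[THEN iffD2], rule allI)
    fix i
    have xj: "x $ j = of_real (?X a $ j) + \<i> * of_real (?X b $ j)" for j
      by (simp add: x_def complex_eq_iff)
    have "(M *v x) $ i = (\<Sum>j\<in>UNIV. (l * of_real (E_mat $ i $ j) - of_real (A $ i $ j)) * x $ j)"
      by (simp add: matrix_vector_mult_def M_def)
    also have "\<dots> = l * (of_real (\<Sum>j\<in>UNIV. E_mat $ i $ j * ?X a $ j) + \<i> * of_real (\<Sum>j\<in>UNIV. E_mat $ i $ j * ?X b $ j))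
        - (of_real (\<Sum>j\<in>UNIV. A $ i $ j * ?X a $ j) + \<i> * of_real (\<Sum>j\<in>UNIV. A $ i $ j * ?X b $ j))"
      unfolding xj by (simp add: algebra_simps sum.distrib sum_subtractf sum_distrib_left)
    also have "(\<Sum>j\<in>UNIV. A $ i $ j * ?X a $ j) = join_vec (B a) 0 $ i"
      using AB[of a] by (simp add: matrix_vector_mult_def vec_eq_iff)
    also have "(\<Sum>j\<in>UNIV. A $ i $ j * ?X b $ j) = join_vec (B b) 0 $ i"
      using AB[of b] by (simp add: matrix_vector_mult_def vec_eq_iff)
    finally have "(M *v x) $ i = l * (of_real (case i of Inl c \<Rightarrow> ?X a $ Inl c | Inr d \<Rightarrow> 0) + \<i> * of_real (case i of Inl c \<Rightarrow> ?X b $ Inl c | Inr d \<Rightarrow> 0))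
        - (of_real (join_vec (B a) 0 $ i) + \<i> * of_real (join_vec (B b) 0 $ i))"
      unfolding E_mat_apply .
    also have "\<dots> = 0"
      by (cases i) (simp_all add: Ba Bb complex_eq_iff algebra_simps)
    finally show "(M *v x) $ i = 0 $ i" by simp
  qed
  moreover have "x \<noteq> 0"
  proof
    assume "x = 0"
    have "a $ i = 0 \<and> b $ i = 0" for i
      using arg_cong[OF \<open>x = 0\<close>, of "\<lambda>x. x $ Inl i"] by (simp add: x_def complex_eq_iff)
    then have "a = 0" "b = 0" by (simp_all add: vec_eq_iff)
    then show False using v(1) by (simp add: ab zero_prod_def)
  qed
  ultimately have "det M = 0"
    using matrix_left_invertible_ker[of M] invertible_det_nz[of M] invertible_left_inverse[of M] by blast
  then show ?thesis by (simp add: pencil_eigenvalue_def poly_pencil_poly M_def)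
qed

lemma dvd_det_of_dvd_column:
  fixes M :: "'a::comm_ring_1 ^ 'n ^ 'n"
  assumes "\<And>i. c dvd M $ i $ k"
  shows "c dvd det M"
  unfolding det_def
proof (rule dvd_sum)
  fix p assume "p \<in> {p. p permutes (UNIV :: 'n set)}"
  then obtain i where i: "p i = k" by (metis mem_Collect_eq permutes_def)
  have "M $ i $ p i dvd (\<Prod>i\<in>UNIV. M $ i $ p i)" by (rule dvd_prodI) auto
  then show "c dvd of_int (sign p) * (\<Prod>i\<in>UNIV. M $ i $ p i)"
    using assms[of i] i by (metis dvd_mult dvd_trans)
qed

lemma poly_det:
  fixes M :: "'a::comm_ring_1 poly ^ 'n ^ 'n"
  shows "poly (det M) z = det (\<chi> i j. poly (M $ i $ j) z)"
  by (simp add: det_def poly_sum poly_prod)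

text \<open>
  A Jordan chain of length 3 would yield vectors \<open>X0, X1, X2\<close> with
  \<open>(z E - A) (X0 + z X1 + z\<^sup>2 X2) = z\<^sup>3 E X2\<close>. Replacing one column of the identity matrix by the vector
  polynomial on the left gives a matrix \<open>N\<close> for which \<open>z\<^sup>3\<close> divides \<open>det (z E - A) * det N\<close>. Since \<open>X0\<close>
  is a nonzero multiple of the unit vector that was replaced, \<open>det N\<close> does not vanish at 0, so 0 would
  be a root of the pencil polynomial of order at least 3.
\<close>

lemma pencil_chain_length:
  fixes A :: "real ^ ('r::finite + 'p::finite) ^ ('r + 'p)" and B :: "real ^ 'r \<Rightarrow> real ^ 'r"
  assumes B: "linear B" and AB: "\<And>y. A *v join_vec y (L y) = join_vec (B y) 0"
    and nz: "pencil_poly E_mat A \<noteq> 0" and ord: "order 0 (pencil_poly E_mat A) = 2"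
    and ker: "\<And>v. A *v v = 0 \<Longrightarrow> v \<in> span {axis (Inl k) 1}"
    and x: "B (B (B x)) = 0"
  shows "B (B x) = 0"
proof (rule ccontr)
  assume ne: "B (B x) \<noteq> 0"
  let ?X = "\<lambda>y. join_vec y (L y)"
  have "A *v ?X (B (B x)) = 0" by (simp add: AB x)
  then obtain \<alpha> where \<alpha>: "?X (B (B x)) = \<alpha> *\<^sub>R axis (Inl k) 1" using ker by (auto simp: span_singleton)
  have "\<alpha> \<noteq> 0"
  proof
    assume "\<alpha> = 0"
    then have "?X (B (B x)) $ Inl i = 0" for i by (simp add: \<alpha>)
    then show False using ne by (simp add: vec_eq_iff)
  qed
  define P :: "complex poly ^ ('r + 'p) ^ ('r + 'p)"
    where "P = (\<chi> i j. [: - complex_of_real (A $ i $ j), complex_of_real (E_mat $ i $ j) :])"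
  define X where "X i = [: of_real (?X (B (B x)) $ i), of_real (?X (B x) $ i), complex_of_real (?X x $ i) :]" for i
  define N :: "complex poly ^ ('r + 'p) ^ ('r + 'p)"
    where "N = (\<chi> i j. if j = Inl k then X i else if i = j then 1 else 0)"
  have "det P * det N = det (P ** N)" by (simp add: det_mul)
  moreover have "[:0, 1:] ^ 3 dvd det (P ** N)"
  proof (rule dvd_det_of_dvd_column)
    fix i
    have lin: "(\<Sum>j\<in>UNIV. complex_of_real (C $ i $ j) * of_real (v $ j)) = of_real ((C *v v) $ i)"
      for C :: "real ^ ('r + 'p) ^ ('r + 'p)" and v
      by (simp add: matrix_vector_mult_def)
    have Ev: "(E_mat *v v) $ i = (case i of Inl a \<Rightarrow> v $ Inl a | Inr b \<Rightarrow> 0)" for v :: "real ^ ('r + 'p)"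
      using E_mat_apply[of i v] by (simp add: matrix_vector_mult_def)
    have join0: "join_vec w 0 $ i = (case i of Inl a \<Rightarrow> w $ a | Inr b \<Rightarrow> 0)" for w :: "real ^ 'r"
      by (cases i) simp_all
    have "(P ** N) $ i $ Inl k = (\<Sum>j\<in>UNIV. P $ i $ j * X j)"
      by (simp add: matrix_matrix_mult_def N_def)
    also have "\<dots> = [: of_real (- (A *v ?X (B (B x))) $ i),
        of_real ((E_mat *v ?X (B (B x))) $ i - (A *v ?X (B x)) $ i),
        of_real ((E_mat *v ?X (B x)) $ i - (A *v ?X x) $ i), of_real ((E_mat *v ?X x) $ i) :]"
      by (simp add: P_def X_def poly_eq_iff coeff_sum coeff_pCons lin[symmetric] sum_negf sum_subtractf sum.distrib
          algebra_simps split: nat.split)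
    also have "\<dots> = [: 0, 0, 0, of_real ((E_mat *v ?X x) $ i) :]"
      unfolding AB Ev join0 x by (cases i) simp_all
    also have "\<dots> = [:0, 1:] ^ 3 * [: of_real ((E_mat *v ?X x) $ i) :]"
      by (simp add: power3_eq_cube)
    finally show "[:0, 1:] ^ 3 dvd (P ** N) $ i $ Inl k" by (simp only: dvd_triv_left)
  qed
  moreover have "poly (det N) 0 \<noteq> 0"
  proof -
    have "(\<chi> i j. poly (N $ i $ j) 0)
        = (\<chi> i (j :: 'r + 'p). if i = j then (if j = Inl k then complex_of_real \<alpha> else 1) else 0)"
      by (auto simp: N_def X_def \<alpha> vec_eq_iff axis_def)
    then have "poly (det N) 0 = det (\<chi> i (j :: 'r + 'p). if i = j then (if j = Inl k then complex_of_real \<alpha> else 1) else 0)"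
      unfolding poly_det by (simp only:)
    also have "\<dots> = (\<Prod>i\<in>(UNIV :: ('r + 'p) set). if i = Inl k then complex_of_real \<alpha> else 1)"
      by (subst det_diagonal) auto
    also have "\<dots> \<noteq> 0" using \<open>\<alpha> \<noteq> 0\<close> by (simp add: prod_zero_iff)
    finally show ?thesis .
  qed
  ultimately have "[:- 0, 1:] ^ 3 dvd det P * det N" "poly (det N) 0 \<noteq> 0" by auto
  moreover have "det P = pencil_poly E_mat A" by (simp add: P_def pencil_poly_def)
  moreover have "det P * det N \<noteq> 0" using nz \<open>poly (det N) 0 \<noteq> 0\<close> \<open>det P = _\<close> by auto
  ultimately have "3 \<le> order 0 (det P * det N)" using order_divides[of 0 3 "det P * det N"] by simp
  also have "\<dots> = 2 + order 0 (det N)"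
    using order_mult[OF \<open>det P * det N \<noteq> 0\<close>] ord \<open>det P = _\<close> by simp
  also have "order 0 (det N) = 0" using \<open>poly (det N) 0 \<noteq> 0\<close> by (rule order_0I)
  finally show False by simp
qed


section \<open>The centre manifold of a differential-algebraic system\<close>

text \<open>
  The function \<open>exp (- 2 K t) * (w t \<bullet> w t)\<close> is nonincreasing and \<open>exp (2 K t) * (w t \<bullet> w t)\<close> is
  nondecreasing, which settles the times after and before \<open>t0\<close>.
\<close>

lemma zero_of_linear_growth:
  fixes w :: "real \<Rightarrow> 'a::real_inner"
  assumes J: "is_interval J" and t0: "t0 \<in> J" "w t0 = 0" and t: "t \<in> J"
    and w': "\<And>t. t \<in> J \<Longrightarrow> (w has_vector_derivative w' t) (at t within J)"
    and bound: "\<And>t. t \<in> J \<Longrightarrow> norm (w' t) \<le> K * norm (w t)"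
  shows "w t = 0"
proof -
  have seg: "{a..b} \<subseteq> J" if "a \<in> J" "b \<in> J" for a b
  proof
    fix x assume "x \<in> {a..b}"
    then show "x \<in> J" using J that unfolding is_interval_1 by (meson atLeastAtMost_iff)
  qed
  have cont: "continuous_on J w"
    unfolding continuous_on_eq_continuous_within
    by (intro ballI has_vector_derivative_continuous[OF w'])
  have deriv: "((\<lambda>s. exp (m * s) * (w s \<bullet> w s)) has_real_derivative
      exp (m * s) * (2 * (w s \<bullet> w' s) + m * (w s \<bullet> w s))) (at s)"
    if "a \<in> J" "b \<in> J" "a < s" "s < b" for a b s m
  proof -
    have "s \<in> J" using seg[OF that(1,2)] that(3,4) by (meson atLeastAtMost_iff less_imp_le subsetD)
    then have "(w has_vector_derivative w' s) (at s within {a..b})"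
      by (rule has_vector_derivative_within_subset[OF w' seg[OF that(1,2)]])
    then have *: "(w has_vector_derivative w' s) (at s)"
      using that(3,4) by (simp add: at_within_Icc_at)
    have "((\<lambda>s. w s \<bullet> w s) has_real_derivative 2 * (w s \<bullet> w' s)) (at s)"
      using bounded_bilinear.has_vector_derivative[OF bounded_bilinear_inner * *]
      unfolding has_real_derivative_iff_has_vector_derivative by (simp add: inner_commute)
    then show ?thesis by (auto intro!: derivative_eq_intros simp: algebra_simps)
  qed
  have est: "\<bar>2 * (w s \<bullet> w' s)\<bar> \<le> 2 * K * (w s \<bullet> w s)" if "s \<in> J" for s
  proof -
    have "\<bar>w s \<bullet> w' s\<bar> \<le> norm (w s) * norm (w' s)" by (rule Cauchy_Schwarz_ineq2)
    also have "\<dots> \<le> norm (w s) * (K * norm (w s))" by (intro mult_left_mono bound that) simp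
    finally show ?thesis by (simp add: dot_square_norm power2_eq_square mult_ac)
  qed
  have inJ: "s \<in> J" if "a \<in> J" "b \<in> J" "a < s" "s < b" for a b s
    using seg[OF that(1,2)] that(3,4) by (meson atLeastAtMost_iff less_imp_le subsetD)
  have cont': "continuous_on {a..b} (\<lambda>s. exp (m * s) * (w s \<bullet> w s))" if "a \<in> J" "b \<in> J" for a b m
    by (intro continuous_intros continuous_on_subset[OF cont seg[OF that]])
  consider "t = t0" | "t0 < t" | "t < t0" by linarith
  then have "w t \<bullet> w t \<le> 0"
  proof cases
    case 2
    let ?f = "\<lambda>s. exp (- (2 * K) * s) * (w s \<bullet> w s)"
    have "?f t \<le> ?f t0"
    proof (rule DERIV_nonpos_imp_decreasing_open[OF less_imp_le[OF 2]])
      fix s assume s: "t0 < s" "s < t"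
      show "\<exists>y. (?f has_real_derivative y) (at s) \<and> y \<le> 0"
      proof (rule exI, rule conjI)
        show "(?f has_real_derivative exp (- (2 * K) * s) * (2 * (w s \<bullet> w' s) + - (2 * K) * (w s \<bullet> w s))) (at s)"
          by (rule deriv[OF t0(1) t s])
        show "exp (- (2 * K) * s) * (2 * (w s \<bullet> w' s) + - (2 * K) * (w s \<bullet> w s)) \<le> 0"
          using est[OF inJ[OF t0(1) t s]] by (intro mult_nonneg_nonpos) auto
      qed
    qed (rule cont'[OF t0(1) t])
    then show ?thesis using t0(2) by (simp add: mult_le_0_iff)
  next
    case 3
    let ?f = "\<lambda>s. exp (2 * K * s) * (w s \<bullet> w s)"
    have "?f t \<le> ?f t0"
    proof (rule DERIV_nonneg_imp_increasing_open[OF less_imp_le[OF 3]])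
      fix s assume s: "t < s" "s < t0"
      show "\<exists>y. (?f has_real_derivative y) (at s) \<and> 0 \<le> y"
      proof (rule exI, rule conjI)
        show "(?f has_real_derivative exp (2 * K * s) * (2 * (w s \<bullet> w' s) + 2 * K * (w s \<bullet> w s))) (at s)"
          by (rule deriv[OF t t0(1) s])
        show "0 \<le> exp (2 * K * s) * (2 * (w s \<bullet> w' s) + 2 * K * (w s \<bullet> w s))"
          using est[OF inJ[OF t t0(1) s]] by (intro mult_nonneg_nonneg) auto
      qed
    qed (rule cont'[OF t t0(1)])
    then show ?thesis using t0(2) by (simp add: mult_le_0_iff)
  qed (use t0 in simp)
  then show ?thesis by (metis inner_eq_zero_iff inner_ge_zero order_antisym)
qed

lemma small_nonlinearity_mono:
  "small_nonlinearity \<epsilon> G \<Longrightarrow> \<epsilon> \<le> \<epsilon>' \<Longrightarrow> small_nonlinearity \<epsilon>' G"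
  unfolding small_nonlinearity_def by (meson order_trans)

lemma small_nonlinearity_lipschitz:
  assumes "small_nonlinearity \<epsilon> G" shows "norm (G x - G y) \<le> \<epsilon> * norm (x - y)"
proof -
  obtain G' where "\<And>x. (G has_derivative blinfun_apply (G' x)) (at x)" "\<And>x. norm (G' x) \<le> \<epsilon>"
    using assms unfolding small_nonlinearity_def by blast
  then show ?thesis
    using differentiable_bound[of UNIV G "\<lambda>x. blinfun_apply (G' x)" \<epsilon> x y] by (simp add: norm_blinfun.rep_eq)
qed

text \<open>
  A system \<open>y' = h (y, z)\<close>, \<open>0 = g (y, z)\<close> on a product space. \<open>Gi\<close> is the inverse of the partial
  derivative of \<open>g\<close> in \<open>z\<close>, the graph of \<open>L\<close> is the kernel of the derivative of \<open>g\<close>, and \<open>B\<close> is the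
  derivative of \<open>h\<close> on this graph.
\<close>

locale index_one_dae = slow_dae B e q c \<pi> L
  for B :: "'y::euclidean_space \<Rightarrow> 'y" and e q :: 'y and c :: real and \<pi> :: "'y \<Rightarrow> real \<times> real"
    and L :: "'y \<Rightarrow> 'z::euclidean_space" +
  fixes h :: "'y \<times> 'z \<Rightarrow> 'y" and g :: "'y \<times> 'z \<Rightarrow> 'z"
    and Dh :: "'y \<times> 'z \<Rightarrow> 'y" and Dg :: "'y \<times> 'z \<Rightarrow> 'z" and Gi :: "'z \<Rightarrow> 'z"
  assumes C2_h: "C2_on UNIV h" and C2_g: "C2_on UNIV g"
    and Dh: "(h has_derivative Dh) (at 0)" and Dg: "(g has_derivative Dg) (at 0)"
    and lin_Gi: "linear Gi" and Gi: "\<And>z. Gi (Dg (0, z)) = z" and Gi_inj: "\<And>z. Gi z = 0 \<Longrightarrow> z = 0"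
    and Dg_L: "\<And>y. Dg (y, L y) = 0" and Dh_L: "\<And>y. Dh (y, L y) = B y"
    and c: "c \<noteq> 0" and ker_B: "\<And>y. B y = 0 \<Longrightarrow> y \<in> span {e}"
    and equilibria: "\<And>s. h (s *\<^sub>R e, 0) = 0" "\<And>s. g (s *\<^sub>R e, 0) = 0"
begin

lemma lin_Dh: "linear Dh" and lin_Dg: "linear Dg"
  using Dh Dg by (auto dest: has_derivative_linear)

text \<open>
  The nonlinear part, after the linear part of the constraint has been solved for \<open>z\<close> and the
  solution has been inserted into \<open>h\<close>.
\<close>

definition N :: "'y \<times> 'z \<Rightarrow> 'y \<times> 'z" where
  "N x = (h x - Dh x - Dh (0, Gi (g x - Dg x)), - Gi (g x - Dg x))"

lemma constraint_iff: "g x = 0 \<longleftrightarrow> snd x = L (fst x) + snd (N x)"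
proof -
  have "x = (fst x, L (fst x)) + (0, snd x - L (fst x))" by (simp add: prod_eq_iff)
  then have "Dg x = Dg (fst x, L (fst x)) + Dg (0, snd x - L (fst x))" by (metis linear_add[OF lin_Dg])
  then have "Gi (Dg x) = snd x - L (fst x)" by (simp add: Dg_L Gi)
  then have "snd (N x) = snd x - L (fst x) - Gi (g x)" by (simp add: N_def linear_diff[OF lin_Gi])
  moreover have "Gi (g x) = 0 \<longleftrightarrow> g x = 0" using Gi_inj linear_0[OF lin_Gi] by metis
  ultimately show ?thesis by (auto simp: algebra_simps)
qed

lemma field_eq:
  assumes "g x = 0" shows "h x = B (fst x) + fst (N x)"
proof -
  have "snd x = L (fst x) + snd (N x)" using assms constraint_iff by blast
  then have "x = (fst x, L (fst x)) + (0, snd (N x))" by (simp add: prod_eq_iff)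
  then have a: "Dh x = B (fst x) + Dh (0, snd (N x))" by (metis linear_add[OF lin_Dh] Dh_L)
  have b: "Dh (0, Gi (g x - Dg x)) = - Dh (0, snd (N x))"
    using linear_neg[OF lin_Dh, of "(0, Gi (g x - Dg x))"] by (simp add: N_def)
  have "fst (N x) = h x - Dh x - Dh (0, Gi (g x - Dg x))" by (simp add: N_def)
  then show ?thesis unfolding b unfolding a by simp
qed

lemma h_0: "h 0 = 0" and g_0: "g 0 = 0"
  using equilibria[of 0] by (simp_all add: zero_prod_def)

lemma C2_N: "C2_on UNIV N"
proof -
  have bl: "bounded_linear Dh" "bounded_linear Dg" "bounded_linear Gi"
    using lin_Dh lin_Dg lin_Gi by (simp_all add: linear_conv_bounded_linear)
  have bl0: "bounded_linear (\<lambda>z. Dh (0, z))"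
    by (intro bounded_linear_compose[OF bl(1)] bounded_linear_Pair bounded_linear_zero bounded_linear_ident)
  have G: "C2_on UNIV (\<lambda>x. Gi (g x - Dg x))"
    by (intro C2_on_linear_compose[OF bl(3)] C2_on_minus C2_g C2_on_bounded_linear bl)
  show ?thesis unfolding N_def[abs_def]
    by (intro C2_on_Pair C2_on_minus C2_h C2_on_bounded_linear[OF bl(1)] C2_on_linear_compose[OF bl0 G]
        C2_on_linear_compose[OF bounded_linear_minus[OF bounded_linear_ident] G])
qed

lemma N_0: "N 0 = 0"
  by (simp add: N_def h_0 g_0 linear_0[OF lin_Dh] linear_0[OF lin_Dg] linear_0[OF lin_Gi]
      zero_prod_def[symmetric])

lemma N_derivative_0: "(N has_derivative (\<lambda>_. 0)) (at 0)"
proof -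
  have bl: "bounded_linear Dh" "bounded_linear Dg" "bounded_linear Gi"
    using lin_Dh lin_Dg lin_Gi by (simp_all add: linear_conv_bounded_linear)
  have G: "((\<lambda>x. Gi (g x - Dg x)) has_derivative (\<lambda>a. Gi (Dg a - Dg a))) (at 0)"
    by (intro bounded_linear.has_derivative[OF bl(3)] has_derivative_diff Dg bounded_linear_imp_has_derivative bl)
  have "((\<lambda>x. Dh (0, Gi (g x - Dg x))) has_derivative (\<lambda>a. Dh (0, Gi (Dg a - Dg a)))) (at 0)"
    by (intro bounded_linear.has_derivative[OF bl(1)] has_derivative_Pair has_derivative_const G)
  from has_derivative_Pair[OF has_derivative_diff[OF has_derivative_diff[OF Dh bounded_linear_imp_has_derivative[OF bl(1)]] this]
      has_derivative_minus[OF G]]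
  show ?thesis unfolding N_def[abs_def]
    by (simp add: linear_0[OF lin_Gi] zero_prod_def[symmetric] linear_0[OF lin_Dh])
qed

text \<open>
  The manifold is that of the cut-off system. In the ball of radius \<open>\<delta>\<close> the cut-off changes nothing,
  so there \<open>h\<close> and \<open>g\<close> can replace the cut-off expressions. The last assertion prepares local
  invariance: for a point \<open>x\<close> of the constraint set, the defect of tangency at \<open>x\<close> vanishes on the
  manifold and is Lipschitz in \<open>x\<close>, hence is bounded by the distance to \<open>\<Phi> u\<close>. This in turn is bounded
  by the distance of the \<open>y\<close>-components, since \<open>z = L y + \<dots>\<close> with a Lipschitz constant at most 1/2.
\<close>

theorem center_manifold:
  obtains \<Phi> :: "real \<times> real \<Rightarrow> 'y \<times> 'z" and \<delta> K :: real where
    "0 < \<delta>" "C2_on UNIV \<Phi>" "\<And>u. \<pi> (fst (\<Phi> u)) = u" "\<Phi> 0 = 0"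
    "\<And>u. norm (\<Phi> u) \<le> \<delta> \<Longrightarrow> g (\<Phi> u) = 0"
    "\<And>u D. norm (\<Phi> u) \<le> \<delta> \<Longrightarrow> ((\<lambda>u. fst (\<Phi> u)) has_derivative D) (at u) \<Longrightarrow> D (\<pi> (h (\<Phi> u))) = h (\<Phi> u)"
    "\<And>s. \<bar>s\<bar> * norm e \<le> \<delta> \<Longrightarrow> \<Phi> (s, 0) = (s *\<^sub>R e, 0)"
    "\<And>x u D. norm x \<le> \<delta> \<Longrightarrow> g x = 0 \<Longrightarrow> u = \<pi> (fst x) \<Longrightarrow> norm u \<le> 1 \<Longrightarrow> norm (\<Phi> u) \<le> \<delta> \<Longrightarrow>
       ((\<lambda>u. fst (\<Phi> u)) has_derivative D) (at u) \<Longrightarrow>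
       norm (x - \<Phi> u) \<le> K * norm (fst x - fst (\<Phi> u)) \<and>
       norm (h x - D (\<pi> (h x))) \<le> K * norm (fst x - fst (\<Phi> u))"
proof -
  obtain \<epsilon>0 where \<epsilon>0: "0 < \<epsilon>0"
    "\<And>G. small_nonlinearity \<epsilon>0 G \<Longrightarrow> \<exists>\<Phi>. slow_manifold_of G \<Phi>"
    using slow_manifold_exists by blast
  define \<epsilon> where "\<epsilon> = min \<epsilon>0 (1/2)"
  have \<epsilon>: "0 < \<epsilon>" "\<epsilon> \<le> \<epsilon>0" "\<epsilon> \<le> 1/2" using \<epsilon>0(1) by (auto simp: \<epsilon>_def)
  obtain \<delta> and G :: "'y \<times> 'z \<Rightarrow> 'y \<times> 'z"
    where G: "0 < \<delta>" "small_nonlinearity \<epsilon> G" "\<And>x. norm x \<le> \<delta> \<Longrightarrow> G x = N x"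
    by (rule C2_cutoff[OF C2_N N_0 N_derivative_0 \<epsilon>(1)]) blast
  obtain \<Phi> where "slow_manifold_of G \<Phi>"
    using \<epsilon>0(2) small_nonlinearity_mono[OF G(2) \<epsilon>(2)] by blast
  then have \<Phi>: "C2_on UNIV \<Phi>" "\<And>u. \<pi> (fst (\<Phi> u)) = u"
    "\<And>u. snd (\<Phi> u) = L (fst (\<Phi> u)) + snd (G (\<Phi> u))"
    "\<And>u D. ((\<lambda>u. fst (\<Phi> u)) has_derivative D) (at u) \<Longrightarrow>
          D (\<pi> (B (fst (\<Phi> u)) + fst (G (\<Phi> u)))) = B (fst (\<Phi> u)) + fst (G (\<Phi> u))"
    "\<And>x. B (fst x) + fst (G x) = 0 \<Longrightarrow> snd x = L (fst x) + snd (G x) \<Longrightarrow> \<Phi> (\<pi> (fst x)) = x"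
    unfolding slow_manifold_of_def by blast+
  have g_iff: "g x = 0 \<longleftrightarrow> snd x = L (fst x) + snd (G x)" if "norm x \<le> \<delta>" for x
    using constraint_iff[of x] G(3)[OF that] by simp
  have h_eq: "h x = B (fst x) + fst (G x)" if "norm x \<le> \<delta>" "g x = 0" for x
    using field_eq[OF that(2)] G(3)[OF that(1)] by simp
  have g\<Phi>: "g (\<Phi> u) = 0" if "norm (\<Phi> u) \<le> \<delta>" for u
    using \<Phi>(3)[of u] g_iff[OF that] by simp
  have equil: "\<Phi> (s, 0) = (s *\<^sub>R e, 0)" if "\<bar>s\<bar> * norm e \<le> \<delta>" for s
  proof -
    let ?x = "(s *\<^sub>R e, 0 :: 'z)"
    have n: "norm ?x \<le> \<delta>" using that by (simp add: norm_Pair)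
    have "\<Phi> (\<pi> (fst ?x)) = ?x"
      using h_eq[OF n] g_iff[OF n] equilibria[of s] by (intro \<Phi>(5)) auto
    then show ?thesis by (simp add: linear_scale[OF lin_\<pi>] \<pi>_e)
  qed
  note G_lip = small_nonlinearity_lipschitz[OF G(2)]
  obtain CL where CL: "0 \<le> CL" "\<And>y. norm (L y) \<le> norm y * CL"
    using bounded_linear.nonneg_bounded[OF bounded_linear_L] by blast
  obtain CB where CB: "0 \<le> CB" "\<And>y. norm (B y) \<le> norm y * CB"
    using bounded_linear.nonneg_bounded[OF bounded_linear_B] by blast
  obtain CP where CP: "0 \<le> CP" "\<And>y. norm (\<pi> y) \<le> norm y * CP"
    using bounded_linear.nonneg_bounded[OF bounded_linear_\<pi>] by blast
  obtain \<Phi>' \<Phi>'' where \<Phi>': "\<And>u. (\<Phi> has_derivative blinfun_apply (\<Phi>' u)) (at u)"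
    "\<And>u. (\<Phi>' has_derivative blinfun_apply (\<Phi>'' u)) (at u)"
    by (rule C2_onE[OF \<Phi>(1)]) blast
  have "bounded (\<Phi>' ` cball 0 1)"
    by (intro compact_imp_bounded compact_continuous_image continuous_on_of_derivative[OF \<Phi>'(2)]) auto
  then obtain CD where CD: "0 < CD" "\<And>u. norm u \<le> 1 \<Longrightarrow> norm (\<Phi>' u) \<le> CD"
    by (auto simp: bounded_pos)
  define K1 where "K1 = 2 * (1 + CL)"
  define K2 where "K2 = (1 + CD * CP) * ((CB + 1) * K1)"
  have K: "0 \<le> K1" "0 \<le> K2" using CL CB CP CD by (auto simp: K1_def K2_def)
  have near: "norm (x - \<Phi> u) \<le> K1 * norm (fst x - fst (\<Phi> u))"
    "norm (h x - D (\<pi> (h x))) \<le> K2 * norm (fst x - fst (\<Phi> u))"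
    if x: "norm x \<le> \<delta>" "g x = 0" "norm u \<le> 1" "norm (\<Phi> u) \<le> \<delta>"
      and D: "((\<lambda>u. fst (\<Phi> u)) has_derivative D) (at u)" for x u D
  proof -
    let ?w = "x - \<Phi> u"
    have "norm (snd ?w) \<le> norm (L (fst ?w)) + norm (snd (G x - G (\<Phi> u)))"
    proof -
      have "snd x = L (fst x) + snd (G x)" using g_iff[OF x(1)] x(2) by simp
      then have "snd ?w = L (fst ?w) + snd (G x - G (\<Phi> u))"
        using \<Phi>(3)[of u] by (simp add: linear_diff[OF lin_L])
      then show ?thesis by (metis norm_triangle_ineq)
    qed
    also have "\<dots> \<le> norm (fst ?w) * CL + 1/2 * norm ?w"
    proof (intro add_mono CL(2))
      have "norm (snd (G x - G (\<Phi> u))) \<le> norm (G x - G (\<Phi> u))" by (metis norm_snd_le prod.collapse)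
      also have "\<dots> \<le> \<epsilon> * norm ?w" by (rule G_lip)
      also have "\<dots> \<le> 1/2 * norm ?w" by (intro mult_right_mono \<epsilon>) simp
      finally show "norm (snd (G x - G (\<Phi> u))) \<le> 1/2 * norm ?w" .
    qed
    finally have "norm (snd ?w) \<le> norm (fst ?w) * CL + 1/2 * norm ?w" .
    moreover have "norm ?w \<le> norm (fst ?w) + norm (snd ?w)" by (metis norm_Pair_le prod.collapse)
    ultimately have "norm ?w \<le> 2 * (norm (fst ?w) * (1 + CL))" by (simp add: algebra_simps)
    then show w: "norm ?w \<le> K1 * norm (fst x - fst (\<Phi> u))" by (simp add: K1_def algebra_simps)
    let ?d = "B (fst ?w) + fst (G x - G (\<Phi> u))"
    have lD: "linear D" using D by (rule has_derivative_linear)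
    have D_eq: "D a = fst (\<Phi>' u a)" for a
      using has_derivative_unique[OF D bounded_linear.has_derivative[OF bounded_linear_fst \<Phi>'(1)]] by metis
    have D_bound: "norm (D a) \<le> CD * norm a" for a
    proof -
      have "norm (D a) \<le> norm (\<Phi>' u a)" unfolding D_eq by (metis norm_fst_le prod.collapse)
      also have "\<dots> \<le> norm (\<Phi>' u) * norm a" by (rule norm_blinfun)
      also have "\<dots> \<le> CD * norm a" by (intro mult_right_mono CD(2) x(3)) simp
      finally show ?thesis .
    qed
    have hx: "h x = h (\<Phi> u) + ?d"
      by (simp add: h_eq x g\<Phi> linear_diff[OF lin_B])
    have "D (\<pi> (h (\<Phi> u))) = h (\<Phi> u)"
      using \<Phi>(4)[OF D] by (simp add: h_eq x g\<Phi>)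
    then have "h x - D (\<pi> (h x)) = ?d - D (\<pi> ?d)"
      unfolding hx by (simp add: linear_add[OF lD] linear_add[OF lin_\<pi>])
    then have "norm (h x - D (\<pi> (h x))) \<le> norm ?d + norm (D (\<pi> ?d))" by (metis norm_triangle_ineq4)
    also have "\<dots> \<le> norm ?d + CD * (norm ?d * CP)"
      using CD(1) by (intro add_left_mono order_trans[OF D_bound] mult_left_mono CP(2)) auto
    also have "\<dots> = (1 + CD * CP) * norm ?d" by (simp add: algebra_simps)
    also have "\<dots> \<le> (1 + CD * CP) * ((CB + 1) * (K1 * norm (fst x - fst (\<Phi> u))))"
    proof (intro mult_left_mono)
      have "norm ?d \<le> norm (fst ?w) * CB + norm (G x - G (\<Phi> u))"
        by (intro order_trans[OF norm_triangle_ineq] add_mono CB(2)) (metis norm_fst_le prod.collapse)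
      also have "\<dots> \<le> norm ?w * CB + 1 * norm ?w"
        using CB(1) \<epsilon>(3) by (intro add_mono mult_right_mono order_trans[OF G_lip]) (auto, metis fst_diff norm_fst_le prod.collapse snd_diff)
      also have "\<dots> = (CB + 1) * norm ?w" by (simp add: algebra_simps)
      also have "\<dots> \<le> (CB + 1) * (K1 * norm (fst x - fst (\<Phi> u)))" using CB(1) by (intro mult_left_mono w) auto
      finally show "norm ?d \<le> (CB + 1) * (K1 * norm (fst x - fst (\<Phi> u)))" .
    qed (use CD CP in auto)
    finally show "norm (h x - D (\<pi> (h x))) \<le> K2 * norm (fst x - fst (\<Phi> u))" by (simp add: K2_def mult_ac)
  qed
  show thesis
  proof (rule that[of \<delta> \<Phi> "max K1 K2"])
    show "\<Phi> 0 = 0" using equil[of 0] G(1) by (simp add: zero_prod_def)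
    show "D (\<pi> (h (\<Phi> u))) = h (\<Phi> u)"
      if "norm (\<Phi> u) \<le> \<delta>" "((\<lambda>u. fst (\<Phi> u)) has_derivative D) (at u)" for u D
      using \<Phi>(4)[OF that(2)] h_eq[OF that(1) g\<Phi>[OF that(1)]] by simp
    show "norm (x - \<Phi> u) \<le> max K1 K2 * norm (fst x - fst (\<Phi> u)) \<and>
       norm (h x - D (\<pi> (h x))) \<le> max K1 K2 * norm (fst x - fst (\<Phi> u))"
      if "norm x \<le> \<delta>" "g x = 0" "u = \<pi> (fst x)" "norm u \<le> 1" "norm (\<Phi> u) \<le> \<delta>"
       "((\<lambda>u. fst (\<Phi> u)) has_derivative D) (at u)" for x u D
      using near[OF that(1,2,4-6)] by (meson max.cobounded1 max.cobounded2 mult_right_mono norm_ge_zero order_trans)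
  qed (use \<Phi> G(1) g\<Phi> equil in auto)
qed

end


section \<open>The reduced vector field\<close>

context index_one_dae
begin

text \<open>
  The invariance equation is differentiated first at the points of the equilibrium line, where
  \<open>\<xi> = 0\<close> removes the second derivative of \<open>\<Phi>\<close>, and then along this line. In the second step the
  term with \<open>\<Phi>''(0)(1, 0) (\<xi>'(0)(0, 1))\<close> drops out because \<open>\<xi>'(0)(0, 1) = (c, 0)\<close> and \<open>\<Phi>\<close> is affine
  on the line.
\<close>

theorem reduced_field:
  fixes \<Phi> :: "real \<times> real \<Rightarrow> 'y \<times> 'z" and \<delta> :: real
    and F' :: "'y \<times> 'z \<Rightarrow> ('y \<times> 'z) \<Rightarrow>\<^sub>L ('y \<times> 'z)"
  defines "\<xi> \<equiv> \<lambda>u. \<pi> (h (\<Phi> u))"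
  assumes \<delta>: "0 < \<delta>" and C2_\<Phi>: "C2_on UNIV \<Phi>" and \<pi>_\<Phi>: "\<And>u. \<pi> (fst (\<Phi> u)) = u" and \<Phi>_0: "\<Phi> 0 = 0"
    and g_\<Phi>: "\<And>u. norm (\<Phi> u) \<le> \<delta> \<Longrightarrow> g (\<Phi> u) = 0"
    and tangent: "\<And>u D. norm (\<Phi> u) \<le> \<delta> \<Longrightarrow> ((\<lambda>u. fst (\<Phi> u)) has_derivative D) (at u) \<Longrightarrow>
        D (\<pi> (h (\<Phi> u))) = h (\<Phi> u)"
    and \<Phi>_line: "\<And>s. \<bar>s\<bar> * norm e \<le> \<delta> \<Longrightarrow> \<Phi> (s, 0) = (s *\<^sub>R e, 0)"
    and F': "\<And>x. ((\<lambda>x. (h x, g x)) has_derivative blinfun_apply (F' x)) (at x)"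
    and F'': "(F' has_derivative blinfun_apply F'') (at 0)"
  shows "C2_on UNIV \<xi>"
    and "\<forall>\<^sub>F s in nhds 0. \<xi> (s, 0) = (0, 0)"
    and "deriv (\<lambda>u2. snd (\<xi> (0, u2))) 0 = 0"
    and "deriv (\<lambda>u2. fst (\<xi> (0, u2))) 0 \<noteq> 0"
    and "F'' (e, 0) (q, L q) \<notin> range (F' 0) \<Longrightarrow> deriv (\<lambda>u1. deriv (\<lambda>u2. snd (\<xi> (u1, u2))) 0) 0 \<noteq> 0"
proof -
  show C2_\<xi>: "C2_on UNIV \<xi>" unfolding \<xi>_def
    by (intro C2_on_linear_compose[OF bounded_linear_\<pi>] C2_on_compose[OF C2_\<Phi> C2_h])
  obtain \<Phi>' \<Phi>'' where \<Phi>': "\<And>u. (\<Phi> has_derivative blinfun_apply (\<Phi>' u)) (at u)"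
    "\<And>u. (\<Phi>' has_derivative blinfun_apply (\<Phi>'' u)) (at u)"
    by (rule C2_onE[OF C2_\<Phi>]) blast
  obtain \<xi>' \<xi>'' where \<xi>': "\<And>u. (\<xi> has_derivative blinfun_apply (\<xi>' u)) (at u)"
    "\<And>u. (\<xi>' has_derivative blinfun_apply (\<xi>'' u)) (at u)"
    by (rule C2_onE[OF C2_\<xi>]) blast
  define r where "r = \<delta> / (norm e + 1)"
  have r: "0 < r" using \<delta> by (simp add: r_def add_nonneg_pos)
  have e_nz: "e \<noteq> 0" using \<pi>_e linear_0[OF lin_\<pi>] by (auto simp: zero_prod_def)
  have small: "\<bar>s\<bar> * norm e < \<delta>" if "\<bar>s\<bar> < r" for s
  proof -
    have "\<bar>s\<bar> * norm e < r * (norm e + 1)"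
      using that r by (intro mult_strict_mono') auto
    then show ?thesis by (simp add: r_def add_nonneg_eq_0_iff)
  qed
  have line: "\<Phi> (s, 0) = (s *\<^sub>R e, 0)" if "\<bar>s\<bar> < r" for s
    using \<Phi>_line small[OF that] by simp
  have ev: "\<forall>\<^sub>F s in nhds 0. \<bar>s\<bar> < r"
    using eventually_nhds_in_open[of "{-r<..<r}" 0] r by (auto elim!: eventually_mono)
  have \<xi>_line: "\<xi> (s, 0) = 0" if "\<bar>s\<bar> < r" for s
    using line[OF that] equilibria(1)[of s] linear_0[OF lin_\<pi>] by (simp add: \<xi>_def)
  show "\<forall>\<^sub>F s in nhds 0. \<xi> (s, 0) = (0, 0)"
    using ev by eventually_elim (use \<xi>_line in \<open>simp add: zero_prod_def\<close>)

  have along: "((\<lambda>s. f (s, 0)) has_vector_derivative blinfun_apply D (1, 0)) (at s)"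
    if "(f has_derivative blinfun_apply D) (at (s, 0))" for f :: "real \<times> real \<Rightarrow> 'c::real_normed_vector" and D s
  proof -
    have "((\<lambda>s. (s, 0)) has_vector_derivative (1, 0)) (at (s::real))"
      by (auto intro!: derivative_eq_intros)
    from diff_chain_at[OF this[unfolded has_vector_derivative_def] that]
    have "((\<lambda>s. f (s, 0)) has_derivative (\<lambda>t. D (t *\<^sub>R (1, 0)))) (at s)" by (simp add: o_def)
    then show ?thesis unfolding has_vector_derivative_def by (simp only: blinfun.scaleR_right)
  qed
  have across: "((\<lambda>t. f (s, t)) has_vector_derivative blinfun_apply D (0, 1)) (at t)"
    if "(f has_derivative blinfun_apply D) (at (s, t))" for f :: "real \<times> real \<Rightarrow> 'c::real_normed_vector" and D s t
  proof -
    have "((\<lambda>t. (s, t)) has_vector_derivative (0, 1)) (at (t::real))"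
      by (auto intro!: derivative_eq_intros)
    from diff_chain_at[OF this[unfolded has_vector_derivative_def] that]
    have "((\<lambda>t. f (s, t)) has_derivative (\<lambda>k. D (k *\<^sub>R (0, 1)))) (at t)" by (simp add: o_def)
    then show ?thesis unfolding has_vector_derivative_def by (simp only: blinfun.scaleR_right)
  qed
  have eq_near: "a = b"
    if "(f has_vector_derivative a) (at s)" "(k has_vector_derivative b) (at s)" "\<bar>s\<bar> < r"
      "\<And>s. \<bar>s\<bar> < r \<Longrightarrow> f s = k s" for f k :: "real \<Rightarrow> 'c::real_normed_vector" and a b s
  proof -
    have "(k has_vector_derivative a) (at s)"
      by (rule has_vector_derivative_transform_within_open[OF that(1), of "{-r<..<r}"]) (use that in auto)
    then show ?thesis using that(2) by (rule vector_derivative_unique_at)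
  qed

  have d1\<Phi>: "\<Phi>' (s, 0) (1, 0) = (e, 0)" if "\<bar>s\<bar> < r" for s
  proof (rule eq_near[OF along[OF \<Phi>'(1)] _ that line])
    show "((\<lambda>s. (s *\<^sub>R e, 0)) has_vector_derivative (e, 0)) (at s)"
      by (auto intro!: derivative_eq_intros)
  qed
  have d11\<Phi>: "\<Phi>'' 0 (1, 0) (1, 0) = 0"
  proof -
    have "((\<lambda>s. \<Phi>' (s, 0) (1, 0)) has_vector_derivative \<Phi>'' (0, 0) (1, 0) (1, 0)) (at 0)"
      using bounded_linear.has_vector_derivative[OF blinfun.bounded_linear_left along[OF \<Phi>'(2)]] .
    from eq_near[OF this has_vector_derivative_const _ d1\<Phi>] show ?thesis using r by (simp add: zero_prod_def)
  qed
  \<comment> \<open>differentiate the invariance equation at a point of the equilibrium line\<close>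
  have inv': "F' (s *\<^sub>R e, 0) (\<Phi>' (s, 0) a) = (fst (\<Phi>' (s, 0) (\<xi>' (s, 0) a)), 0)" if s: "\<bar>s\<bar> < r" for s a
  proof -
    define T where "T = {u. norm (\<Phi> u) < \<delta>}"
    have "open T" unfolding T_def
      by (intro open_Collect_less continuous_on_norm continuous_on_const continuous_on_of_derivative[OF \<Phi>'(1)])
    have "(s, 0) \<in> T" using line[OF s] small[OF s] by (simp add: T_def norm_Pair)
    have eq: "(h (\<Phi> u), g (\<Phi> u)) = (fst (\<Phi>' u (\<xi> u)), 0)" if "u \<in> T" for u
      using that g_\<Phi>[of u] tangent[OF _ bounded_linear.has_derivative[OF bounded_linear_fst \<Phi>'(1)], of u]
      by (auto simp: T_def \<xi>_def)
    have "((\<lambda>u. (h (\<Phi> u), g (\<Phi> u))) has_derivative (\<lambda>a. F' (\<Phi> (s, 0)) (\<Phi>' (s, 0) a))) (at (s, 0))"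
      using diff_chain_at[OF \<Phi>'(1)[of "(s, 0)"] F'[of "\<Phi> (s, 0)"]] by (simp add: o_def)
    from has_derivative_transform_within_open[OF this \<open>open T\<close> \<open>(s, 0) \<in> T\<close> eq]
    have 1: "((\<lambda>u. (fst (\<Phi>' u (\<xi> u)), 0)) has_derivative (\<lambda>a. F' (\<Phi> (s, 0)) (\<Phi>' (s, 0) a))) (at (s, 0))" .
    have "((\<lambda>u. \<Phi>' u (\<xi> u)) has_derivative (\<lambda>a. \<Phi>' (s, 0) (\<xi>' (s, 0) a) + \<Phi>'' (s, 0) a (\<xi> (s, 0)))) (at (s, 0))"
      using blinfun.FDERIV[OF \<Phi>'(2) \<xi>'(1)] .
    then have "((\<lambda>u. (fst (\<Phi>' u (\<xi> u)), 0)) has_derivative (\<lambda>a. (fst (\<Phi>' (s, 0) (\<xi>' (s, 0) a) + \<Phi>'' (s, 0) a (\<xi> (s, 0))), 0))) (at (s, 0))"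
      by (intro has_derivative_Pair has_derivative_const bounded_linear.has_derivative[OF bounded_linear_fst])
    from fun_cong[OF has_derivative_unique[OF 1 this], of a] show ?thesis
      by (simp add: line[OF s] \<xi>_line[OF s] blinfun.zero_right)
  qed
  have F'0: "F' 0 x = (Dh x, Dg x)" for x
    using has_derivative_unique[OF F'[of 0] has_derivative_Pair[OF Dh Dg]] by simp

  \<comment> \<open>the derivative in the second direction turns out to be the generalized eigenvector\<close>
  define v where "v = \<Phi>' 0 (0, 1)"
  have v_\<pi>: "\<pi> (fst v) = (0, 1)"
  proof -
    have "((\<lambda>u. \<pi> (fst (\<Phi> u))) has_derivative (\<lambda>a. \<pi> (fst (\<Phi>' 0 a)))) (at 0)"
      by (intro bounded_linear.has_derivative[OF bounded_linear_\<pi>] bounded_linear.has_derivative[OF bounded_linear_fst] \<Phi>')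
    then have "((\<lambda>u. u) has_derivative (\<lambda>a. \<pi> (fst (\<Phi>' 0 a)))) (at 0)" by (simp add: \<pi>_\<Phi>)
    from has_derivative_unique[OF this has_derivative_ident] show ?thesis unfolding v_def by metis
  qed
  have inv0: "(Dh (\<Phi>' 0 a), Dg (\<Phi>' 0 a)) = (fst (\<Phi>' 0 (\<xi>' 0 a)), 0)" for a
    using inv'[of 0 a] r by (simp add: zero_prod_def[symmetric] F'0)
  have v_eq: "v = (fst v, L (fst v))"
  proof -
    have "v = (fst v, L (fst v)) + (0, snd v - L (fst v))" by (simp add: prod_eq_iff)
    then have "Dg v = Dg (fst v, L (fst v)) + Dg (0, snd v - L (fst v))" by (metis linear_add[OF lin_Dg])
    then have "Dg (0, snd v - L (fst v)) = 0" using inv0[of "(0, 1)"] by (simp add: v_def[symmetric] Dg_L)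
    then have "snd v - L (fst v) = 0" using Gi[of "snd v - L (fst v)"] linear_0[OF lin_Gi] by simp
    then show ?thesis by (simp add: prod_eq_iff)
  qed
  have \<xi>'_eq: "\<xi>' 0 (0, 1) = (c, 0)"
  proof -
    have "(\<xi> has_derivative (\<lambda>a. \<pi> (Dh (\<Phi>' 0 a)))) (at 0)"
      unfolding \<xi>_def
      using bounded_linear.has_derivative[OF bounded_linear_\<pi> diff_chain_at[OF \<Phi>'(1)[of 0], of h Dh]] Dh \<Phi>_0
      by (simp add: o_def)
    from has_derivative_unique[OF \<xi>'(1) this] have "\<xi>' 0 (0, 1) = \<pi> (Dh v)" by (simp add: v_def)
    also have "Dh v = B (fst v)" by (subst v_eq) (rule Dh_L)
    also have "\<pi> (B (fst v)) = (c, 0)" by (simp add: \<pi>_B v_\<pi>)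
    finally show ?thesis .
  qed
  have v_q: "v = (q, L q)"
  proof -
    have "B (fst v) = Dh v" by (subst (2) v_eq) (rule Dh_L[symmetric])
    also have "\<dots> = fst (\<Phi>' 0 (c, 0))" using inv0[of "(0, 1)"] by (simp add: \<xi>'_eq v_def)
    also have "\<Phi>' 0 (c, 0) = c *\<^sub>R \<Phi>' 0 (1, 0)" by (simp flip: blinfun.scaleR_right)
    also have "\<dots> = c *\<^sub>R (e, 0)" using d1\<Phi>[of 0] r by (simp add: zero_prod_def)
    finally have "B (fst v - q) = 0" by (simp add: linear_diff[OF lin_B] B_q)
    then obtain k where k: "fst v - q = k *\<^sub>R e" using ker_B by (auto simp: span_singleton)
    have "\<pi> (k *\<^sub>R e) = \<pi> (fst v) - \<pi> q" unfolding k[symmetric] by (rule linear_diff[OF lin_\<pi>])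
    then have "k = 0" by (simp add: linear_scale[OF lin_\<pi>] \<pi>_e v_\<pi> \<pi>_q zero_prod_def)
    then have "fst v = q" using k by simp
    then show ?thesis using v_eq by simp
  qed
  have deriv_snd: "deriv (\<lambda>u2. snd (\<xi> (s, u2))) 0 = snd (\<xi>' (s, 0) (0, 1))"
    and deriv_fst: "deriv (\<lambda>u2. fst (\<xi> (s, u2))) 0 = fst (\<xi>' (s, 0) (0, 1))" for s
  proof -
    have "((\<lambda>t. \<xi> (s, t)) has_vector_derivative \<xi>' (s, 0) (0, 1)) (at 0)" by (rule across[OF \<xi>'(1)])
    from bounded_linear.has_vector_derivative[OF bounded_linear_snd this]
      bounded_linear.has_vector_derivative[OF bounded_linear_fst this]
    show "deriv (\<lambda>u2. snd (\<xi> (s, u2))) 0 = snd (\<xi>' (s, 0) (0, 1))"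
      "deriv (\<lambda>u2. fst (\<xi> (s, u2))) 0 = fst (\<xi>' (s, 0) (0, 1))"
      by (auto intro!: DERIV_imp_deriv simp: has_real_derivative_iff_has_vector_derivative)
  qed
  show "deriv (\<lambda>u2. snd (\<xi> (0, u2))) 0 = 0" "deriv (\<lambda>u2. fst (\<xi> (0, u2))) 0 \<noteq> 0"
    using \<xi>'_eq c by (simp_all add: deriv_snd deriv_fst zero_prod_def)

  assume transversal: "F'' (e, 0) (q, L q) \<notin> range (F' 0)"
  define m where "m = \<xi>'' 0 (1, 0) (0, 1)"
  have "((\<lambda>s. \<xi>' (s, 0)) has_vector_derivative \<xi>'' (0, 0) (1, 0)) (at 0)" by (rule along[OF \<xi>'(2)])
  from bounded_linear.has_vector_derivative[OF blinfun.bounded_linear_left this]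
  have m': "((\<lambda>s. \<xi>' (s, 0) (0, 1)) has_vector_derivative m) (at 0)" by (simp add: m_def zero_prod_def)
  have deriv_mixed: "deriv (\<lambda>u1. deriv (\<lambda>u2. snd (\<xi> (u1, u2))) 0) 0 = snd m"
    unfolding deriv_snd using bounded_linear.has_vector_derivative[OF bounded_linear_snd m']
    by (auto intro!: DERIV_imp_deriv simp: has_real_derivative_iff_has_vector_derivative)
  \<comment> \<open>differentiate once more along the equilibrium line\<close>
  have "F'' (e, 0) v + F' 0 (\<Phi>'' 0 (1, 0) (0, 1)) = (fst (\<Phi>' 0 m), 0)"
  proof -
    have e': "((\<lambda>s. (s *\<^sub>R e, 0)) has_vector_derivative (e, 0)) (at (0::real))"
      by (auto intro!: derivative_eq_intros)
    have F'_line: "((\<lambda>s. F' (s *\<^sub>R e, 0)) has_vector_derivative F'' (e, 0)) (at 0)"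
    proof -
      have "((\<lambda>s. F' (s *\<^sub>R e, 0)) has_derivative (\<lambda>t. F'' (t *\<^sub>R (e, 0)))) (at 0)"
        using diff_chain_at[OF e'[unfolded has_vector_derivative_def], of F' F''] F''
        by (simp add: o_def zero_prod_def)
      then show ?thesis unfolding has_vector_derivative_def by (simp only: blinfun.scaleR_right)
    qed
    have \<Phi>'_line: "((\<lambda>s. \<Phi>' (s, 0)) has_vector_derivative \<Phi>'' 0 (1, 0)) (at 0)"
      using along[OF \<Phi>'(2)] by (simp add: zero_prod_def)
    have v': "((\<lambda>s. \<Phi>' (s, 0) (0, 1)) has_vector_derivative \<Phi>'' 0 (1, 0) (0, 1)) (at 0)"
      by (rule bounded_linear.has_vector_derivative[OF blinfun.bounded_linear_left \<Phi>'_line])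
    have "((\<lambda>s. F' (s *\<^sub>R e, 0) (\<Phi>' (s, 0) (0, 1))) has_vector_derivative
        F' (0 *\<^sub>R e, 0) (\<Phi>'' 0 (1, 0) (0, 1)) + F'' (e, 0) (\<Phi>' (0, 0) (0, 1))) (at 0)"
      by (rule blinfun.has_vector_derivative[OF F'_line v'])
    moreover have "((\<lambda>s. \<Phi>' (s, 0) (\<xi>' (s, 0) (0, 1))) has_vector_derivative
        \<Phi>' (0, 0) m + \<Phi>'' 0 (1, 0) (\<xi>' (0, 0) (0, 1))) (at 0)"
      by (rule blinfun.has_vector_derivative[OF \<Phi>'_line m'])
    then have "((\<lambda>s. (fst (\<Phi>' (s, 0) (\<xi>' (s, 0) (0, 1))), 0)) has_vector_derivative
        (fst (\<Phi>' (0, 0) m + \<Phi>'' 0 (1, 0) (\<xi>' (0, 0) (0, 1))), 0)) (at 0)"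
      by (intro has_vector_derivative_Pair has_vector_derivative_const bounded_linear.has_vector_derivative[OF bounded_linear_fst])
    ultimately have "F' (0 *\<^sub>R e, 0) (\<Phi>'' 0 (1, 0) (0, 1)) + F'' (e, 0) (\<Phi>' (0, 0) (0, 1))
        = (fst (\<Phi>' (0, 0) m + \<Phi>'' 0 (1, 0) (\<xi>' (0, 0) (0, 1))), 0)"
      by (rule eq_near) (use r inv' in auto)
    moreover have "\<Phi>'' 0 (1, 0) (\<xi>' 0 (0, 1)) = 0"
    proof -
      have "\<Phi>'' 0 (1, 0) (c, 0) = c *\<^sub>R \<Phi>'' 0 (1, 0) (1, 0)" by (simp flip: blinfun.scaleR_right)
      then show ?thesis by (simp add: \<xi>'_eq d11\<Phi>)
    qed
    ultimately show ?thesis by (simp add: zero_prod_def[symmetric] v_def add.commute)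
  qed
  then have key: "F'' (e, 0) (q, L q) = (fst (\<Phi>' 0 m), 0) - F' 0 (\<Phi>'' 0 (1, 0) (0, 1))"
    unfolding v_q by (simp add: algebra_simps)
  \<comment> \<open>if the second component of \<open>m\<close> vanished, \<open>\<Phi>'(0) m\<close> would be a multiple of \<open>e = F'(0) q / c\<close>\<close>
  show "deriv (\<lambda>u1. deriv (\<lambda>u2. snd (\<xi> (u1, u2))) 0) 0 \<noteq> 0"
  proof
    assume "deriv (\<lambda>u1. deriv (\<lambda>u2. snd (\<xi> (u1, u2))) 0) 0 = 0"
    then have "m = (fst m, 0)" unfolding deriv_mixed by (simp add: prod_eq_iff)
    then have "\<Phi>' 0 m = fst m *\<^sub>R \<Phi>' 0 (1, 0)" by (metis blinfun.scaleR_right mult.right_neutral mult_zero_right scaleR_Pair real_scaleR_def)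
    then have "(fst (\<Phi>' 0 m), 0) = fst m *\<^sub>R (e, 0 :: 'z)"
      using d1\<Phi>[of 0] r by (simp add: zero_prod_def)
    also have "(e, 0) = F' 0 ((1 / c) *\<^sub>R (q, L q))"
    proof -
      have "F' 0 ((1 / c) *\<^sub>R (q, L q)) = (1 / c) *\<^sub>R F' 0 (q, L q)" by (rule blinfun.scaleR_right)
      also have "\<dots> = (e, 0)" using c by (simp add: F'0 Dh_L Dg_L B_q)
      finally show ?thesis by simp
    qed
    finally have "F'' (e, 0) (q, L q) = F' 0 (fst m *\<^sub>R ((1 / c) *\<^sub>R (q, L q)) - \<Phi>'' 0 (1, 0) (0, 1))"
      unfolding key by (simp only: blinfun.diff_right blinfun.scaleR_right)
    then show False using transversal by blast
  qed
qed

end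


section \<open>The invariant surface of the semiexplicit system\<close>

text \<open>
  The preceding results concern pairs \<open>(y, z)\<close>; \<open>join\<close> and \<open>unjoin\<close> identify them with vectors
  whose index type is a sum.
\<close>

definition z_part :: "real ^ ('r::finite + 'p::finite) \<Rightarrow> real ^ 'p" where
  "z_part x = (\<chi> b. x $ Inr b)"

definition join :: "(real ^ 'r) \<times> (real ^ 'p) \<Rightarrow> real ^ ('r::finite + 'p::finite)" where
  "join x = join_vec (fst x) (snd x)"

definition unjoin :: "real ^ ('r::finite + 'p::finite) \<Rightarrow> (real ^ 'r) \<times> (real ^ 'p)" where
  "unjoin x = (y_part x, z_part x)"

lemma join_unjoin [simp]: "join (unjoin x) = x"
  by (auto simp: join_def unjoin_def join_vec_def y_part_def z_part_def vec_eq_iff split: sum.split)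

lemma unjoin_join [simp]: "unjoin (join x) = x"
  by (auto simp: join_def unjoin_def y_part_def z_part_def vec_eq_iff prod_eq_iff)

lemma y_part_join_vec [simp]: "y_part (join_vec v w) = v" and z_part_join_vec [simp]: "z_part (join_vec v w) = w"
  by (simp_all add: y_part_def z_part_def vec_eq_iff)

lemma fst_unjoin [simp]: "fst (unjoin x) = y_part x" and snd_unjoin [simp]: "snd (unjoin x) = z_part x"
  by (simp_all add: unjoin_def)

lemma bounded_linear_join: "bounded_linear join"
  by (auto simp: linear_conv_bounded_linear[symmetric] join_def join_vec_def vec_eq_iff split: sum.split intro!: linearI)

lemma bounded_linear_unjoin: "bounded_linear unjoin"
  by (auto simp: linear_conv_bounded_linear[symmetric] unjoin_def y_part_def z_part_def vec_eq_iff intro!: linearI)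

lemma bounded_linear_y_part: "bounded_linear y_part"
  by (auto simp: linear_conv_bounded_linear[symmetric] y_part_def vec_eq_iff intro!: linearI)

lemma sum_over_Plus:
  fixes f :: "'a::finite + 'b::finite \<Rightarrow> 'c::comm_monoid_add"
  shows "(\<Sum>i\<in>UNIV. f i) = (\<Sum>i\<in>UNIV. f (Inl i)) + (\<Sum>i\<in>UNIV. f (Inr i))"
  unfolding UNIV_Plus_UNIV[symmetric] by (subst sum.Plus) auto

lemma has_vector_derivative_chain:
  assumes "(u has_vector_derivative d) (at t within J)" "(f has_derivative D) (at (u t))"
  shows "((\<lambda>s. f (u s)) has_vector_derivative D d) (at t within J)"
  using has_derivative_compose[OF assms(1)[unfolded has_vector_derivative_def] assms(2)]
  unfolding has_vector_derivative_def by (simp add: linear_scale[OF has_derivative_linear[OF assms(2)]])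

lemma join_axis: "join (s *\<^sub>R axis k 1, 0) = axis (Inl k) s"
  by (auto simp: join_def join_vec_def vec_eq_iff axis_def split: sum.split)

lemma jacobian_eq:
  fixes f :: "real ^ 'n \<Rightarrow> real ^ 'm"
  shows "(f has_derivative D) (at x) \<Longrightarrow> jacobian f (at x) *v v = D v"
proof -
  assume D: "(f has_derivative D) (at x)"
  then have "(f has_derivative (\<lambda>v. jacobian f (at x) *v v)) (at x)"
    using jacobian_works[of f "at x"] differentiableI by blast
  then show ?thesis using has_derivative_unique[OF D] by metis
qed

theorem theorem3:
  fixes h :: "real ^ ('r::finite + 'p::finite) \<Rightarrow> real ^ 'r"
    and g :: "real ^ ('r + 'p) \<Rightarrow> real ^ 'p"
    and F :: "real ^ ('r + 'p) \<Rightarrow> real ^ ('r + 'p)"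
    and A :: "real ^ ('r + 'p) ^ ('r + 'p)"
    and k :: 'r
    and p q :: "real ^ ('r + 'p)"
  defines "F \<equiv> (\<lambda>x. join_vec (h x) (g x))"
    and "A \<equiv> jacobian F (at 0)"
  assumes h_C2: "C2_on UNIV h"
    and g_C2: "C2_on UNIV g"
    and g_z: "invertible (jacobian_z g 0)"
    and equilibria: "\<And>s. h (axis (Inl k) s) = 0" "\<And>s. g (axis (Inl k) s) = 0"
    and double_zero: "double_index_two_zero_eigenvalue E_mat A"
    and hyperbolic: "\<And>\<mu>. pencil_eigenvalue E_mat A \<mu> \<Longrightarrow> \<mu> \<noteq> 0 \<Longrightarrow> Re \<mu> \<noteq> 0"
    and p: "p \<in> {v. A *v v = 0} - {0}"
    and q: "q \<in> {v. (A ** A) *v v = 0} - {v. A *v v = 0}"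
    and transversality: "second_derivative F 0 p q \<notin> range ((*v) A)"
  shows "\<exists>M (U :: (real \<times> real) set) \<phi> (\<xi> :: real \<times> real \<Rightarrow> real \<times> real).
           M \<subseteq> {x. g x = 0} \<and> 0 \<in> M \<and> C2_surface M \<and> dae_locally_invariant h g M \<and>
           C2_local_parametrization U \<phi> M \<and> (0, 0) \<in> U \<and> \<phi> (0, 0) = 0 \<and>
           C2_on U \<xi> \<and> dae_described_by h g U \<phi> \<xi> \<and>
           (\<forall>\<^sub>F u1 in nhds 0. \<xi> (u1, 0) = (0, 0)) \<and>
           deriv (\<lambda>u2. snd (\<xi> (0, u2))) 0 = 0 \<and>
           deriv (\<lambda>u2. fst (\<xi> (0, u2))) 0 \<noteq> 0 \<and>
           deriv (\<lambda>u1. deriv (\<lambda>u2. snd (\<xi> (u1, u2))) 0) 0 \<noteq> 0"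
proof -
  \<comment> \<open>the system in the coordinates \<open>(y, z)\<close> of a product space\<close>
  define h0 where "h0 x = h (join x)" for x
  define g0 where "g0 x = g (join x)" for x
  have C2_h0: "C2_on UNIV h0" and C2_g0: "C2_on UNIV g0"
    unfolding h0_def[abs_def] g0_def[abs_def]
    by (intro C2_on_compose[OF C2_on_bounded_linear[OF bounded_linear_join]] h_C2 g_C2)+
  have C2_F0: "C2_on UNIV (\<lambda>x. (h0 x, g0 x))" by (rule C2_on_Pair[OF C2_h0 C2_g0])
  obtain F' F'' where F': "\<And>x. ((\<lambda>x. (h0 x, g0 x)) has_derivative blinfun_apply (F' x)) (at x)"
    "\<And>x. (F' has_derivative blinfun_apply (F'' x)) (at x)"
    by (rule C2_onE[OF C2_F0]) blast
  define Dh where "Dh x = fst (F' 0 x)" for x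
  define Dg where "Dg x = snd (F' 0 x)" for x
  have Dh: "(h0 has_derivative Dh) (at 0)"
    using bounded_linear.has_derivative[OF bounded_linear_fst F'(1)[of 0]] by (simp add: Dh_def[abs_def])
  have Dg: "(g0 has_derivative Dg) (at 0)"
    using bounded_linear.has_derivative[OF bounded_linear_snd F'(1)[of 0]] by (simp add: Dg_def[abs_def])
  have lin_Dh: "linear Dh" and lin_Dg: "linear Dg" using Dh Dg by (auto dest: has_derivative_linear)
  have F_eq: "F = (\<lambda>x. join (h0 (unjoin x), g0 (unjoin x)))"
    by (simp add: F_def h0_def g0_def join_def[of "(_, _)"])
  have F_deriv: "(F has_derivative (\<lambda>v. join (F' (unjoin x) (unjoin v)))) (at x)" for x
  proof -
    have "((\<lambda>x. (h0 (unjoin x), g0 (unjoin x))) has_derivative (\<lambda>v. F' (unjoin x) (unjoin v))) (at x)"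
      using diff_chain_at[OF bounded_linear_imp_has_derivative[OF bounded_linear_unjoin] F'(1)[of "unjoin x"]]
      by (simp add: o_def)
    then show ?thesis unfolding F_eq by (rule bounded_linear.has_derivative[OF bounded_linear_join])
  qed
  have unjoin_0: "unjoin 0 = 0" using linear_0 bounded_linear.linear[OF bounded_linear_unjoin] by blast
  have A_eq: "A *v v = join_vec (Dh (unjoin v)) (Dg (unjoin v))" for v
    using jacobian_eq[OF F_deriv[of 0], of v] by (simp add: A_def unjoin_0 join_def Dh_def Dg_def)
  have Jz: "jacobian_z g 0 *v z = Dg (0, z)" for z
  proof -
    have "(g has_derivative (\<lambda>v. Dg (unjoin v))) (at 0)"
      using diff_chain_at[OF bounded_linear_imp_has_derivative[OF bounded_linear_unjoin], of g0 Dg 0] Dg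
      by (simp add: o_def g0_def[abs_def] unjoin_0)
    from jacobian_eq[OF this, of "join (0, z)"]
    have "jacobian g (at 0) *v join (0, z) = Dg (0, z)" by simp
    moreover have "jacobian g (at 0) *v join (0, z) = jacobian_z g 0 *v z"
      by (simp add: vec_eq_iff matrix_vector_mult_def jacobian_z_def join_def sum_over_Plus)
    ultimately show ?thesis by simp
  qed
  obtain Jinv where inv: "Jinv ** jacobian_z g 0 = mat 1" "jacobian_z g 0 ** Jinv = mat 1"
    using g_z unfolding invertible_def by blast
  \<comment> \<open>the reduction of the linearized system to the \<open>y\<close>-component\<close>
  define Gi where "Gi z = Jinv *v z" for z
  have Gi: "Gi (Dg (0, z)) = z" "Dg (0, Gi z) = z" for z
    unfolding Gi_def Jz[symmetric] by (simp_all add: matrix_vector_mul_assoc inv)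
  have lin_Gi: "linear Gi" unfolding Gi_def[abs_def] by simp
  define L where "L y = - Gi (Dg (y, 0))" for y
  define B where "B y = Dh (y, L y)" for y
  have lin_L: "linear L"
  proof (rule linearI)
    fix x y :: "real ^ 'r" and r :: real
    show "L (x + y) = L x + L y"
      using linear_add[OF lin_Dg, of "(x, 0)" "(y, 0)"] by (simp add: L_def linear_add[OF lin_Gi])
    show "L (r *\<^sub>R x) = r *\<^sub>R L x"
      using linear_scale[OF lin_Dg, of r "(x, 0)"] by (simp add: L_def linear_scale[OF lin_Gi])
  qed
  have lin_B: "linear B"
  proof (rule linearI)
    fix x y :: "real ^ 'r" and r :: real
    show "B (x + y) = B x + B y"
      using linear_add[OF lin_Dh, of "(x, L x)" "(y, L y)"] by (simp add: B_def linear_add[OF lin_L])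
    show "B (r *\<^sub>R x) = r *\<^sub>R B x"
      using linear_scale[OF lin_Dh, of r "(x, L x)"] by (simp add: B_def linear_scale[OF lin_L])
  qed
  have Dg_split: "Dg (y, z) = Dg (0, z - L y)" for y z
  proof -
    have "Dg (y, z) = Dg (y, 0) + Dg (0, z)" using linear_add[OF lin_Dg, of "(y, 0)" "(0, z)"] by simp
    also have "Dg (y, 0) = Dg (0, - L y)" by (simp add: L_def Gi)
    also have "Dg (0, - L y) + Dg (0, z) = Dg (0, z - L y)"
      using linear_add[OF lin_Dg, of "(0, - L y)" "(0, z)"] by simp
    finally show ?thesis .
  qed
  have Dg_L: "Dg (y, L y) = 0" for y
    using linear_0[OF lin_Dg] Dg_split[of y "L y"] by (simp add: zero_prod_def)
  have Dg_zero: "z = L y" if "Dg (y, z) = 0" for y z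
    using that Gi(1)[of "z - L y"] linear_0[OF lin_Gi] Dg_split[of y z] by simp
  have AB: "A *v join_vec y (L y) = join_vec (B y) 0" for y
    by (simp add: A_eq unjoin_def B_def Dg_L)

  \<comment> \<open>the equilibrium line is the kernel of the linearization\<close>
  define e where "e = (axis k 1 :: real ^ 'r)"
  have e_nz: "e \<noteq> 0" by (simp add: e_def axis_eq_0_iff)
  have join_e: "join (s *\<^sub>R e, 0) = axis (Inl k) s" for s unfolding e_def by (rule join_axis)
  have eq0: "h0 (s *\<^sub>R e, 0) = 0" "g0 (s *\<^sub>R e, 0) = 0" for s
    by (simp_all add: h0_def g0_def join_e equilibria)
  have F'_e: "F' 0 (e, 0) = 0"
  proof -
    have "((\<lambda>s. (s *\<^sub>R e, 0)) has_derivative (\<lambda>s. (s *\<^sub>R e, 0))) (at (0::real))"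
      by (auto intro!: derivative_eq_intros)
    from diff_chain_at[OF this, of "\<lambda>x. (h0 x, g0 x)" "F' 0"] F'(1)[of 0]
    have "((\<lambda>s. (h0 (s *\<^sub>R e, 0), g0 (s *\<^sub>R e, 0))) has_derivative (\<lambda>s. F' 0 (s *\<^sub>R e, 0))) (at 0)"
      by (simp add: o_def zero_prod_def)
    then have "((\<lambda>s::real. (0, 0)) has_derivative (\<lambda>s. F' 0 (s *\<^sub>R e, 0))) (at 0)" by (simp add: eq0)
    from fun_cong[OF has_derivative_unique[OF this has_derivative_const], of 1] show ?thesis by simp
  qed
  have A_axis: "A *v axis (Inl k) 1 = 0"
    using F'_e by (simp add: A_eq join_e[of 1, symmetric] Dh_def Dg_def)
  have dim_ker: "dim {v. A *v v = 0} = 1" and nz: "pencil_poly E_mat A \<noteq> 0" and ord: "order 0 (pencil_poly E_mat A) = 2"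
    using double_zero unfolding double_index_two_zero_eigenvalue_def by auto
  have ker_A: "v \<in> span {axis (Inl k) 1}" if "A *v v = 0" for v
  proof -
    have "{v. A *v v = 0} \<subseteq> span {axis (Inl k) 1}"
    proof (rule card_ge_dim_independent)
      show "{axis (Inl k) 1} \<subseteq> {v. A *v v = 0}" using A_axis by simp
      show "independent {axis (Inl k) (1::real) :: real ^ ('r + 'p)}" by (simp add: axis_eq_0_iff)
    qed (use dim_ker in simp)
    then show ?thesis using that by blast
  qed
  have ker_B: "y \<in> span {e}" if "B y = 0" for y
  proof -
    have "A *v join_vec y (L y) = 0" using that by (simp add: AB)
    then obtain s where "join_vec y (L y) = s *\<^sub>R axis (Inl k) 1" using ker_A by (auto simp: span_singleton)
    then have "join_vec y (L y) = join (s *\<^sub>R e, 0)" by (simp add: join_e axis_def vec_eq_iff)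
    then have "y = s *\<^sub>R e" by (simp add: join_def join_vec_eq_iff)
    then show ?thesis by (simp add: span_base span_scale)
  qed
  \<comment> \<open>\<open>p\<close> is a multiple of \<open>e\<close>, and \<open>A q\<close> a nonzero one, so \<open>e\<close> and \<open>q\<close> form a Jordan chain\<close>
  obtain \<mu> where \<mu>: "p = \<mu> *\<^sub>R axis (Inl k) 1" using p ker_A by (auto simp: span_singleton)
  have "\<mu> \<noteq> 0" using p \<mu> by auto
  have p_eq: "unjoin p = \<mu> *\<^sub>R (e, 0)"
  proof -
    have "p = join (\<mu> *\<^sub>R e, 0)" unfolding join_e \<mu> by (simp add: axis_def vec_eq_iff)
    then show ?thesis by simp
  qed
  have "A *v (A *v q) = 0" using q by (simp add: matrix_vector_mul_assoc)
  then obtain c where Aq: "A *v q = c *\<^sub>R axis (Inl k) 1" using ker_A by (auto simp: span_singleton)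
  have c: "c \<noteq> 0" using q Aq by auto
  define q0 where "q0 = y_part q"
  have Aq': "join_vec (Dh (unjoin q)) (Dg (unjoin q)) = join (c *\<^sub>R e, 0)"
    unfolding A_eq[symmetric] Aq join_e by (simp add: axis_def vec_eq_iff)
  have q_eq: "unjoin q = (q0, L q0)"
  proof -
    have "Dg (y_part q, z_part q) = 0" using Aq' by (simp add: join_def join_vec_eq_iff unjoin_def)
    then show ?thesis using Dg_zero by (simp add: unjoin_def q0_def)
  qed
  have B_q: "B q0 = c *\<^sub>R e" using Aq' by (simp add: q_eq B_def join_def join_vec_eq_iff)
  have B_e: "B e = 0"
  proof -
    have "L e = 0" using F'_e Dg_zero[of e 0] by (simp add: Dg_def)
    then show ?thesis using F'_e by (simp add: B_def Dh_def)
  qed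
  obtain \<pi> :: "real ^ 'r \<Rightarrow> real \<times> real" where \<pi>: "linear \<pi>" "\<pi> e = (1, 0)" "\<pi> q0 = (0, 1)"
    "\<And>y. \<pi> (B y) = (c * snd (\<pi> y), 0)"
    by (rule double_zero_coordinates[OF lin_B e_nz B_e B_q c ker_B pencil_chain_length[OF lin_B AB nz ord ker_A]]) blast+
  have Gi_inj: "z = 0" if "Gi z = 0" for z
    using Gi(2)[of z] that linear_0[OF lin_Dg] by (simp add: zero_prod_def)
  interpret index_one_dae B e q0 c \<pi> L h0 g0 Dh Dg Gi
  proof (intro index_one_dae.intro slow_dae.intro double_zero_splitting.intro slow_dae_axioms.intro
      index_one_dae_axioms.intro)
    fix l v assume v: "v \<noteq> 0" "\<pi> (fst v) = 0" "\<pi> (snd v) = 0" "cB B v = cs l v"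
    have "l \<noteq> 0"
    proof
      assume "l = 0"
      then have "B (fst v) = 0" "B (snd v) = 0" using v(4) by (simp_all add: cB_def[OF lin_B] cs_def)
      then obtain s t where "fst v = s *\<^sub>R e" "snd v = t *\<^sub>R e" using ker_B by (force simp: span_singleton)
      then show False using v(1-3) by (simp add: linear_scale[OF \<pi>(1)] \<pi>(2) prod_eq_iff)
    qed
    then show "Re l \<noteq> 0"
      using hyperbolic pencil_eigenvalue_of_reduced[OF lin_B AB v(1,4)] by blast
  qed (fact lin_B lin_L \<pi> B_e B_q C2_h0 C2_g0 Dh Dg lin_Gi Gi Dg_L c eq0 B_def[symmetric] | erule ker_B Gi_inj)+

  obtain \<Phi> \<delta> K where \<Phi>: "0 < \<delta>" "C2_on UNIV \<Phi>" "\<And>u. \<pi> (fst (\<Phi> u)) = u" "\<Phi> 0 = 0"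
    "\<And>u. norm (\<Phi> u) \<le> \<delta> \<Longrightarrow> g0 (\<Phi> u) = 0"
    "\<And>u D. norm (\<Phi> u) \<le> \<delta> \<Longrightarrow> ((\<lambda>u. fst (\<Phi> u)) has_derivative D) (at u) \<Longrightarrow> D (\<pi> (h0 (\<Phi> u))) = h0 (\<Phi> u)"
    "\<And>s. \<bar>s\<bar> * norm e \<le> \<delta> \<Longrightarrow> \<Phi> (s, 0) = (s *\<^sub>R e, 0)"
    "\<And>x u D. norm x \<le> \<delta> \<Longrightarrow> g0 x = 0 \<Longrightarrow> u = \<pi> (fst x) \<Longrightarrow> norm u \<le> 1 \<Longrightarrow> norm (\<Phi> u) \<le> \<delta> \<Longrightarrow>
       ((\<lambda>u. fst (\<Phi> u)) has_derivative D) (at u) \<Longrightarrow>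
       norm (x - \<Phi> u) \<le> K * norm (fst x - fst (\<Phi> u)) \<and>
       norm (h0 x - D (\<pi> (h0 x))) \<le> K * norm (fst x - fst (\<Phi> u))"
    by (rule center_manifold) blast
  define \<xi> where "\<xi> u = \<pi> (h0 (\<Phi> u))" for u
  \<comment> \<open>\<open>p = \<mu> e\<close>, so the second derivative at \<open>(p, q)\<close> is \<open>\<mu>\<close> times that at \<open>(e, q)\<close>\<close>
  have transversal: "F'' 0 (e, 0) (q0, L q0) \<notin> range (F' 0)"
  proof
    assume "F'' 0 (e, 0) (q0, L q0) \<in> range (F' 0)"
    then obtain x where x: "F'' 0 (e, 0) (q0, L q0) = F' 0 x" by blast
    have "(\<lambda>y. frechet_derivative F (at y) q) = (\<lambda>y. join (F' (unjoin y) (unjoin q)))"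
      using frechet_derivative_at[OF F_deriv] by metis
    moreover have "((\<lambda>y. join (F' (unjoin y) (unjoin q))) has_derivative (\<lambda>v. join (F'' 0 (unjoin v) (unjoin q)))) (at 0)"
    proof -
      have "((\<lambda>y. F' (unjoin y)) has_derivative (\<lambda>v. F'' 0 (unjoin v))) (at 0)"
        using diff_chain_at[OF bounded_linear_imp_has_derivative[OF bounded_linear_unjoin], of F' "F'' 0" 0] F'(2)[of 0]
        by (simp add: o_def unjoin_0)
      then show ?thesis
        by (intro bounded_linear.has_derivative[OF bounded_linear_join] bounded_linear.has_derivative[OF blinfun.bounded_linear_left])
    qed
    ultimately have "second_derivative F 0 p q = join (F'' 0 (unjoin p) (unjoin q))"
      unfolding second_derivative_def using frechet_derivative_at by metis
    also have "F'' 0 (unjoin p) (unjoin q) = \<mu> *\<^sub>R F'' 0 (e, 0) (q0, L q0)"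
      unfolding p_eq q_eq by (simp only: blinfun.scaleR_right blinfun.scaleR_left)
    also have "\<dots> = F' 0 (\<mu> *\<^sub>R x)" unfolding x by (simp only: blinfun.scaleR_right)
    also have "join \<dots> = A *v join (\<mu> *\<^sub>R x)" by (simp add: A_eq join_def[of "blinfun_apply _ _"] Dh_def Dg_def)
    finally show False using transversality by blast
  qed

  note red = reduced_field[where \<Phi>=\<Phi> and \<delta>=\<delta> and F'=F' and F''="F'' 0", folded \<xi>_def]
  have reduced: "C2_on UNIV \<xi>" "\<forall>\<^sub>F s in nhds 0. \<xi> (s, 0) = (0, 0)"
    "deriv (\<lambda>u2. snd (\<xi> (0, u2))) 0 = 0" "deriv (\<lambda>u2. fst (\<xi> (0, u2))) 0 \<noteq> 0"
    "deriv (\<lambda>u1. deriv (\<lambda>u2. snd (\<xi> (u1, u2))) 0) 0 \<noteq> 0"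
  proof -
    show "C2_on UNIV \<xi>" by (rule red(1)) (fact \<Phi> \<Phi>(6)[folded \<xi>_def] F')+
    show "\<forall>\<^sub>F s in nhds 0. \<xi> (s, 0) = (0, 0)" by (rule red(2)) (fact \<Phi> \<Phi>(6)[folded \<xi>_def] F')+
    show "deriv (\<lambda>u2. snd (\<xi> (0, u2))) 0 = 0" by (rule red(3)) (fact \<Phi> \<Phi>(6)[folded \<xi>_def] F')+
    show "deriv (\<lambda>u2. fst (\<xi> (0, u2))) 0 \<noteq> 0" by (rule red(4)) (fact \<Phi> \<Phi>(6)[folded \<xi>_def] F')+
    show "deriv (\<lambda>u1. deriv (\<lambda>u2. snd (\<xi> (u1, u2))) 0) 0 \<noteq> 0"
      by (rule red(5)) (fact \<Phi> \<Phi>(6)[folded \<xi>_def] F' transversal)+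
  qed

  \<comment> \<open>the condition \<open>norm u < 1\<close> bounds the derivatives of \<open>\<Phi>\<close>, as the estimates for invariance require\<close>
  define U where "U = {u. norm u < 1 \<and> norm (\<Phi> u) < \<delta>}"
  define \<phi> where "\<phi> u = join (\<Phi> u)" for u
  obtain \<Phi>' where \<Phi>': "\<And>u. (\<Phi> has_derivative blinfun_apply (\<Phi>' u)) (at u)"
    by (rule C2_onE[OF \<Phi>(2)]) blast
  have cont_\<Phi>: "continuous_on S \<Phi>" for S by (rule continuous_on_of_derivative[OF \<Phi>'])
  have fst_\<Phi>': "((\<lambda>u. fst (\<Phi> u)) has_derivative (\<lambda>a. fst (\<Phi>' u a))) (at u)" for u
    by (rule bounded_linear.has_derivative[OF bounded_linear_fst \<Phi>'])
  have "open U" unfolding U_def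
    by (intro open_Collect_conj open_Collect_less continuous_on_norm continuous_on_const continuous_on_id cont_\<Phi>)
  have "0 \<in> U" using \<Phi>(1,4) by (simp add: U_def)
  have C2_\<phi>: "C2_on UNIV \<phi>" unfolding \<phi>_def[abs_def]
    by (rule C2_on_linear_compose[OF bounded_linear_join \<Phi>(2)])
  have y_\<phi>: "y_part (\<phi> u) = fst (\<Phi> u)" for u by (simp add: \<phi>_def join_def)
  have g_\<phi>: "g (\<phi> u) = 0" if "u \<in> U" for u using \<Phi>(5)[of u] that by (simp add: U_def \<phi>_def g0_def)
  have h_\<phi>: "h (\<phi> u) = h0 (\<Phi> u)" for u by (simp add: \<phi>_def h0_def)
  have cont_\<pi>: "continuous_on S \<pi>" for S by (rule bounded_linear.continuous_on[OF bounded_linear_\<pi> continuous_on_id])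
  have cont_y: "continuous_on S y_part" for S :: "(real ^ ('r + 'p)) set"
    by (rule bounded_linear.continuous_on[OF bounded_linear_y_part continuous_on_id])
  have param: "C2_local_parametrization U \<phi> (\<phi> ` U)"
    unfolding C2_local_parametrization_def
  proof (intro conjI ballI)
    show "C2_on U \<phi>" by (rule C2_on_subset[OF C2_\<phi>]) simp
    show "inj (frechet_derivative \<phi> (at u))" for u
    proof -
      have "(\<phi> has_derivative (\<lambda>a. join (\<Phi>' u a))) (at u)"
        unfolding \<phi>_def[abs_def] by (rule bounded_linear.has_derivative[OF bounded_linear_join \<Phi>'])
      then have fd: "frechet_derivative \<phi> (at u) = (\<lambda>a. join (\<Phi>' u a))" by (rule frechet_derivative_at[symmetric])
      have "((\<lambda>u. \<pi> (fst (\<Phi> u))) has_derivative (\<lambda>a. \<pi> (fst (\<Phi>' u a)))) (at u)"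
        by (rule bounded_linear.has_derivative[OF bounded_linear_\<pi> fst_\<Phi>'])
      then have "((\<lambda>u. u) has_derivative (\<lambda>a. \<pi> (fst (\<Phi>' u a)))) (at u)" by (simp add: \<Phi>(3))
      then have "(\<lambda>a. \<pi> (fst (\<Phi>' u a))) = (\<lambda>a. a)" using has_derivative_ident by (rule has_derivative_unique)
      then have "\<pi> (y_part (join (\<Phi>' u a))) = a" for a
        using fun_cong[of "\<lambda>a. \<pi> (fst (\<Phi>' u a))" "\<lambda>a. a" a] by (simp add: join_def)
      then show ?thesis unfolding fd by (rule inj_on_inverseI)
    qed
    show "\<exists>\<psi>. homeomorphism U (\<phi> ` U) \<phi> \<psi>"
    proof (intro exI[of _ "\<lambda>x. \<pi> (y_part x)"] homeomorphismI)
      show "continuous_on U \<phi>" unfolding \<phi>_def[abs_def]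
        by (rule bounded_linear.continuous_on[OF bounded_linear_join cont_\<Phi>])
      show "continuous_on (\<phi> ` U) (\<lambda>x. \<pi> (y_part x))"
        by (rule continuous_on_compose2[OF cont_\<pi>[of UNIV] cont_y]) simp
    qed (auto simp: y_\<phi> \<Phi>(3))
  qed (use \<open>open U\<close> in auto)
  have surface: "C2_surface (\<phi> ` U)" unfolding C2_surface_def using param by blast
  \<comment> \<open>\<open>V\<close> is open, and a point of \<open>V\<close> is on the surface as soon as it is \<open>\<phi>\<close> of its own centre coordinates\<close>
  define V where "V = {x :: real ^ ('r + 'p). norm (unjoin x) < \<delta>} \<inter> {x. norm (\<pi> (y_part x)) < 1}
      \<inter> {x. norm (\<Phi> (\<pi> (y_part x))) < \<delta>}"
  have invariant: "dae_locally_invariant h g (\<phi> ` U)"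
    unfolding dae_locally_invariant_def
  proof (intro exI[of _ V] conjI allI impI)
    have cont_\<pi>y: "continuous_on UNIV (\<lambda>x :: real ^ ('r + 'p). \<pi> (y_part x))"
      by (rule continuous_on_compose2[OF cont_\<pi>[of UNIV] cont_y]) simp
    have cont_\<Phi>\<pi>: "continuous_on UNIV (\<lambda>x :: real ^ ('r + 'p). \<Phi> (\<pi> (y_part x)))"
      by (rule continuous_on_compose2[OF cont_\<Phi>[of UNIV] cont_\<pi>y]) simp
    have cont_unjoin: "continuous_on UNIV (unjoin :: real ^ ('r + 'p) \<Rightarrow> _)"
      by (rule bounded_linear.continuous_on[OF bounded_linear_unjoin continuous_on_id])
    have "open {x :: real ^ ('r + 'p). norm (unjoin x) < \<delta>}"
      by (rule open_Collect_less[OF continuous_on_norm[OF cont_unjoin] continuous_on_const])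
    moreover have "open {x :: real ^ ('r + 'p). norm (\<pi> (y_part x)) < 1}"
      by (rule open_Collect_less[OF continuous_on_norm[OF cont_\<pi>y] continuous_on_const])
    moreover have "open {x :: real ^ ('r + 'p). norm (\<Phi> (\<pi> (y_part x))) < \<delta>}"
      by (rule open_Collect_less[OF continuous_on_norm[OF cont_\<Phi>\<pi>] continuous_on_const])
    ultimately show "open V" unfolding V_def by (intro open_Int)
    show "\<phi> ` U \<subseteq> V" by (auto simp: V_def U_def y_\<phi> \<Phi>(3)) (simp add: \<phi>_def)
    fix J x assume "is_interval J \<and> dae_solution h g J x \<and> x ` J \<subseteq> V \<and> (\<exists>t\<in>J. x t \<in> \<phi> ` U)"
    then have J: "is_interval J" and sol: "dae_solution h g J x" and V: "\<And>t. t \<in> J \<Longrightarrow> x t \<in> V"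
      and "\<exists>t\<in>J. x t \<in> \<phi> ` U" by blast+
    then obtain t0 u0 where t0: "t0 \<in> J" "x t0 = \<phi> u0" "u0 \<in> U" by blast
    define u where "u t = \<pi> (y_part (x t))" for t
    define w where "w t = y_part (x t) - fst (\<Phi> (u t))" for t
    have est: "norm (unjoin (x t) - \<Phi> (u t)) \<le> K * norm (w t) \<and>
        norm (h (x t) - fst (\<Phi>' (u t) (\<pi> (h (x t))))) \<le> K * norm (w t)" if "t \<in> J" for t
      using \<Phi>(8)[of "unjoin (x t)" "u t", OF _ _ _ _ _ fst_\<Phi>'] V[OF that] sol that
      by (auto simp: V_def u_def w_def h0_def g0_def dae_solution_def)
    have "w t = 0" if "t \<in> J" for t
    proof (rule zero_of_linear_growth[OF J t0(1) _ that, where K=K])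
      show "w t0 = 0" by (simp add: w_def u_def t0 y_\<phi> \<Phi>(3))
      fix t assume t: "t \<in> J"
      have y': "((\<lambda>s. y_part (x s)) has_vector_derivative h (x t)) (at t within J)"
        using sol t by (simp add: dae_solution_def)
      have "(u has_vector_derivative \<pi> (h (x t))) (at t within J)"
        unfolding u_def[abs_def] by (rule bounded_linear.has_vector_derivative[OF bounded_linear_\<pi> y'])
      then have "((\<lambda>s. fst (\<Phi> (u s))) has_vector_derivative fst (\<Phi>' (u t) (\<pi> (h (x t))))) (at t within J)"
        by (rule has_vector_derivative_chain[OF _ fst_\<Phi>'])
      then show "(w has_vector_derivative h (x t) - fst (\<Phi>' (u t) (\<pi> (h (x t))))) (at t within J)"
        unfolding w_def[abs_def] by (intro has_vector_derivative_diff y')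
      show "norm (h (x t) - fst (\<Phi>' (u t) (\<pi> (h (x t))))) \<le> K * norm (w t)" using est[OF t] by blast
    qed
    then have "unjoin (x t) = \<Phi> (u t)" if "t \<in> J" for t using est[OF that] that by simp
    then have "x t = \<phi> (u t)" if "t \<in> J" for t unfolding \<phi>_def using that by (metis join_unjoin)
    moreover have "u t \<in> U" if "t \<in> J" for t using V[OF that] by (simp add: V_def u_def U_def)
    ultimately show "x ` J \<subseteq> \<phi> ` U" by blast
  qed
  have described: "dae_described_by h g U \<phi> \<xi>"
    unfolding dae_described_by_def
  proof (intro allI impI)
    fix J :: "real set" and u :: "real \<Rightarrow> real \<times> real" assume "is_interval J \<and> u ` J \<subseteq> U"
    then have uU: "u t \<in> U" if "t \<in> J" for t using that by blast
    show "dae_solution h g J (\<phi> \<circ> u) \<longleftrightarrow> ode_solution \<xi> J u"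
    proof
      assume sol: "dae_solution h g J (\<phi> \<circ> u)"
      have "(u has_vector_derivative \<xi> (u t)) (at t within J)" if "t \<in> J" for t
      proof -
        have "((\<lambda>s. y_part (\<phi> (u s))) has_vector_derivative h (\<phi> (u t))) (at t within J)"
          using sol that by (simp add: dae_solution_def)
        from bounded_linear.has_vector_derivative[OF bounded_linear_\<pi> this]
        show ?thesis by (simp add: y_\<phi> \<Phi>(3) h_\<phi> \<xi>_def)
      qed
      then show "ode_solution \<xi> J u" by (simp add: ode_solution_def)
    next
      assume "ode_solution \<xi> J u"
      then have u': "(u has_vector_derivative \<xi> (u t)) (at t within J)" if "t \<in> J" for t
        using that by (simp add: ode_solution_def)
      have "continuous_on J u"
        unfolding continuous_on_eq_continuous_within
        by (intro ballI has_vector_derivative_continuous[OF u'])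
      then have "continuous_on J (\<phi> \<circ> u)"
        unfolding \<phi>_def[abs_def] o_def
        by (intro bounded_linear.continuous_on[OF bounded_linear_join] continuous_on_compose2[OF cont_\<Phi>[of UNIV]]) auto
      moreover have "((\<lambda>s. y_part ((\<phi> \<circ> u) s)) has_vector_derivative h ((\<phi> \<circ> u) t)) (at t within J)" if t: "t \<in> J" for t
      proof -
        have "((\<lambda>s. fst (\<Phi> (u s))) has_vector_derivative fst (\<Phi>' (u t) (\<xi> (u t)))) (at t within J)"
          by (rule has_vector_derivative_chain[OF u'[OF t] fst_\<Phi>'])
        moreover have "fst (\<Phi>' (u t) (\<xi> (u t))) = h0 (\<Phi> (u t))"
          using \<Phi>(6)[OF _ fst_\<Phi>'] uU[OF t] by (simp add: U_def \<xi>_def)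
        ultimately show ?thesis by (simp add: y_\<phi> h_\<phi>)
      qed
      ultimately show "dae_solution h g J (\<phi> \<circ> u)" unfolding dae_solution_def using g_\<phi> uU by simp
    qed
  qed
  have "\<phi> (0, 0) = 0"
    using \<Phi>(4) linear_0[OF bounded_linear.linear[OF bounded_linear_join]] by (simp add: \<phi>_def zero_prod_def)
  then have "0 \<in> \<phi> ` U" using \<open>0 \<in> U\<close> by (metis imageI zero_prod_def)
  show ?thesis
    by (rule exI[of _ "\<phi> ` U"], rule exI[of _ U], rule exI[of _ \<phi>], rule exI[of _ \<xi>], intro conjI)
      (use g_\<phi> \<open>0 \<in> \<phi> ` U\<close> surface invariant param \<open>0 \<in> U\<close> \<open>\<phi> (0, 0) = 0\<close> C2_on_subset[OF reduced(1)] described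
          reduced(2-5) in \<open>auto simp: zero_prod_def\<close>)
qed

end
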